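(* Let $g \in \mathrm{BMOA}$ and let $1 \le p < \infty$ with $p \neq 2$. If $M \subset H^p$ is an infinite-dimensional closed subspace and the restriction of $T_g$ to $M$ is bounded below (i.e. there is $c>0$ with $\|T_g f\|_{H^p} \ge c\|f\|_{H^p}$ for all $f \in M$), then $M$ contains a closed subspace linearly isomorphic to $\ell^p$.
   Context: $\mathbb{D}$ is the open unit disc and $\mathbb{T}=\partial\mathbb{D}$. For $0<p<\infty$, $H^p$ is the Hardy space of analytic functions on $\mathbb{D}$. For $a\in\mathbb{D}$ let $\sigma_a(z)=\frac{a-z}{1-\bar a z}$. $\mathrm{BMOA}$ is the space of analytic $f\colon\mathbb{D}\to\mathbb{C}$ with $\sup_{a\in\mathbb{D}}\|f\circ\sigma_a-f(a)\|_{H^2}<\infty$. For an analytic $g$ on $\mathbb{D}$, the generalised Volterra operator is $T_g f(z)=\int_0^z f(w)g'(w)\,dw$, $z\in\mathbb{D}$; for $g\in\mathrm{BMOA}$ it is bounded $H^p\to H^p$. *)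

theory Defs
  imports "HOL-Analysis.Analysis"
begin

definition hardy_mean :: "real \<Rightarrow> (complex \<Rightarrow> complex) \<Rightarrow> real \<Rightarrow> real" where
  "hardy_mean p f r = (1 / (2 * pi)) * integral {0..2*pi} (\<lambda>\<theta>. norm (f (of_real r * cis \<theta>)) powr p)"

definition hardy_norm :: "real \<Rightarrow> (complex \<Rightarrow> complex) \<Rightarrow> real" where
  "hardy_norm p f = (SUP r\<in>{0..<1}. hardy_mean p f r) powr (1 / p)"

text \<open>Elements of H^p are represented by functions that are holomorphic on the
  disc and (normalised to be) zero outside it.\<close>
definition hardy :: "real \<Rightarrow> (complex \<Rightarrow> complex) set" where
  "hardy p = {f. f holomorphic_on ball 0 1 \<and> (\<forall>z. z \<notin> ball 0 1 \<longrightarrow> f z = 0) \<and>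
                 bdd_above ((\<lambda>r. hardy_mean p f r) ` {0..<1})}"

definition disc_aut :: "complex \<Rightarrow> complex \<Rightarrow> complex" where
  "disc_aut a z = (a - z) / (1 - cnj a * z)"

definition BMOA :: "(complex \<Rightarrow> complex) set" where
  "BMOA = {g. g holomorphic_on ball 0 1 \<and>
     bdd_above {hardy_mean 2 (\<lambda>z. g (disc_aut a z) - g a) r | a r. a \<in> ball 0 1 \<and> 0 \<le> r \<and> r < 1}}"

text \<open>Generalised Volterra operator; the integral over the segment [0,z] is
  parametrised by w = t z, t in [0,1]. Normalised to be zero outside the disc.\<close>
definition volterra :: "(complex \<Rightarrow> complex) \<Rightarrow> (complex \<Rightarrow> complex) \<Rightarrow> complex \<Rightarrow> complex" where
  "volterra g f z = (if z \<in> ball 0 1 then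
      integral {0..1} (\<lambda>t::real. f (of_real t * z) * deriv g (of_real t * z) * z) else 0)"

definition complex_subspace :: "(complex \<Rightarrow> complex) set \<Rightarrow> bool" where
  "complex_subspace M \<longleftrightarrow> (\<lambda>z. 0) \<in> M \<and> (\<forall>f\<in>M. \<forall>h\<in>M. (\<lambda>z. f z + h z) \<in> M) \<and>
     (\<forall>c. \<forall>f\<in>M. (\<lambda>z. c * f z) \<in> M)"

definition hardy_closed :: "real \<Rightarrow> (complex \<Rightarrow> complex) set \<Rightarrow> bool" where
  "hardy_closed p M \<longleftrightarrow> (\<forall>F f. (\<forall>n. F n \<in> M) \<and> f \<in> hardy p \<and>
       (\<lambda>n. hardy_norm p (\<lambda>z. F n z - f z)) \<longlonglongrightarrow> 0 \<longrightarrow> f \<in> M)"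

definition infinite_dimensional :: "(complex \<Rightarrow> complex) set \<Rightarrow> bool" where
  "infinite_dimensional M \<longleftrightarrow> (\<forall>n::nat. \<exists>F::nat \<Rightarrow> complex \<Rightarrow> complex. (\<forall>i<n. F i \<in> M) \<and>
      (\<forall>c. (\<lambda>z. \<Sum>i<n. c i * F i z) = (\<lambda>z. 0) \<longrightarrow> (\<forall>i<n. c i = 0)))"

definition lp_space :: "real \<Rightarrow> (nat \<Rightarrow> complex) set" where
  "lp_space p = {x. summable (\<lambda>n. norm (x n) powr p)}"

definition lp_norm :: "real \<Rightarrow> (nat \<Rightarrow> complex) \<Rightarrow> real" where
  "lp_norm p x = (\<Sum>n. norm (x n) powr p) powr (1 / p)"

definition iso_to_lp :: "real \<Rightarrow> (complex \<Rightarrow> complex) set \<Rightarrow> bool" where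
  "iso_to_lp p N \<longleftrightarrow> (\<exists>\<Phi> :: (nat \<Rightarrow> complex) \<Rightarrow> complex \<Rightarrow> complex. \<exists>A B.
      0 < A \<and> 0 < B \<and> bij_betw \<Phi> (lp_space p) N \<and>
      (\<forall>x\<in>lp_space p. \<forall>y\<in>lp_space p. \<forall>a b.
          \<Phi> (\<lambda>n. a * x n + b * y n) = (\<lambda>z. a * \<Phi> x z + b * \<Phi> y z)) \<and>
      (\<forall>x\<in>lp_space p. A * lp_norm p x \<le> hardy_norm p (\<Phi> x) \<and> hardy_norm p (\<Phi> x) \<le> B * lp_norm p x))"

end

theory Submission
  imports Defs "HOL-Complex_Analysis.Complex_Analysis"
begin

text \<open>Write \<open>T\<close> for the Volterra operator of \<open>g\<close>, and let \<open>q\<close> be given by \<open>1/q = 1/p + 1/2\<close>. The operator \<open>T\<close> is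
  bounded on \<open>H\<^sup>p\<close>, and it is compact from \<open>H\<^sup>p\<close> to \<open>H\<^sup>q\<close>, because \<open>g\<close> is a limit in \<open>H\<^sup>2\<close> of functions
  with bounded derivative. Both facts are proved by comparing Laplacians: a \<open>C\<^sup>2\<close> function with nonnegative
  Laplacian has increasing circle means. The BMOA condition enters through a bounded function with
  Laplacian \<open>4 |g'|\<^sup>2\<close>, namely \<open>|g|\<^sup>2\<close> minus its Poisson integral.

  Since \<open>M\<close> is infinite-dimensional, it contains unit vectors \<open>f n\<close> vanishing at 0 to arbitrarily high order. Their images
  tend to 0 in \<open>H\<^sup>q\<close>, but not in \<open>H\<^sup>p\<close>, so a suitable choice makes the images almost disjoint. Hence the
  images span a copy of \<open>\<ell>\<^sup>p\<close>, and so do the \<open>f n\<close>, because \<open>T\<close> is an isomorphism from \<open>M\<close> onto its image.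
  Almost disjointness is measured uniformly on the circles of radius \<open>r < 1\<close>, which avoids boundary values.\<close>

subsection \<open>Laplacians\<close>

text \<open>The exponent \<open>q\<close> is dictated by Hoelder's inequality: a symbol that is
  small in H^2 acts with small norm from H^p to H^q. The target has to be weakened because a
  function in BMOA is in general no limit of smooth functions in the BMOA norm, only in H^2. Vectors
  whose images are small in H^q but not in H^p have images concentrated on sets of small measure.
  This is the Kadec-Pelczynski alternative, and functions concentrated on ever smaller sets behave
  like disjointly supported ones. Laplacians are taken in the logarithmic coordinate w with z = exp
  w. There a circle becomes a vertical segment, periodicity in the angle does the work of Green's
  formula, and derivatives carry the factor z. The potential of \<open>g\<close> is built on discs
  of radius R < 1 with a bound independent of R, so every estimate is made on a circle of radius r <
  R < 1 with constants that do not depend on r. Estimates are stated for p-th powers of norms, with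
  factors \<open>2 powr p\<close> in place of Minkowski's inequality, which is enough for an
  isomorphism.\<close>

definition dir_deriv :: "complex \<Rightarrow> (complex \<Rightarrow> real) \<Rightarrow> (complex \<Rightarrow> real) \<Rightarrow> complex set \<Rightarrow> bool" where
  "dir_deriv u Y Y' S \<longleftrightarrow> continuous_on S Y' \<and>
     (\<forall>w\<in>S. ((\<lambda>t::real. Y (w + of_real t * u)) has_real_derivative Y' w) (at 0))"

text \<open>The first partials are parameters because the chain rule needs the squared gradient. The
  pure second partials are hidden, since only their sum \<open>L\<close> is used. All of them are
  continuous, which permits differentiation under the integral sign.\<close>

definition has_lap :: "(complex \<Rightarrow> real) \<Rightarrow> (complex \<Rightarrow> real) \<Rightarrow> (complex \<Rightarrow> real) \<Rightarrow>
    (complex \<Rightarrow> real) \<Rightarrow> complex set \<Rightarrow> bool" where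
  "has_lap Y Yx Yy L S \<longleftrightarrow> continuous_on S Y \<and>
     (\<exists>Yxx Yyy. dir_deriv 1 Y Yx S \<and> dir_deriv \<i> Y Yy S \<and> dir_deriv 1 Yx Yxx S \<and> dir_deriv \<i> Yy Yyy S \<and>
       (\<forall>w\<in>S. L w = Yxx w + Yyy w))"

lemma dir_deriv_const: "dir_deriv u (\<lambda>w. c) (\<lambda>w. 0) S"
  by (simp add: dir_deriv_def)

lemma dir_deriv_add:
  assumes "dir_deriv u Y Y' S" "dir_deriv u Z Z' S"
  shows "dir_deriv u (\<lambda>w. Y w + Z w) (\<lambda>w. Y' w + Z' w) S"
  using assms unfolding dir_deriv_def
  by (auto intro!: continuous_intros derivative_eq_intros)

lemma dir_deriv_cmult:
  assumes "dir_deriv u Y Y' S"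
  shows "dir_deriv u (\<lambda>w. c * Y w) (\<lambda>w. c * Y' w) S"
  using assms unfolding dir_deriv_def
  by (auto intro!: continuous_intros derivative_eq_intros)

lemma dir_deriv_mult:
  assumes "dir_deriv u Y Y' S" "dir_deriv u Z Z' S" "continuous_on S Y" "continuous_on S Z"
  shows "dir_deriv u (\<lambda>w. Y w * Z w) (\<lambda>w. Y' w * Z w + Y w * Z' w) S"
  using assms unfolding dir_deriv_def
  by (auto intro!: continuous_intros derivative_eq_intros)

lemma dir_deriv_compose:
  assumes "dir_deriv u Y Y' S" "continuous_on S Y"
    and "\<And>w. w \<in> S \<Longrightarrow> Y w \<in> I" "continuous_on I \<psi>'"
    and "\<And>x. x \<in> I \<Longrightarrow> (\<psi> has_real_derivative \<psi>' x) (at x)"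
  shows "dir_deriv u (\<lambda>w. \<psi> (Y w)) (\<lambda>w. \<psi>' (Y w) * Y' w) S"
  unfolding dir_deriv_def
proof (intro conjI ballI)
  show "continuous_on S (\<lambda>w. \<psi>' (Y w) * Y' w)"
    using assms unfolding dir_deriv_def
    by (auto intro!: continuous_intros continuous_on_compose2[OF assms(4), of S Y])
  fix w assume w: "w \<in> S"
  have "(\<psi> has_real_derivative \<psi>' (Y w)) (at (Y (w + of_real 0 * u)))"
    using assms(5)[OF assms(3)[OF w]] by simp
  then show "((\<lambda>t. \<psi> (Y (w + complex_of_real t * u))) has_real_derivative \<psi>' (Y w) * Y' w) (at 0)"
    using assms(1) w unfolding dir_deriv_def by (intro DERIV_chain2[of \<psi>]) auto
qed

lemma dir_deriv_Re_holomorphic: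
  assumes "f holomorphic_on S" "open S"
  shows "dir_deriv u (\<lambda>w. Re (f w)) (\<lambda>w. Re (deriv f w * u)) S"
  unfolding dir_deriv_def
proof (intro conjI ballI)
  show "continuous_on S (\<lambda>w. Re (deriv f w * u))"
    by (intro continuous_intros holomorphic_on_imp_continuous_on holomorphic_deriv assms)
  fix w assume w: "w \<in> S"
  have "(f has_field_derivative deriv f w) (at (w + of_real 0 * u))"
    using holomorphic_derivI[OF assms w] by simp
  then have "((\<lambda>t::real. f (w + of_real t * u)) has_vector_derivative (u * deriv f w)) (at 0)"
    by (intro field_vector_diff_chain_at[where g=f and f="\<lambda>t::real. w + of_real t * u", unfolded o_def])
      (auto intro!: derivative_eq_intros simp: has_vector_derivative_def scaleR_conv_of_real fun_eq_iff)
  then have "((\<lambda>t::real. Re (f (w + of_real t * u))) has_vector_derivative Re (u * deriv f w)) (at 0)"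
    by (rule bounded_linear.has_vector_derivative[OF bounded_linear_Re])
  then show "((\<lambda>t. Re (f (w + complex_of_real t * u))) has_real_derivative Re (deriv f w * u)) (at 0)"
    by (simp add: has_real_derivative_iff_has_vector_derivative mult.commute)
qed

lemma dir_deriv_cong:
  assumes "dir_deriv u Y Y' S" "open S" "\<And>w. w \<in> S \<Longrightarrow> Y w = Z w" "\<And>w. w \<in> S \<Longrightarrow> Y' w = Z' w"
  shows "dir_deriv u Z Z' S"
  unfolding dir_deriv_def
proof (intro conjI ballI)
  show "continuous_on S Z'"
    using assms(1,4) continuous_on_cong[of S S Y' Z'] by (auto simp: dir_deriv_def)
  fix w assume w: "w \<in> S"
  have "open ((\<lambda>t::real. w + of_real t * u) -` S)"
    by (rule open_vimage[OF assms(2)]) (intro continuous_intros)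
  then have "\<forall>\<^sub>F t::real in nhds 0. t \<in> (\<lambda>t::real. w + of_real t * u) -` S"
    by (rule eventually_nhds_in_open) (use w in auto)
  then have ev: "\<forall>\<^sub>F t::real in nhds 0. Y (w + of_real t * u) = Z (w + of_real t * u)"
    by eventually_elim (use assms(3) in auto)
  show "((\<lambda>t. Z (w + complex_of_real t * u)) has_real_derivative Z' w) (at 0)"
    using DERIV_cong_ev[OF refl ev assms(4)[OF w]] assms(1) w unfolding dir_deriv_def by blast
qed

lemma has_lap_cong:
  assumes "has_lap Y Yx Yy L S" "open S" "\<And>w. w \<in> S \<Longrightarrow> Y w = Z w"
    "\<And>w. w \<in> S \<Longrightarrow> Yx w = Zx w" "\<And>w. w \<in> S \<Longrightarrow> Yy w = Zy w" "\<And>w. w \<in> S \<Longrightarrow> L w = L' w"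
  shows "has_lap Z Zx Zy L' S"
proof -
  obtain Yxx Yyy where Y: "dir_deriv 1 Y Yx S" "dir_deriv \<i> Y Yy S" "dir_deriv 1 Yx Yxx S" "dir_deriv \<i> Yy Yyy S"
       "\<forall>w\<in>S. L w = Yxx w + Yyy w" "continuous_on S Y"
    using assms(1) unfolding has_lap_def by blast
  show ?thesis unfolding has_lap_def
  proof (intro conjI exI)
    show "continuous_on S Z" using Y(6) assms(3) continuous_on_cong[of S S Y Z] by auto
    show "dir_deriv 1 Z Zx S" by (rule dir_deriv_cong[OF Y(1) assms(2)]) (use assms in auto)
    show "dir_deriv \<i> Z Zy S" by (rule dir_deriv_cong[OF Y(2) assms(2)]) (use assms in auto)
    show "dir_deriv 1 Zx Yxx S" by (rule dir_deriv_cong[OF Y(3) assms(2)]) (use assms in auto)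
    show "dir_deriv \<i> Zy Yyy S" by (rule dir_deriv_cong[OF Y(4) assms(2)]) (use assms in auto)
    show "\<forall>w\<in>S. L' w = Yxx w + Yyy w" using Y(5) assms(6) by auto
  qed
qed

lemma has_lap_const: "has_lap (\<lambda>w. c) (\<lambda>w. 0) (\<lambda>w. 0) (\<lambda>w. 0) S"
  unfolding has_lap_def by (auto intro!: exI[of _ "\<lambda>w. 0"] dir_deriv_const)

lemma has_lap_add:
  assumes "has_lap Y Yx Yy L S" "has_lap Z Zx Zy L' S"
  shows "has_lap (\<lambda>w. Y w + Z w) (\<lambda>w. Yx w + Zx w) (\<lambda>w. Yy w + Zy w) (\<lambda>w. L w + L' w) S"
proof -
  obtain Yxx Yyy where Y: "dir_deriv 1 Y Yx S" "dir_deriv \<i> Y Yy S" "dir_deriv 1 Yx Yxx S" "dir_deriv \<i> Yy Yyy S"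
       "\<forall>w\<in>S. L w = Yxx w + Yyy w" "continuous_on S Y"
    using assms(1) unfolding has_lap_def by blast
  obtain Zxx Zyy where Z: "dir_deriv 1 Z Zx S" "dir_deriv \<i> Z Zy S" "dir_deriv 1 Zx Zxx S" "dir_deriv \<i> Zy Zyy S"
       "\<forall>w\<in>S. L' w = Zxx w + Zyy w" "continuous_on S Z"
    using assms(2) unfolding has_lap_def by blast
  show ?thesis unfolding has_lap_def
    by (intro conjI continuous_intros exI[of _ "\<lambda>w. Yxx w + Zxx w"] exI[of _ "\<lambda>w. Yyy w + Zyy w"]
        dir_deriv_add Y Z ballI) (use Y Z in auto)
qed

lemma has_lap_cmult:
  assumes "has_lap Y Yx Yy L S"
  shows "has_lap (\<lambda>w. c * Y w) (\<lambda>w. c * Yx w) (\<lambda>w. c * Yy w) (\<lambda>w. c * L w) S"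
proof -
  obtain Yxx Yyy where Y: "dir_deriv 1 Y Yx S" "dir_deriv \<i> Y Yy S" "dir_deriv 1 Yx Yxx S" "dir_deriv \<i> Yy Yyy S"
       "\<forall>w\<in>S. L w = Yxx w + Yyy w" "continuous_on S Y"
    using assms(1) unfolding has_lap_def by blast
  show ?thesis unfolding has_lap_def
    by (intro conjI continuous_intros exI[of _ "\<lambda>w. c * Yxx w"] exI[of _ "\<lambda>w. c * Yyy w"]
        dir_deriv_cmult Y ballI) (use Y in \<open>auto simp: algebra_simps\<close>)
qed

lemma has_lap_compose:
  assumes "has_lap Y Yx Yy L S" and I: "\<And>w. w \<in> S \<Longrightarrow> Y w \<in> I" and c2: "continuous_on I \<psi>''"
    and d1: "\<And>x. x \<in> I \<Longrightarrow> (\<psi> has_real_derivative \<psi>' x) (at x)"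
    and d2: "\<And>x. x \<in> I \<Longrightarrow> (\<psi>' has_real_derivative \<psi>'' x) (at x)"
  shows "has_lap (\<lambda>w. \<psi> (Y w)) (\<lambda>w. \<psi>' (Y w) * Yx w) (\<lambda>w. \<psi>' (Y w) * Yy w)
           (\<lambda>w. \<psi>' (Y w) * L w + \<psi>'' (Y w) * ((Yx w)\<^sup>2 + (Yy w)\<^sup>2)) S"
proof -
  obtain Yxx Yyy where Y: "dir_deriv 1 Y Yx S" "dir_deriv \<i> Y Yy S" "dir_deriv 1 Yx Yxx S" "dir_deriv \<i> Yy Yyy S"
       "\<forall>w\<in>S. L w = Yxx w + Yyy w" "continuous_on S Y"
    using assms(1) unfolding has_lap_def by blast
  have c1: "continuous_on I \<psi>'" and c0: "continuous_on I \<psi>"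
    using d1 d2 by (meson DERIV_continuous continuous_at_imp_continuous_on)+
  have cY: "continuous_on S (\<lambda>w. \<psi> (Y w))" "continuous_on S (\<lambda>w. \<psi>' (Y w))"
    using I Y(6) by (auto intro!: continuous_on_compose2[OF c0] continuous_on_compose2[OF c1])
  have c: "continuous_on S Yx" "continuous_on S Yy"
    using Y unfolding dir_deriv_def by auto
  show ?thesis unfolding has_lap_def
  proof (intro conjI exI)
    show "continuous_on S (\<lambda>w. \<psi> (Y w))" by fact
    show "dir_deriv 1 (\<lambda>w. \<psi> (Y w)) (\<lambda>w. \<psi>' (Y w) * Yx w) S"
      by (rule dir_deriv_compose[OF Y(1) Y(6) I c1 d1])
    show "dir_deriv \<i> (\<lambda>w. \<psi> (Y w)) (\<lambda>w. \<psi>' (Y w) * Yy w) S"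
      by (rule dir_deriv_compose[OF Y(2) Y(6) I c1 d1])
    show "dir_deriv 1 (\<lambda>w. \<psi>' (Y w) * Yx w) (\<lambda>w. (\<psi>'' (Y w) * Yx w) * Yx w + \<psi>' (Y w) * Yxx w) S"
      by (rule dir_deriv_mult[OF dir_deriv_compose[OF Y(1) Y(6) I c2 d2] Y(3) cY(2) c(1)])
    show "dir_deriv \<i> (\<lambda>w. \<psi>' (Y w) * Yy w) (\<lambda>w. (\<psi>'' (Y w) * Yy w) * Yy w + \<psi>' (Y w) * Yyy w) S"
      by (rule dir_deriv_mult[OF dir_deriv_compose[OF Y(2) Y(6) I c2 d2] Y(4) cY(2) c(2)])
    show "\<forall>w\<in>S. \<psi>' (Y w) * L w + \<psi>'' (Y w) * ((Yx w)\<^sup>2 + (Yy w)\<^sup>2) =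
      (\<psi>'' (Y w) * Yx w) * Yx w + \<psi>' (Y w) * Yxx w + ((\<psi>'' (Y w) * Yy w) * Yy w + \<psi>' (Y w) * Yyy w)"
      using Y(5) by (auto simp: algebra_simps power2_eq_square)
  qed
qed

text \<open>Differentiating twice in the direction \<i> gives \<i>^2 = -1 times what two
  differentiations in the direction 1 give, so the two second partials cancel.\<close>

lemma has_lap_Re_holomorphic:
  assumes "f holomorphic_on S" "open S"
  shows "has_lap (\<lambda>w. Re (f w)) (\<lambda>w. Re (deriv f w)) (\<lambda>w. - Im (deriv f w)) (\<lambda>w. 0) S"
proof -
  have *: "deriv f holomorphic_on S" "(\<lambda>w. deriv f w * \<i>) holomorphic_on S"
    using assms by (auto intro!: holomorphic_intros)
  have d: "deriv (\<lambda>w. deriv f w * \<i>) w = deriv (deriv f) w * \<i>" if "w \<in> S" for w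
    by (rule DERIV_imp_deriv) (auto intro!: derivative_eq_intros holomorphic_derivI[OF *(1) assms(2) that])
  show ?thesis unfolding has_lap_def
    using dir_deriv_Re_holomorphic[OF assms, of 1] dir_deriv_Re_holomorphic[OF assms, of \<i>]
      dir_deriv_Re_holomorphic[OF *(1) assms(2), of 1] dir_deriv_Re_holomorphic[OF *(2) assms(2), of \<i>]
    by (intro conjI exI[of _ "\<lambda>w. Re (deriv (deriv f) w * 1)"] exI[of _ "\<lambda>w. Re (deriv (\<lambda>w. deriv f w * \<i>) w * \<i>)"]
        continuous_intros holomorphic_on_imp_continuous_on assms) (auto simp: d)
qed

text \<open>As Im f = Re (- \<i> f), |f|^2 is a sum of squares of two harmonic functions. The square
  of a harmonic function has twice the squared gradient as its Laplacian, and by the Cauchy-Riemann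
  equations each squared gradient is |f'|^2.\<close>

lemma has_lap_norm_sq:
  assumes "f holomorphic_on S" "open S"
  shows "has_lap (\<lambda>w. (norm (f w))\<^sup>2) (\<lambda>w. 2 * Re (f w) * Re (deriv f w) + 2 * Im (f w) * Im (deriv f w))
     (\<lambda>w. - 2 * Re (f w) * Im (deriv f w) + 2 * Im (f w) * Re (deriv f w)) (\<lambda>w. 4 * (norm (deriv f w))\<^sup>2) S"
proof -
  have sq: "has_lap (\<lambda>w. (Re (h w))\<^sup>2) (\<lambda>w. 2 * Re (h w) * Re (deriv h w)) (\<lambda>w. 2 * Re (h w) * - Im (deriv h w))
       (\<lambda>w. 2 * Re (h w) * 0 + 2 * ((Re (deriv h w))\<^sup>2 + (- Im (deriv h w))\<^sup>2)) S"
    if h: "h holomorphic_on S" for h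
    by (rule has_lap_compose[OF has_lap_Re_holomorphic[OF h assms(2)], where I=UNIV and \<psi>="\<lambda>x. x\<^sup>2" and \<psi>'="\<lambda>x. 2 * x" and \<psi>''="\<lambda>x. 2"])
       (auto intro!: derivative_eq_intros)
  have h: "(\<lambda>w. - (\<i> * f w)) holomorphic_on S" using assms by (auto intro!: holomorphic_intros)
  have d: "deriv (\<lambda>w. - (\<i> * f w)) w = - (\<i> * deriv f w)" if "w \<in> S" for w
    by (rule DERIV_imp_deriv) (auto intro!: derivative_eq_intros holomorphic_derivI[OF assms that])
  have f: "has_lap (\<lambda>w. (Re (f w))\<^sup>2 + (Re (- (\<i> * f w)))\<^sup>2)
      (\<lambda>w. 2 * Re (f w) * Re (deriv f w) + 2 * Re (- (\<i> * f w)) * Re (deriv (\<lambda>w. - (\<i> * f w)) w))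
      (\<lambda>w. 2 * Re (f w) * - Im (deriv f w) + 2 * Re (- (\<i> * f w)) * - Im (deriv (\<lambda>w. - (\<i> * f w)) w))
      (\<lambda>w. 2 * Re (f w) * 0 + 2 * ((Re (deriv f w))\<^sup>2 + (- Im (deriv f w))\<^sup>2) +
        (2 * Re (- (\<i> * f w)) * 0 + 2 * ((Re (deriv (\<lambda>w. - (\<i> * f w)) w))\<^sup>2 + (- Im (deriv (\<lambda>w. - (\<i> * f w)) w))\<^sup>2))) S"
    by (rule has_lap_add[OF sq[OF assms(1)] sq[OF h]])
  show ?thesis
    by (rule has_lap_cong[OF f assms(2)]) (auto simp: d cmod_power2)
qed

subsection \<open>Circle means and subharmonicity\<close>

definition cmean :: "(complex \<Rightarrow> real) \<Rightarrow> real \<Rightarrow> real" where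
  "cmean W r = (1 / (2 * pi)) * integral {0..2*pi} (\<lambda>\<theta>. W (of_real r * cis \<theta>))"

lemma hardy_mean_eq_cmean: "hardy_mean p f r = cmean (\<lambda>z. norm (f z) powr p) r"
  by (simp add: hardy_mean_def cmean_def)

lemma cmean_integrable:
  fixes W :: "complex \<Rightarrow> real"
  assumes "continuous_on (sphere 0 r) W" "0 \<le> r"
  shows "(\<lambda>\<theta>. W (of_real r * cis \<theta>)) integrable_on {0..2*pi}" "continuous_on {0..2*pi} (\<lambda>\<theta>. W (of_real r * cis \<theta>))"
proof -
  show *: "continuous_on {0..2*pi} (\<lambda>\<theta>. W (of_real r * cis \<theta>))"
    by (rule continuous_on_compose2[OF assms(1)]) (use assms(2) in \<open>auto intro!: continuous_intros simp: norm_mult\<close>)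
  show "(\<lambda>\<theta>. W (of_real r * cis \<theta>)) integrable_on {0..2*pi}"
    by (rule integrable_continuous_real[OF *])
qed

lemma cmean_const [simp]: "cmean (\<lambda>z. c) r = c"
  by (simp add: cmean_def)

lemma cmean_zero_radius [simp]: "cmean W 0 = W 0"
  by (simp add: cmean_def)

lemma cmean_cmult: "cmean (\<lambda>z. c * W z) r = c * cmean W r"
  by (simp add: cmean_def)

lemma cmean_uminus: "cmean (\<lambda>z. - W z) r = - cmean W r"
  by (simp add: cmean_def)

lemma cmean_add:
  assumes "continuous_on (sphere 0 r) W" "continuous_on (sphere 0 r) V" "0 \<le> r"
  shows "cmean (\<lambda>z. W z + V z) r = cmean W r + cmean V r"
  using cmean_integrable(1)[OF assms(1,3)] cmean_integrable(1)[OF assms(2,3)]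
  by (simp add: cmean_def integral_add ring_distribs)

lemma cmean_sum:
  assumes "finite A" "\<And>i. i \<in> A \<Longrightarrow> continuous_on (sphere 0 r) (W i)" "0 \<le> r"
  shows "cmean (\<lambda>z. \<Sum>i\<in>A. W i z) r = (\<Sum>i\<in>A. cmean (W i) r)"
  using cmean_integrable(1)[OF assms(2,3)] assms(1)
  by (simp add: cmean_def integral_sum sum_distrib_left)

lemma cmean_mono:
  assumes "continuous_on (sphere 0 r) W" "continuous_on (sphere 0 r) V" "0 \<le> r"
    "\<And>z. norm z = r \<Longrightarrow> W z \<le> V z"
  shows "cmean W r \<le> cmean V r"
  unfolding cmean_def
  by (intro mult_left_mono integral_le cmean_integrable assms(1,2,3)) (use assms(3,4) in \<open>auto simp: norm_mult\<close>)

lemma cmean_cong: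
  assumes "0 \<le> r" "\<And>z. norm z = r \<Longrightarrow> W z = V z"
  shows "cmean W r = cmean V r"
  unfolding cmean_def using assms by (auto simp: norm_mult intro!: arg_cong[of _ _ "\<lambda>x. x / _"] integral_cong)

lemma cmean_nonneg:
  assumes "0 \<le> r" "\<And>z. norm z = r \<Longrightarrow> 0 \<le> W z"
  shows "0 \<le> cmean W r"
proof (cases "(\<lambda>\<theta>. W (of_real r * cis \<theta>)) integrable_on {0..2*pi}")
  case True
  then show ?thesis unfolding cmean_def
    by (intro mult_nonneg_nonneg integral_nonneg) (use assms in \<open>auto simp: norm_mult\<close>)
qed (simp add: cmean_def not_integrable_integral)

text \<open>With exp w = z and w = \<sigma> + \<i>\<theta>, the mean over |z| = exp \<sigma> is an
  integral over \<theta>. Periodicity removes the contribution of \<open>Yyy\<close>, so the mean is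
  a convex function of \<sigma>. Continuity of \<open>W\<close> at 0 keeps it bounded as \<sigma>
  tends to minus infinity, and a convex function bounded above there is nondecreasing.\<close>

lemma cmean_mono_lap:
  fixes W :: "complex \<Rightarrow> real"
  assumes lap: "has_lap (\<lambda>w. W (exp w)) Yx Yy L {w. Re w < b}"
    and L: "\<And>w. Re w < b \<Longrightarrow> 0 \<le> L w"
    and cont: "isCont W 0" and sr: "0 \<le> s" "s \<le> r" "r < exp b"
  shows "cmean W s \<le> cmean W r"
proof -
  let ?S = "{w. Re w < b}"
  define Y where "Y = (\<lambda>w. W (exp w))"
  define E where "E = (\<lambda>\<sigma> \<theta>::real. complex_of_real \<sigma> + \<i> * of_real \<theta>)"
  obtain Yxx Yyy where dd: "dir_deriv 1 Y Yx ?S" "dir_deriv \<i> Y Yy ?S" "dir_deriv 1 Yx Yxx ?S" "dir_deriv \<i> Yy Yyy ?S"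
       "\<forall>w\<in>?S. L w = Yxx w + Yyy w" and cY: "continuous_on ?S Y"
    using lap unfolding has_lap_def Y_def by blast
  have ES: "E \<sigma> \<theta> \<in> ?S" if "\<sigma> < b" for \<sigma> \<theta> using that by (simp add: E_def)
  have dx: "((\<lambda>\<sigma>. G (E \<sigma> \<theta>)) has_real_derivative G' (E \<sigma> \<theta>)) (at \<sigma>)"
    if "dir_deriv 1 G G' ?S" "\<sigma> < b" for G G' \<sigma> \<theta>
  proof -
    have "((\<lambda>t. G (E \<sigma> \<theta> + of_real t * 1)) has_real_derivative G' (E \<sigma> \<theta>)) (at 0)"
      using that ES[OF that(2), of \<theta>] unfolding dir_deriv_def by blast
    moreover have "E \<sigma> \<theta> + of_real t * 1 = E (t + \<sigma>) \<theta>" for t by (simp add: E_def)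
    ultimately have "((\<lambda>t. G (E (t + \<sigma>) \<theta>)) has_real_derivative G' (E \<sigma> \<theta>)) (at 0)" by simp
    then show ?thesis using DERIV_shift[of "\<lambda>\<sigma>. G (E \<sigma> \<theta>)" "G' (E \<sigma> \<theta>)" 0 \<sigma>] by simp
  qed
  have dy: "((\<lambda>\<theta>. G (E \<sigma> \<theta>)) has_real_derivative G' (E \<sigma> \<theta>)) (at \<theta>)"
    if "dir_deriv \<i> G G' ?S" "\<sigma> < b" for G G' \<sigma> \<theta>
  proof -
    have "((\<lambda>t. G (E \<sigma> \<theta> + of_real t * \<i>)) has_real_derivative G' (E \<sigma> \<theta>)) (at 0)"
      using that ES[OF that(2), of \<theta>] unfolding dir_deriv_def by blast
    moreover have "E \<sigma> \<theta> + of_real t * \<i> = E \<sigma> (t + \<theta>)" for t by (simp add: E_def algebra_simps)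
    ultimately have "((\<lambda>t. G (E \<sigma> (t + \<theta>))) has_real_derivative G' (E \<sigma> \<theta>)) (at 0)" by simp
    then show ?thesis using DERIV_shift[of "\<lambda>\<theta>. G (E \<sigma> \<theta>)" "G' (E \<sigma> \<theta>)" 0 \<theta>] by simp
  qed
  have c2: "continuous_on ({..<b} \<times> cbox 0 (2*pi)) (\<lambda>(\<sigma>,\<theta>). G (E \<sigma> \<theta>))" if "continuous_on ?S G" for G :: "complex \<Rightarrow> real"
    unfolding case_prod_beta by (rule continuous_on_compose2[OF that]) (auto simp: E_def intro!: continuous_intros)
  have c1: "continuous_on {0..2*pi} (\<lambda>\<theta>. G (E \<sigma> \<theta>))" if "continuous_on ?S G" "\<sigma> < b" for G :: "complex \<Rightarrow> real" and \<sigma>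
    by (rule continuous_on_compose2[OF that(1)]) (use that(2) in \<open>auto simp: E_def intro!: continuous_intros\<close>)
  have int: "(\<lambda>\<theta>. G (E \<sigma> \<theta>)) integrable_on {0..2*pi}" if "continuous_on ?S G" "\<sigma> < b" for G :: "complex \<Rightarrow> real" and \<sigma>
    using c1[OF that] by (rule integrable_continuous_real)
  define I where "I = (\<lambda>(G::complex \<Rightarrow> real) \<sigma>. integral {0..2*pi} (\<lambda>\<theta>. G (E \<sigma> \<theta>)))"
  have dI: "(I G has_real_derivative I G' \<sigma>) (at \<sigma>)" if G: "dir_deriv 1 G G' ?S" "continuous_on ?S G" and s: "\<sigma> < b" for G G' \<sigma>
  proof -
    have "((\<lambda>\<sigma>. integral (cbox 0 (2*pi)) (\<lambda>\<theta>. G (E \<sigma> \<theta>))) has_real_derivative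
        integral (cbox 0 (2*pi)) (\<lambda>\<theta>. G' (E \<sigma> \<theta>))) (at \<sigma> within {..<b})"
      using G s by (intro leibniz_rule_field_derivative[where fx="\<lambda>\<sigma> \<theta>. G' (E \<sigma> \<theta>)"] c2)
        (auto intro!: has_field_derivative_at_within[OF dx[OF G(1)]] int simp: dir_deriv_def)
    then show ?thesis using at_within_open[of \<sigma> "{..<b}"] s by (simp add: I_def cbox_interval)
  qed
  have cont': "continuous_on ?S Yx" "continuous_on ?S Yy" "continuous_on ?S Yxx" "continuous_on ?S Yyy"
    using dd unfolding dir_deriv_def by auto
  \<comment> \<open>The exponential has period 2 pi \<i>, so the \<theta>-derivative of
    \<open>Y\<close> agrees at both ends of the segment. The integral of \<open>Yyy\<close> is the
    difference of these end values.\<close>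
  have per: "Yy (E \<sigma> (2*pi)) = Yy (E \<sigma> 0)" if s: "\<sigma> < b" for \<sigma>
  proof -
    have "exp (E \<sigma> \<theta> + \<i> * of_real (2*pi)) = exp (E \<sigma> \<theta>)" for \<theta>
      by (simp add: exp_add exp_two_pi_i' mult.commute mult.left_commute)
    then have "Y (E \<sigma> (\<theta> + 2*pi)) = Y (E \<sigma> \<theta>)" for \<theta>
      by (simp add: Y_def E_def algebra_simps)
    then have "((\<lambda>\<theta>. Y (E \<sigma> \<theta>)) has_real_derivative Yy (E \<sigma> (2*pi))) (at 0)"
      using dy[OF dd(2) s, of "2*pi"] DERIV_shift[of "\<lambda>\<theta>. Y (E \<sigma> \<theta>)" "Yy (E \<sigma> (2*pi))" 0 "2*pi"] by simp
    then show ?thesis using DERIV_unique dy[OF dd(2) s, of 0] by blast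
  qed
  have Iyy: "I Yyy \<sigma> = 0" if s: "\<sigma> < b" for \<sigma>
  proof -
    have "((\<lambda>\<theta>. Yyy (E \<sigma> \<theta>)) has_integral (Yy (E \<sigma> (2*pi)) - Yy (E \<sigma> 0))) {0..2*pi}"
      by (rule fundamental_theorem_of_calculus)
        (auto intro!: has_field_derivative_at_within dy[OF dd(4) s] simp flip: has_real_derivative_iff_has_vector_derivative)
    then show ?thesis using per[OF s] by (simp add: I_def integral_unique)
  qed
  have Ixx: "I Yxx \<sigma> \<ge> 0" if s: "\<sigma> < b" for \<sigma>
  proof -
    have "0 \<le> integral {0..2*pi} (\<lambda>\<theta>. Yxx (E \<sigma> \<theta>) + Yyy (E \<sigma> \<theta>))"
      using dd(5) L ES[OF s] by (intro integral_nonneg integrable_add int cont' s) fastforce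
    also have "\<dots> = I Yxx \<sigma> + I Yyy \<sigma>"
      unfolding I_def by (intro integral_add int cont' s)
    finally show ?thesis using Iyy[OF s] by simp
  qed
  have mono': "I Yx \<sigma> \<le> I Yx \<tau>" if "\<sigma> \<le> \<tau>" "\<tau> < b" for \<sigma> \<tau>
    by (rule DERIV_nonneg_imp_nondecreasing[OF that(1)]) (use dI[OF dd(3) cont'(1)] Ixx that in \<open>meson le_less_trans\<close>)
  have near: "\<exists>\<sigma>0 \<le> c. \<forall>\<sigma>\<le>\<sigma>0. \<forall>\<theta>. \<bar>Y (E \<sigma> \<theta>) - W 0\<bar> < \<epsilon>" if "\<epsilon> > 0" for \<epsilon> c
  proof -
    obtain d where d: "d > 0" "\<And>z. norm z < d \<Longrightarrow> \<bar>W z - W 0\<bar> < \<epsilon>"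
      using cont \<open>\<epsilon> > 0\<close> unfolding continuous_at_eps_delta dist_norm by (auto simp: dist_real_def)
    have "norm (exp (E \<sigma> \<theta>)) < d" if "\<sigma> \<le> min c (ln d - 1)" for \<sigma> \<theta>
    proof -
      have "exp \<sigma> < exp (ln d)" using that by simp
      then show ?thesis using d(1) by (simp add: E_def norm_exp_eq_Re)
    qed
    then show ?thesis using d(2) by (intro exI[of _ "min c (ln d - 1)"]) (auto simp: Y_def)
  qed
  have pos: "I Yx \<tau> \<ge> 0" if t: "\<tau> < b" for \<tau>
  proof (rule ccontr)
    assume neg: "\<not> I Yx \<tau> \<ge> 0"
    obtain \<sigma>0 where s0: "\<sigma>0 \<le> \<tau> - 1" "\<forall>\<sigma>\<le>\<sigma>0. \<forall>\<theta>. \<bar>Y (E \<sigma> \<theta>) - W 0\<bar> < 1" using near[of 1 "\<tau>-1"] by auto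
    define B where "B = 2*pi*(W 0 + 1)"
    have up: "I Y \<sigma> \<le> B" if "\<sigma> \<le> \<sigma>0" for \<sigma>
    proof -
      have "I Y \<sigma> \<le> integral {0..2*pi} (\<lambda>\<theta>. W 0 + 1)" unfolding I_def
        using s0 that t by (intro integral_le int cY) (auto, smt (verit, best))
      then show ?thesis by (simp add: B_def)
    qed
    \<comment> \<open>If the slope at \<tau> were negative, all slopes further left would be at most
      as large. Going left with slope \<open>I Yx \<tau>\<close> to this point lifts the mean above
      the bound \<open>B\<close> that holds near the centre.\<close>
    define \<sigma> where "\<sigma> = min \<sigma>0 (\<tau> - (\<bar>B - I Y \<tau>\<bar> + 1) / (- I Yx \<tau>))"
    have st: "\<sigma> < \<tau>" using s0 by (simp add: \<sigma>_def)
    obtain \<xi> where xi: "\<xi> > \<sigma>" "\<xi> < \<tau>" "I Y \<tau> - I Y \<sigma> = (\<tau> - \<sigma>) * I Yx \<xi>"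
      using MVT2[OF st, of "I Y" "I Yx"] dI[OF dd(1) cY] t by (metis le_less_trans)
    have "(\<tau> - \<sigma>) * I Yx \<xi> \<le> (\<tau> - \<sigma>) * I Yx \<tau>"
      using mono'[of \<xi> \<tau>] xi st t by (intro mult_left_mono) auto
    moreover have "(\<tau> - \<sigma>) * (- I Yx \<tau>) \<ge> ((\<bar>B - I Y \<tau>\<bar> + 1) / (- I Yx \<tau>)) * (- I Yx \<tau>)"
      using neg by (intro mult_right_mono) (auto simp: \<sigma>_def)
    moreover have "((\<bar>B - I Y \<tau>\<bar> + 1) / (- I Yx \<tau>)) * (- I Yx \<tau>) = \<bar>B - I Y \<tau>\<bar> + 1"
      using neg by simp
    moreover have "(\<tau> - \<sigma>) * (- I Yx \<tau>) = - ((\<tau> - \<sigma>) * I Yx \<tau>)" by simp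
    ultimately have "I Y \<sigma> \<ge> I Y \<tau> + (\<bar>B - I Y \<tau>\<bar> + 1)" using xi(3) by linarith
    with up[of \<sigma>] show False by (auto simp: \<sigma>_def)
  qed
  have monoI: "I Y \<sigma> \<le> I Y \<tau>" if "\<sigma> \<le> \<tau>" "\<tau> < b" for \<sigma> \<tau>
    by (rule DERIV_nonneg_imp_nondecreasing[OF that(1)]) (use dI[OF dd(1) cY] pos that in \<open>meson le_less_trans\<close>)
  have cm: "cmean W (exp \<sigma>) = I Y \<sigma> / (2*pi)" for \<sigma>
    by (simp add: cmean_def I_def Y_def E_def exp_add cis_conv_exp exp_of_real)
  show ?thesis
  proof (cases "r = 0")
    case True then show ?thesis using sr by simp
  next
    case False
    then have r0: "r > 0" using sr by simp
    then have "exp (ln r) < exp b" using sr by simp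
    then have r: "r > 0" "ln r < b" using r0 by (simp_all only: exp_less_cancel_iff)
    show ?thesis
    proof (cases "s = 0")
      case False
      then have "cmean W (exp (ln s)) \<le> cmean W (exp (ln r))"
        unfolding cm using sr r by (intro divide_right_mono monoI) auto
      then show ?thesis using False sr r by simp
    next
      case True
      \<comment> \<open>The centre lies at \<sigma> = minus infinity, so its value is compared with
        means over tiny circles, on which \<open>W\<close> exceeds
        \<open>W 0 - \<epsilon>\<close>.\<close>
      have "W 0 - \<epsilon> \<le> cmean W r" if ep: "\<epsilon> > 0" for \<epsilon>
      proof -
        obtain \<sigma>0 where s0: "\<sigma>0 \<le> ln r" "\<forall>\<sigma>\<le>\<sigma>0. \<forall>\<theta>. \<bar>Y (E \<sigma> \<theta>) - W 0\<bar> < \<epsilon>" using near[OF ep, of "ln r"] by auto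
        have "integral {0..2*pi} (\<lambda>\<theta>. W 0 - \<epsilon>) \<le> I Y \<sigma>0" unfolding I_def
          using s0 r by (intro integral_le int cY) (auto, smt (verit, best))
        also have "\<dots> \<le> I Y (ln r)" using s0 r by (intro monoI) auto
        finally have "2 * pi * (W 0 - \<epsilon>) \<le> 2 * pi * cmean W r" using cm[of "ln r"] r by simp
        then show ?thesis by (simp only: mult_le_cancel_left_pos[of "2*pi"] pi_gt_zero zero_less_mult_iff zero_less_numeral simp_thms)
      qed
      then show ?thesis using True field_le_epsilon[of "W 0" "cmean W r"] by force
    qed
  qed
qed

section \<open>Laplacians of regularised powers of holomorphic functions\<close>

lemma norm_sq_gradient:
  "(2 * Re z * Re d + 2 * Im z * Im d)\<^sup>2 + (- 2 * Re z * Im d + 2 * Im z * Re d)\<^sup>2 = 4 * (norm z)\<^sup>2 * (norm d)\<^sup>2"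
  unfolding cmod_power2 by algebra

lemma has_lap_powr:
  assumes "has_lap Y Yx Yy L S" "\<And>w. w \<in> S \<Longrightarrow> Y w > 0"
  shows "has_lap (\<lambda>w. Y w powr a) (\<lambda>w. a * Y w powr (a - 1) * Yx w) (\<lambda>w. a * Y w powr (a - 1) * Yy w)
     (\<lambda>w. a * Y w powr (a - 1) * L w + a * (a - 1) * Y w powr (a - 2) * ((Yx w)\<^sup>2 + (Yy w)\<^sup>2)) S"
  by (rule has_lap_compose[OF assms(1), where I="{0<..}" and \<psi>="\<lambda>x. x powr a" and \<psi>'="\<lambda>x. a * x powr (a - 1)"
        and \<psi>''="\<lambda>x. a * (a - 1) * x powr (a - 2)"])
     (use assms(2) in \<open>auto intro!: derivative_eq_intros continuous_intros simp: algebra_simps\<close>)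

lemma has_lap_norm_sq_eps:
  assumes "f holomorphic_on S" "open S"
  obtains Yx Yy where "has_lap (\<lambda>w. (norm (f w))\<^sup>2 + \<epsilon>) Yx Yy (\<lambda>w. 4 * (norm (deriv f w))\<^sup>2) S"
    "\<And>w. (Yx w)\<^sup>2 + (Yy w)\<^sup>2 = 4 * (norm (f w))\<^sup>2 * (norm (deriv f w))\<^sup>2"
proof -
  have *: "has_lap (\<lambda>w. (norm (f w))\<^sup>2 + \<epsilon>)
     (\<lambda>w. (2 * Re (f w) * Re (deriv f w) + 2 * Im (f w) * Im (deriv f w)) + 0)
     (\<lambda>w. (- 2 * Re (f w) * Im (deriv f w) + 2 * Im (f w) * Re (deriv f w)) + 0) (\<lambda>w. 4 * (norm (deriv f w))\<^sup>2 + 0) S"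
    by (rule has_lap_add[OF has_lap_norm_sq[OF assms] has_lap_const])
  show ?thesis by (rule that[OF *[unfolded add_0_right] norm_sq_gradient])
qed

text \<open>The \<epsilon> keeps the base away from 0, where the power need not be smooth. The two
  terms of the chain rule merge into a factor that is visibly positive for every \<open>a\<close> >
  0.\<close>

lemma has_lap_norm_sq_eps_powr:
  assumes "f holomorphic_on S" "open S" "\<epsilon> > 0"
  obtains Yx Yy where "has_lap (\<lambda>w. ((norm (f w))\<^sup>2 + \<epsilon>) powr a) Yx Yy
    (\<lambda>w. 4 * (norm (deriv f w))\<^sup>2 * ((norm (f w))\<^sup>2 + \<epsilon>) powr (a - 2) * (a * \<epsilon> + a\<^sup>2 * (norm (f w))\<^sup>2)) S"
proof -
  obtain Yx Yy where Y: "has_lap (\<lambda>w. (norm (f w))\<^sup>2 + \<epsilon>) Yx Yy (\<lambda>w. 4 * (norm (deriv f w))\<^sup>2) S"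
    "\<And>w. (Yx w)\<^sup>2 + (Yy w)\<^sup>2 = 4 * (norm (f w))\<^sup>2 * (norm (deriv f w))\<^sup>2"
    using has_lap_norm_sq_eps[OF assms(1,2)] by blast
  have pos: "(norm (f w))\<^sup>2 + \<epsilon> > 0" for w using assms(3) by (simp add: add_nonneg_pos)
  have e: "s powr (a - 1) = s powr (a - 2) * s" if "s > 0" for s :: real
    using powr_mult_base[of s "a-2"] that by (simp add: mult.commute)
  show ?thesis
    by (rule that[OF has_lap_cong[OF has_lap_powr[OF Y(1) pos, of a] assms(2) refl refl refl]])
      (simp add: e[OF pos] Y(2), algebra)
qed

text \<open>For \<open>x\<close> = |f|^2 the Laplacian of (|f|^2 + \<epsilon>)^a is thus comparable
  to |f'|^2 (|f|^2 + \<epsilon>)^(a - 1), uniformly in \<epsilon>, and can stand on either side of a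
  comparison.\<close>

lemma regularised_power_bounds:
  assumes "\<epsilon> > 0" "0 < a" "x \<ge> (0::real)"
  shows "a * min 1 a * (x + \<epsilon>) powr (a - 1) \<le> (x + \<epsilon>) powr (a - 2) * (a * \<epsilon> + a\<^sup>2 * x)"
    and "(x + \<epsilon>) powr (a - 2) * (a * \<epsilon> + a\<^sup>2 * x) \<le> a * max 1 a * (x + \<epsilon>) powr (a - 1)"
proof -
  have pos: "x + \<epsilon> > 0" using assms by simp
  have e: "(x + \<epsilon>) powr (a - 1) = (x + \<epsilon>) powr (a - 2) * (x + \<epsilon>)"
    using powr_mult_base[of "x+\<epsilon>" "a-2"] pos by (simp add: mult.commute)
  have "a * min 1 a * (x + \<epsilon>) \<le> a * \<epsilon> + a\<^sup>2 * x"
  proof -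
    have "min 1 a * x \<le> a * x" "min 1 a * \<epsilon> \<le> 1 * \<epsilon>"
      using assms by (intro mult_right_mono; simp)+
    then have "min 1 a * (x + \<epsilon>) \<le> \<epsilon> + a * x" by (simp add: algebra_simps)
    from mult_left_mono[OF this, of a] assms show ?thesis by (simp add: algebra_simps power2_eq_square)
  qed
  from mult_left_mono[OF this, of "(x + \<epsilon>) powr (a - 2)"]
  show "a * min 1 a * (x + \<epsilon>) powr (a - 1) \<le> (x + \<epsilon>) powr (a - 2) * (a * \<epsilon> + a\<^sup>2 * x)"
    unfolding e by (simp only: mult_ac powr_ge_zero simp_thms)
  have "a * \<epsilon> + a\<^sup>2 * x \<le> a * max 1 a * (x + \<epsilon>)"
  proof -
    have "max 1 a * x \<ge> a * x" "max 1 a * \<epsilon> \<ge> 1 * \<epsilon>"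
      using assms by (intro mult_right_mono; simp)+
    then have "max 1 a * (x + \<epsilon>) \<ge> \<epsilon> + a * x" by (simp add: algebra_simps)
    from mult_left_mono[OF this, of a] assms show ?thesis by (simp add: algebra_simps power2_eq_square)
  qed
  from mult_left_mono[OF this, of "(x + \<epsilon>) powr (a - 2)"]
  show "(x + \<epsilon>) powr (a - 2) * (a * \<epsilon> + a\<^sup>2 * x) \<le> a * max 1 a * (x + \<epsilon>) powr (a - 1)"
    unfolding e by (simp only: mult_ac powr_ge_zero simp_thms)
qed

text \<open>Uchiyama's trick: \<open>exp \<phi> * s powr a\<close> is the exponential of \<open>\<phi>\<close> plus a subharmonic function.\<close>
lemma has_lap_exp_potential:
  assumes f: "f holomorphic_on S" and g: "g holomorphic_on S" and G: "G holomorphic_on S" and S: "open S"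
    and eps: "\<epsilon> > 0" and a: "a \<ge> 0"
  obtains Yx Yy L where
    "has_lap (\<lambda>w. exp ((norm (g w))\<^sup>2 - Re (G w)) * ((norm (f w))\<^sup>2 + \<epsilon>) powr a) Yx Yy L S"
    "\<And>w. w \<in> S \<Longrightarrow> L w \<ge> 4 * (norm (deriv g w))\<^sup>2 * (exp ((norm (g w))\<^sup>2 - Re (G w)) * ((norm (f w))\<^sup>2 + \<epsilon>) powr a)"
proof -
  obtain Yx Yy where Y: "has_lap (\<lambda>w. (norm (f w))\<^sup>2 + \<epsilon>) Yx Yy (\<lambda>w. 4 * (norm (deriv f w))\<^sup>2) S"
    "\<And>w. (Yx w)\<^sup>2 + (Yy w)\<^sup>2 = 4 * (norm (f w))\<^sup>2 * (norm (deriv f w))\<^sup>2"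
    using has_lap_norm_sq_eps[OF f S] by blast
  have pos: "(norm (f w))\<^sup>2 + \<epsilon> > 0" for w using eps by (simp add: add_nonneg_pos)
  let ?s = "\<lambda>w. (norm (f w))\<^sup>2 + \<epsilon>"
  have ln: "has_lap (\<lambda>w. ln (?s w)) (\<lambda>w. inverse (?s w) * Yx w) (\<lambda>w. inverse (?s w) * Yy w)
      (\<lambda>w. inverse (?s w) * (4 * (norm (deriv f w))\<^sup>2) + (- inverse ((?s w)\<^sup>2)) * ((Yx w)\<^sup>2 + (Yy w)\<^sup>2)) S"
    by (rule has_lap_compose[OF Y(1), where I="{0<..}"])
      (use pos in \<open>auto intro!: derivative_eq_intros continuous_intros simp: power2_eq_square divide_inverse\<close>)
  obtain gx gy where g': "has_lap (\<lambda>w. (norm (g w))\<^sup>2) gx gy (\<lambda>w. 4 * (norm (deriv g w))\<^sup>2) S"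
    using has_lap_norm_sq[OF g S] by blast
  define L where "L = (\<lambda>w. 4 * (norm (deriv g w))\<^sup>2 + -1 * 0 +
     a * (inverse (?s w) * (4 * (norm (deriv f w))\<^sup>2) + (- inverse ((?s w)\<^sup>2)) * ((Yx w)\<^sup>2 + (Yy w)\<^sup>2)))"
  obtain Px Py where P: "has_lap (\<lambda>w. (norm (g w))\<^sup>2 + -1 * Re (G w) + a * ln (?s w)) Px Py L S"
    unfolding L_def
    using has_lap_add[OF has_lap_add[OF g' has_lap_cmult[OF has_lap_Re_holomorphic[OF G S], of "-1"]] has_lap_cmult[OF ln, of a]]
    by blast
  let ?P = "\<lambda>w. (norm (g w))\<^sup>2 + -1 * Re (G w) + a * ln (?s w)"
  have E: "has_lap (\<lambda>w. exp (?P w)) (\<lambda>w. exp (?P w) * Px w) (\<lambda>w. exp (?P w) * Py w)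
      (\<lambda>w. exp (?P w) * L w + exp (?P w) * ((Px w)\<^sup>2 + (Py w)\<^sup>2)) S"
    by (rule has_lap_compose[OF P, where I=UNIV]) (auto intro!: derivative_eq_intros continuous_intros)
  have eq: "exp (?P w) = exp ((norm (g w))\<^sup>2 - Re (G w)) * ?s w powr a" for w
    using pos[of w] by (simp add: exp_add powr_def flip: exp_diff)
  \<comment> \<open>The Laplacian of the logarithm collapses to a nonnegative multiple of
    \<epsilon>, so the exponent has Laplacian at least 4 |g'|^2. Exponentiation only adds a squared
    gradient.\<close>
  have Lge: "L w \<ge> 4 * (norm (deriv g w))\<^sup>2" for w
  proof -
    have "inverse (?s w) * (4 * (norm (deriv f w))\<^sup>2) + (- inverse ((?s w)\<^sup>2)) * ((Yx w)\<^sup>2 + (Yy w)\<^sup>2)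
      = 4 * (norm (deriv f w))\<^sup>2 * \<epsilon> / (?s w)\<^sup>2"
    proof -
      have "inverse s * (4 * d) + (- inverse (s\<^sup>2)) * (4 * x * d) = 4 * d * (s - x) / s\<^sup>2" if "s > 0" for s x d :: real
        using that by (simp add: field_simps power2_eq_square)
      from this[OF pos[of w], of "(norm (deriv f w))\<^sup>2" "(norm (f w))\<^sup>2"] show ?thesis unfolding Y(2) by simp
    qed
    then show ?thesis using a eps by (simp add: L_def)
  qed
  show ?thesis
  proof (rule that)
    show "has_lap (\<lambda>w. exp ((norm (g w))\<^sup>2 - Re (G w)) * ?s w powr a) (\<lambda>w. exp (?P w) * Px w) (\<lambda>w. exp (?P w) * Py w)
      (\<lambda>w. exp (?P w) * L w + exp (?P w) * ((Px w)\<^sup>2 + (Py w)\<^sup>2)) S"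
      by (rule has_lap_cong[OF E S eq refl refl refl])
    fix w
    have "4 * (norm (deriv g w))\<^sup>2 * exp (?P w) \<le> L w * exp (?P w) + exp (?P w) * ((Px w)\<^sup>2 + (Py w)\<^sup>2)"
      using mult_right_mono[OF Lge, of "exp (?P w)"] by (simp add: add_increasing2)
    then show "4 * (norm (deriv g w))\<^sup>2 * (exp ((norm (g w))\<^sup>2 - Re (G w)) * ?s w powr a)
       \<le> exp (?P w) * L w + exp (?P w) * ((Px w)\<^sup>2 + (Py w)\<^sup>2)"
      unfolding eq[symmetric] by (simp only: mult_ac)
  qed
qed

lemma holomorphic_comp_exp:
  assumes "f holomorphic_on ball 0 R" "R > 0"
  shows "(\<lambda>w. f (exp w)) holomorphic_on {w. Re w < ln R}"
    and "\<And>w. Re w < ln R \<Longrightarrow> deriv (\<lambda>w. f (exp w)) w = deriv f (exp w) * exp w"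
proof -
  have sub: "exp w \<in> ball 0 R" if "Re w < ln R" for w
    using that assms(2) ln_ge_iff[OF assms(2)] by (simp add: norm_exp_eq_Re) (metis exp_less_mono exp_ln)
  have d: "((\<lambda>w. f (exp w)) has_field_derivative deriv f (exp w) * exp w) (at w)" if "Re w < ln R" for w
    by (rule DERIV_chain2[where g=exp, OF holomorphic_derivI[OF assms(1) open_ball sub[OF that]]]) (auto intro!: derivative_eq_intros)
  show "(\<lambda>w. f (exp w)) holomorphic_on {w. Re w < ln R}"
    using d by (auto simp: holomorphic_on_open[OF open_halfspace_Re_lt])
  show "deriv (\<lambda>w. f (exp w)) w = deriv f (exp w) * exp w" if "Re w < ln R" for w
    using d[OF that] by (rule DERIV_imp_deriv)
qed

lemma norm_sq_powr: "((norm z)\<^sup>2) powr a = norm z powr (2 * a)"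
proof (cases "norm z = 0")
  case False
  then have "norm z powr 2 = (norm z)\<^sup>2" by simp
  then show ?thesis by (metis powr_powr)
qed auto

text \<open>A crude substitute for Minkowski's inequality, used for sums in H^p and in l^p, where
  constants are harmless.\<close>

lemma add_powr_le:
  assumes "x \<ge> 0" "y \<ge> (0::real)" "a \<ge> 0"
  shows "(x + y) powr a \<le> 2 powr a * (x powr a + y powr a)"
proof -
  have "(x + y) powr a \<le> (2 * max x y) powr a" using assms by (intro powr_mono2) auto
  also have "\<dots> = 2 powr a * (max x y) powr a" using assms by (simp add: powr_mult)
  also have "\<dots> \<le> 2 powr a * (x powr a + y powr a)" by (intro mult_left_mono) (auto simp: max_def)
  finally show ?thesis .
qed

text \<open>Splitting off one factor x + y leaves the exponent a - 1 \<le> 0, and replacing x + y by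
  either summand then increases the power. The constant 1 matters, because monotonicity of means
  must come out without loss.\<close>

lemma add_powr_le_subadditive:
  assumes "x \<ge> 0" "y > (0::real)" "0 < a" "a \<le> 1"
  shows "(x + y) powr a \<le> x powr a + y powr a"
proof (cases "x = 0")
  case False
  have "(x + y) powr a = x * (x + y) powr (a - 1) + y * (x + y) powr (a - 1)"
    using powr_mult_base[of "x+y" "a-1"] assms by (simp add: algebra_simps)
  also have "\<dots> \<le> x * x powr (a - 1) + y * y powr (a - 1)"
    using assms False by (intro add_mono mult_left_mono powr_mono2') auto
  also have "\<dots> = x powr a + y powr a"
    using powr_mult_base[of x "a-1"] powr_mult_base[of y "a-1"] assms by simp
  finally show ?thesis .
qed auto

lemma eps_powr_limit:
  assumes "0 < a" "C \<ge> 0" "\<And>\<epsilon>. \<epsilon> > 0 \<Longrightarrow> x \<le> y + C * \<epsilon> powr a"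
  shows "x \<le> (y::real)"
proof -
  have "((\<lambda>\<epsilon>. y + C * \<epsilon> powr a) \<longlongrightarrow> y + C * 0) (at_right 0)"
    by (intro tendsto_intros tendsto_eq_intros) (use assms in \<open>auto intro!: tendsto_zero_powrI simp: eventually_at_filter\<close>)
  then show ?thesis
    by (intro tendsto_lowerbound[of "\<lambda>\<epsilon>. y + C * \<epsilon> powr a" y "at_right 0"])
      (use assms(3) in \<open>auto simp: eventually_at_filter\<close>)
qed

text \<open>Taking a power of \<open>f\<close> reduces to an exponent at most 2, where the regularisation
  \<open>(|f|\<^sup>2 + \<epsilon>) powr (p/2)\<close> costs only \<open>\<epsilon> powr (p/2)\<close>.\<close>
lemma cmean_norm_powr_mono:
  assumes f: "f holomorphic_on ball 0 R" and p: "p > 0" and sr: "0 \<le> s" "s \<le> r" "r < R"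
  shows "cmean (\<lambda>z. norm (f z) powr p) s \<le> cmean (\<lambda>z. norm (f z) powr p) r"
proof -
  have small: "cmean (\<lambda>z. norm (h z) powr q) s \<le> cmean (\<lambda>z. norm (h z) powr q) r"
    if h: "h holomorphic_on ball 0 R" and q: "0 < q" "q \<le> 2" for h q
  proof (rule eps_powr_limit[of "q/2" 1])
    fix \<epsilon> :: real assume e: "\<epsilon> > 0"
    have R: "R > 0" using sr by simp
    let ?W = "\<lambda>z. ((norm (h z))\<^sup>2 + \<epsilon>) powr (q/2)"
    have ch: "continuous_on (ball 0 R) h" using h by (rule holomorphic_on_imp_continuous_on)
    have c: "continuous_on (ball 0 R) ?W" using e
      by (intro continuous_intros ch) (auto simp: add_nonneg_eq_0_iff)
    have c': "continuous_on (sphere 0 t) ?W" "continuous_on (sphere 0 t) (\<lambda>z. norm (h z) powr q)" if "t \<le> r" for t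
      by (rule continuous_on_subset[OF c], use that sr in \<open>auto simp: subset_iff\<close>,
        rule continuous_on_subset[of "ball 0 R"],
        use q that sr in \<open>auto simp: subset_iff intro!: continuous_intros ch continuous_on_powr'\<close>)+
    obtain Yx Yy where lap: "has_lap (\<lambda>w. ((norm (h (exp w)))\<^sup>2 + \<epsilon>) powr (q/2)) Yx Yy
      (\<lambda>w. 4 * (norm (deriv (\<lambda>w. h (exp w)) w))\<^sup>2 * ((norm (h (exp w)))\<^sup>2 + \<epsilon>) powr (q/2 - 2) *
        (q/2 * \<epsilon> + (q/2)\<^sup>2 * (norm (h (exp w)))\<^sup>2)) {w. Re w < ln R}"
      using has_lap_norm_sq_eps_powr[OF holomorphic_comp_exp(1)[OF h R] open_halfspace_Re_lt e] by blast
    have "cmean ?W s \<le> cmean ?W r"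
      by (rule cmean_mono_lap[OF lap]) (use sr e q R c in \<open>auto simp: continuous_on_eq_continuous_at\<close>)
    moreover have "cmean (\<lambda>z. norm (h z) powr q) s \<le> cmean ?W s"
      using sr e q by (intro cmean_mono c') (auto simp: norm_sq_powr[of _ "q/2", simplified, symmetric] intro!: powr_mono2)
    moreover have "cmean ?W r \<le> cmean (\<lambda>z. norm (h z) powr q + \<epsilon> powr (q/2)) r"
      using sr e q add_powr_le_subadditive[of "(norm (h z))\<^sup>2" \<epsilon> "q/2" for z]
      by (intro cmean_mono c' continuous_intros) (auto simp: norm_sq_powr)
    moreover have "\<dots> = cmean (\<lambda>z. norm (h z) powr q) r + \<epsilon> powr (q/2)"
      using sr by (subst cmean_add) (auto intro!: c')
    ultimately show "cmean (\<lambda>z. norm (h z) powr q) s \<le> cmean (\<lambda>z. norm (h z) powr q) r + 1 * \<epsilon> powr (q/2)" by simp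
  qed (use q in auto)
  obtain n where n: "real n > p" using reals_Archimedean2 by blast
  then have "n > 0" using p by (cases n) auto
  have eq: "norm (f z ^ n) powr (p / n) = norm (f z) powr p" for z
    using \<open>n > 0\<close> p by (cases "f z = 0") (auto simp: norm_power powr_powr simp flip: powr_realpow)
  show ?thesis
    using small[of "\<lambda>z. f z ^ n" "p / n"] n p \<open>n > 0\<close> f unfolding eq
    by (auto intro!: holomorphic_intros simp: field_simps)
qed

subsection \<open>Mean estimates for Volterra operators\<close>

lemma continuous_on_sphere_comp:
  fixes h :: "complex \<Rightarrow> complex"
  assumes "h holomorphic_on ball 0 R" "r < R"
  shows "continuous_on (sphere 0 r) h"
  by (rule continuous_on_subset[OF holomorphic_on_imp_continuous_on[OF assms(1)]]) (use assms(2) in auto)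

lemma continuous_on_norm_powr:
  fixes h :: "complex \<Rightarrow> complex"
  assumes "continuous_on S h" "p > 0"
  shows "continuous_on S (\<lambda>z. norm (h z) powr p)"
  using assms by (intro continuous_on_powr' continuous_intros) auto

lemma continuous_on_norm_sq_eps_powr:
  fixes h :: "complex \<Rightarrow> complex"
  assumes "continuous_on S h" "\<epsilon> > 0"
  shows "continuous_on S (\<lambda>z. ((norm (h z))\<^sup>2 + \<epsilon>) powr a)"
  using assms by (intro continuous_intros) (auto simp: add_nonneg_eq_0_iff)

lemma cmean_norm_sq_eps_powr_le:
  fixes h :: "complex \<Rightarrow> complex"
  assumes "continuous_on (sphere 0 r) h" "\<epsilon> > 0" "p > 0" "0 \<le> r"
  shows "cmean (\<lambda>z. ((norm (h z))\<^sup>2 + \<epsilon>) powr (p/2)) r \<le>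
     2 powr (p/2) * cmean (\<lambda>z. norm (h z) powr p) r + 2 powr (p/2) * \<epsilon> powr (p/2)"
proof -
  have "cmean (\<lambda>z. ((norm (h z))\<^sup>2 + \<epsilon>) powr (p/2)) r \<le>
      cmean (\<lambda>z. 2 powr (p/2) * norm (h z) powr p + 2 powr (p/2) * \<epsilon> powr (p/2)) r"
  proof (intro cmean_mono continuous_on_norm_sq_eps_powr continuous_on_add continuous_on_mult continuous_on_const
      continuous_on_norm_powr assms)
    fix z
    show "((norm (h z))\<^sup>2 + \<epsilon>) powr (p/2) \<le> 2 powr (p/2) * norm (h z) powr p + 2 powr (p/2) * \<epsilon> powr (p/2)"
      using add_powr_le[of "(norm (h z))\<^sup>2" \<epsilon> "p/2"] assms(2,3) by (simp add: norm_sq_powr ring_distribs)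
  qed
  also have "\<dots> = 2 powr (p/2) * cmean (\<lambda>z. norm (h z) powr p) r + 2 powr (p/2) * \<epsilon> powr (p/2)"
    using assms by (subst cmean_add) (auto simp: cmean_cmult intro!: continuous_intros continuous_on_norm_powr)
  finally show ?thesis .
qed

lemma has_lap_diff:
  assumes "has_lap Y Yx Yy L S" "has_lap Z Zx Zy L' S"
  obtains Ux Uy where "has_lap (\<lambda>w. Y w - Z w) Ux Uy (\<lambda>w. L w - L' w) S"
proof -
  have "has_lap (\<lambda>w. Y w + -1 * Z w) (\<lambda>w. Yx w + -1 * Zx w) (\<lambda>w. Yy w + -1 * Zy w) (\<lambda>w. L w + -1 * L' w) S"
    by (rule has_lap_add[OF assms(1) has_lap_cmult[OF assms(2)]])
  then show ?thesis using that by simp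
qed

text \<open>The difference of \<open>V\<close> and \<open>W\<close> has nonnegative Laplacian, so
  its mean is at least its value at the centre. The operator estimates below are reduced to a
  pointwise inequality of Laplacians and a check at 0.\<close>

lemma cmean_lap_comparison:
  assumes W: "has_lap (\<lambda>w. W (exp w)) Wx Wy L {w. Re w < ln R}"
    and V: "has_lap (\<lambda>w. V (exp w)) Vx Vy L' {w. Re w < ln R}"
    and le: "\<And>w. Re w < ln R \<Longrightarrow> L w \<le> L' w"
    and c: "continuous_on (ball 0 R) W" "continuous_on (ball 0 R) V" and r: "0 \<le> r" "r < R"
  shows "V 0 - W 0 + cmean W r \<le> cmean V r"
proof -
  obtain Ux Uy where U: "has_lap (\<lambda>w. V (exp w) - W (exp w)) Ux Uy (\<lambda>w. L' w - L w) {w. Re w < ln R}"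
    using has_lap_diff[OF V W] by blast
  have "cmean (\<lambda>z. V z - W z) 0 \<le> cmean (\<lambda>z. V z - W z) r"
    by (rule cmean_mono_lap[OF U]) (use le r c in \<open>auto simp: continuous_on_eq_continuous_at\<close>)
  moreover have "cmean (\<lambda>z. V z - W z) r = cmean V r + cmean (\<lambda>z. - W z) r"
    using r c by (subst cmean_add[symmetric]) (auto intro!: continuous_intros elim: continuous_on_subset)
  ultimately show ?thesis by (simp add: cmean_uminus)
qed

section \<open>Boundedness of means, given a bounded potential\<close>

locale volterra_pair =
  fixes R :: real and f g F :: "complex \<Rightarrow> complex"
  assumes f: "f holomorphic_on ball 0 R" and g: "g holomorphic_on ball 0 R" and F: "F holomorphic_on ball 0 R"
    and dF: "\<And>z. z \<in> ball 0 R \<Longrightarrow> deriv F z = f z * deriv g z" and F0: "F 0 = 0" and R: "R > 0"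
begin

abbreviation "S \<equiv> {w::complex. Re w < ln R}"

lemma fe: "(\<lambda>w. f (exp w)) holomorphic_on S" and ge: "(\<lambda>w. g (exp w)) holomorphic_on S"
  and Fe: "(\<lambda>w. F (exp w)) holomorphic_on S"
  using holomorphic_comp_exp(1) f g F R by auto

lemma dFe: "w \<in> S \<Longrightarrow> deriv (\<lambda>w. F (exp w)) w = f (exp w) * deriv (\<lambda>w. g (exp w)) w"
proof -
  assume w: "w \<in> S"
  then have "exp w \<in> ball 0 R"
    using ln_ge_iff[OF R] by (simp add: norm_exp_eq_Re) (metis R exp_less_mono exp_ln)
  then show ?thesis using w dF holomorphic_comp_exp(2)[OF F R] holomorphic_comp_exp(2)[OF g R] by simp
qed

lemma cont: "continuous_on (ball 0 R) f" "continuous_on (ball 0 R) g" "continuous_on (ball 0 R) F"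
  using f g F by (auto intro: holomorphic_on_imp_continuous_on)

lemma conts: "r < R \<Longrightarrow> continuous_on (sphere 0 r) f" "r < R \<Longrightarrow> continuous_on (sphere 0 r) F"
  using f F by (auto intro: continuous_on_sphere_comp)

end

text \<open>The function |g|^2 - Re G has Laplacian 4 |g'|^2 and values in [-B, 0]. Its exponential
  \<open>ephi\<close> is therefore a weight that changes means by a factor of at most exp B, while
  its Laplacian brings in |g'|^2.\<close>

locale volterra_pair_potential = volterra_pair +
  fixes G :: "complex \<Rightarrow> complex" and B :: real
  assumes G: "G holomorphic_on ball 0 R"
    and pot: "\<And>z. z \<in> ball 0 R \<Longrightarrow> 0 \<le> Re (G z) - (norm (g z))\<^sup>2 \<and> Re (G z) - (norm (g z))\<^sup>2 \<le> B"
begin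

definition "ephi z = exp ((norm (g z))\<^sup>2 - Re (G z))"

lemma Ge: "(\<lambda>w. G (exp w)) holomorphic_on S"
  using holomorphic_comp_exp(1) G R by auto

lemma ephi_bounds: "z \<in> ball 0 R \<Longrightarrow> exp (- B) \<le> ephi z" "z \<in> ball 0 R \<Longrightarrow> ephi z \<le> 1" "ephi z \<ge> 0"
  using pot[of z] by (auto simp: ephi_def)

lemma cont_ephi: "continuous_on (ball 0 R) ephi"
  unfolding ephi_def using G by (intro continuous_intros cont holomorphic_on_imp_continuous_on)

lemma exp_in_ball: "w \<in> S \<Longrightarrow> exp w \<in> ball 0 R"
  using ln_ge_iff[OF R] by (simp add: norm_exp_eq_Re) (metis R exp_less_mono exp_ln)

text \<open>With \<open>s = |f|\<^sup>2 + \<epsilon>\<close>, the Laplacian of \<open>(|F|\<^sup>2 + s) powr (p/2)\<close> is at most a multiple of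
  \<open>s powr (p/2) |g'|\<^sup>2 + s powr (p/2 - 1) |f'|\<^sup>2\<close> because the exponent \<open>p/2 - 1\<close> is not positive.\<close>
lemma volterra_mean_le_small:
  assumes p: "0 < p" "p \<le> 2" and r: "0 \<le> r" "r < R"
  shows "cmean (\<lambda>z. norm (F z) powr p) r \<le> (p/2 * exp B + 2/p) * 2 powr (p/2) * cmean (\<lambda>z. norm (f z) powr p) r"
proof (rule eps_powr_limit[where a="p/2" and C="(p/2 * exp B + 1/(p/2)) * 2 powr (p/2)"])
  define a where "a = p / 2"
  have a: "0 < a" "a \<le> 1" using p by (auto simp: a_def)
  show "0 < p/2" using p by simp
  show "0 \<le> (p/2 * exp B + 1/(p/2)) * 2 powr (p/2)" using p by simp
  fix \<epsilon> :: real assume e: "\<epsilon> > 0"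
  define s where "s = (\<lambda>z. (norm (f z))\<^sup>2 + \<epsilon>)"
  define W where "W = (\<lambda>z. ((norm (F z))\<^sup>2 + s z) powr a)"
  \<comment> \<open>The first summand dominates the |g'|^2 part, where the factor exp B undoes
    \<open>ephi\<close> \<ge> exp (-B). The second dominates the |f'|^2 part, because the Laplacian
    of \<open>s powr a\<close> is at least 4 a^2 s^(a - 1) |f'|^2.\<close>
  define V where "V = (\<lambda>z. a * exp B * (ephi z * s z powr a) + 1 / a * s z powr a)"
  have s0: "s z > 0" for z using e by (simp add: s_def add_nonneg_pos)
  obtain Yx Yy where Y: "has_lap (\<lambda>w. s (exp w)) Yx Yy (\<lambda>w. 4 * (norm (deriv (\<lambda>w. f (exp w)) w))\<^sup>2) S"
    unfolding s_def using has_lap_norm_sq_eps[OF fe open_halfspace_Re_lt, of \<epsilon>] by blast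
  obtain Zx Zy where Z: "has_lap (\<lambda>w. (norm (F (exp w)))\<^sup>2) Zx Zy (\<lambda>w. 4 * (norm (deriv (\<lambda>w. F (exp w)) w))\<^sup>2) S"
    using has_lap_norm_sq[OF Fe open_halfspace_Re_lt] by blast
  define LW where "LW = (\<lambda>w. a * ((norm (F (exp w)))\<^sup>2 + s (exp w)) powr (a - 1) *
      (4 * (norm (deriv (\<lambda>w. F (exp w)) w))\<^sup>2 + 4 * (norm (deriv (\<lambda>w. f (exp w)) w))\<^sup>2) +
      a * (a - 1) * ((norm (F (exp w)))\<^sup>2 + s (exp w)) powr (a - 2) * ((Zx w + Yx w)\<^sup>2 + (Zy w + Yy w)\<^sup>2))"
  obtain Wx Wy where W: "has_lap (\<lambda>w. W (exp w)) Wx Wy LW S"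
    unfolding W_def LW_def using has_lap_powr[OF has_lap_add[OF Z Y], of a] s0 by (blast intro: add_nonneg_pos zero_le_power2)
  obtain Ex Ey LE where E: "has_lap (\<lambda>w. ephi (exp w) * s (exp w) powr a) Ex Ey LE S"
    "\<And>w. w \<in> S \<Longrightarrow> LE w \<ge> 4 * (norm (deriv (\<lambda>w. g (exp w)) w))\<^sup>2 * (ephi (exp w) * s (exp w) powr a)"
    unfolding ephi_def s_def using has_lap_exp_potential[OF fe ge Ge open_halfspace_Re_lt e less_imp_le[OF a(1)]] by blast
  obtain Px Py where P: "has_lap (\<lambda>w. s (exp w) powr a) Px Py (\<lambda>w. 4 * (norm (deriv (\<lambda>w. f (exp w)) w))\<^sup>2 *
      s (exp w) powr (a - 2) * (a * \<epsilon> + a\<^sup>2 * (norm (f (exp w)))\<^sup>2)) S"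
    unfolding s_def using has_lap_norm_sq_eps_powr[OF fe open_halfspace_Re_lt e] by blast
  define LV where "LV = (\<lambda>w. a * exp B * LE w + 1 / a * (4 * (norm (deriv (\<lambda>w. f (exp w)) w))\<^sup>2 *
      s (exp w) powr (a - 2) * (a * \<epsilon> + a\<^sup>2 * (norm (f (exp w)))\<^sup>2)))"
  obtain Vx Vy where V: "has_lap (\<lambda>w. V (exp w)) Vx Vy LV S"
    unfolding V_def LV_def using has_lap_add[OF has_lap_cmult[OF E(1), of "a * exp B"] has_lap_cmult[OF P, of "1 / a"]] by blast
  have le: "LW w \<le> LV w" if w: "Re w < ln R" for w
  proof -
    define x where "x = exp w"
    define f' where "f' = (norm (deriv (\<lambda>w. f (exp w)) w))\<^sup>2"
    define g' where "g' = (norm (deriv (\<lambda>w. g (exp w)) w))\<^sup>2"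
    have nn: "f' \<ge> 0" "g' \<ge> 0" by (auto simp: f'_def g'_def)
    have F': "(norm (deriv (\<lambda>w. F (exp w)) w))\<^sup>2 = (norm (f x))\<^sup>2 * g'"
      using dFe[of w] w by (simp add: x_def g'_def norm_mult power_mult_distrib)
    have "a * (a - 1) * ((norm (F x))\<^sup>2 + s x) powr (a - 2) * ((Zx w + Yx w)\<^sup>2 + (Zy w + Yy w)\<^sup>2) \<le> 0"
      using a by (intro mult_nonpos_nonneg mult_nonneg_nonpos) auto
    then have "LW w \<le> a * ((norm (F x))\<^sup>2 + s x) powr (a - 1) * (4 * ((norm (f x))\<^sup>2 * g') + 4 * f')"
      unfolding LW_def F' x_def[symmetric] f'_def[symmetric] by simp
    also have "\<dots> \<le> a * s x powr (a - 1) * (4 * (s x * g') + 4 * f')"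
    proof -
      have 1: "((norm (F x))\<^sup>2 + s x) powr (a - 1) \<le> s x powr (a - 1)"
        using a s0[of x] by (intro powr_mono2') auto
      have 2: "(norm (f x))\<^sup>2 * g' \<le> s x * g'" using nn e by (intro mult_right_mono) (auto simp: s_def)
      show ?thesis
        by (rule mult_mono[OF mult_left_mono[OF 1] add_right_mono[OF mult_left_mono[OF 2]]]) (use a nn in auto)
    qed
    also have "\<dots> = 4 * a * (s x powr a * g') + 4 * a * (s x powr (a - 1) * f')"
      using powr_mult_base[of "s x" "a - 1"] s0[of x] by (simp add: algebra_simps)
    also have "\<dots> \<le> LV w" unfolding LV_def
    proof (rule add_mono)
      have "exp (- B) \<le> ephi x" using w exp_in_ball[of w] ephi_bounds(1)[of x] by (simp add: x_def)
      then have "4 * g' * (exp (- B) * s x powr a) \<le> 4 * g' * (ephi x * s x powr a)"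
        using nn by (intro mult_left_mono mult_right_mono) auto
      also have "\<dots> \<le> LE w" using E(2)[of w] w by (simp add: x_def g'_def)
      finally have "a * exp B * (4 * g' * (exp (- B) * s x powr a)) \<le> a * exp B * LE w"
        using a by (intro mult_left_mono) auto
      moreover have "a * exp B * (4 * g' * (exp (- B) * s x powr a)) = (exp B * exp (- B)) * (4 * a * (s x powr a * g'))"
        by (simp only: mult_ac)
      ultimately show "4 * a * (s x powr a * g') \<le> a * exp B * LE w" by (simp flip: exp_add)
      have 3: "a * a * s x powr (a - 1) \<le> s x powr (a - 2) * (a * \<epsilon> + a\<^sup>2 * (norm (f x))\<^sup>2)"
        using regularised_power_bounds(1)[OF e a(1), of "(norm (f x))\<^sup>2"] a by (simp add: s_def)
      show "4 * a * (s x powr (a - 1) * f') \<le> 1 / a * (4 * (norm (deriv (\<lambda>w. f (exp w)) w))\<^sup>2 *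
         s (exp w) powr (a - 2) * (a * \<epsilon> + a\<^sup>2 * (norm (f (exp w)))\<^sup>2))"
      proof -
        have "1 / a * 4 * f' * (a * a * s x powr (a - 1)) = 4 * a * (s x powr (a - 1) * f')" using a by simp
        moreover have "1 / a * 4 * f' * (a * a * s x powr (a - 1)) \<le>
            1 / a * 4 * f' * (s x powr (a - 2) * (a * \<epsilon> + a\<^sup>2 * (norm (f x))\<^sup>2))"
          using 3 a nn by (intro mult_left_mono) auto
        ultimately show ?thesis unfolding f'_def[symmetric] x_def[symmetric] by (simp only: mult_ac)
      qed
    qed
    finally show ?thesis .
  qed
  have cs: "continuous_on (ball 0 R) (\<lambda>z. s z powr a)" "continuous_on (ball 0 R) s"
    unfolding s_def by (intro continuous_on_norm_sq_eps_powr cont e continuous_intros)+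
  have cW: "continuous_on (ball 0 R) W" unfolding W_def
    using s0 by (intro continuous_intros cont cs) (metis add_nonneg_pos less_irrefl zero_le_power2)
  have cV: "continuous_on (ball 0 R) V" unfolding V_def
    by (intro cs continuous_on_add continuous_on_mult continuous_on_const cont_ephi)
  have sub: "sphere 0 r \<subseteq> ball 0 R" using r by (auto simp: subset_iff)
  \<comment> \<open>Since \<open>F 0 = 0\<close>, \<open>W 0\<close> is just
    \<open>s 0 powr a\<close>, and the second summand of \<open>V\<close> covers it because a \<le>
    1.\<close>
  have "W 0 \<le> V 0"
  proof -
    have "1 * s 0 powr a \<le> 1 / a * s 0 powr a" using a by (intro mult_right_mono) auto
    moreover have "0 \<le> a * exp B * (ephi 0 * s 0 powr a)" using a ephi_bounds(3) by simp
    ultimately show ?thesis by (simp add: W_def V_def F0)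
  qed
  then have "cmean W r \<le> cmean V r"
    using cmean_lap_comparison[OF W V le cW cV r] by simp
  also have "\<dots> \<le> cmean (\<lambda>z. (a * exp B + 1/a) * s z powr a) r"
  proof (intro cmean_mono continuous_on_subset[OF cV sub] continuous_on_subset[OF _ sub] continuous_on_mult continuous_on_const cs r)
    fix z :: complex assume "norm z = r"
    then have "ephi z * s z powr a \<le> 1 * s z powr a" using ephi_bounds(2)[of z] r by (intro mult_right_mono) auto
    from mult_left_mono[OF this, of "a * exp B"] show "V z \<le> (a * exp B + 1/a) * s z powr a"
      using a by (simp add: V_def algebra_simps)
  qed
  also have "\<dots> = (a * exp B + 1/a) * cmean (\<lambda>z. s z powr a) r" by (rule cmean_cmult)
  also have "\<dots> \<le> (a * exp B + 1/a) * (2 powr a * cmean (\<lambda>z. norm (f z) powr p) r + 2 powr a * \<epsilon> powr a)"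
    unfolding s_def a_def using p by (intro mult_left_mono cmean_norm_sq_eps_powr_le conts r e) auto
  finally have "cmean W r \<le> (a * exp B + 1/a) * (2 powr a * cmean (\<lambda>z. norm (f z) powr p) r + 2 powr a * \<epsilon> powr a)" .
  moreover have "cmean (\<lambda>z. norm (F z) powr p) r \<le> cmean W r"
  proof (intro cmean_mono continuous_on_norm_powr conts r p continuous_on_subset[OF cW sub])
    fix z
    have "norm (F z) powr p = ((norm (F z))\<^sup>2) powr a" by (simp add: norm_sq_powr a_def)
    also have "\<dots> \<le> W z" unfolding W_def using a s0[of z] by (intro powr_mono2) auto
    finally show "norm (F z) powr p \<le> W z" .
  qed
  ultimately show "cmean (\<lambda>z. norm (F z) powr p) r \<le>
      (p/2 * exp B + 2/p) * 2 powr (p/2) * cmean (\<lambda>z. norm (f z) powr p) r +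
      (p/2 * exp B + 1/(p/2)) * 2 powr (p/2) * \<epsilon> powr (p/2)"
    by (simp add: a_def algebra_simps)
qed

text \<open>Here \<open>|F|\<^sup>p |g'|\<^sup>2\<close> is absorbed: it is dominated by the Laplacian of \<open>exp \<phi> (|F|\<^sup>2 + \<epsilon>) powr (p/2)\<close>,
  and Young's inequality makes its coefficient small.\<close>
lemma volterra_mean_le_large:
  assumes p: "2 \<le> p" and r: "0 \<le> r" "r < R"
  shows "cmean (\<lambda>z. norm (F z) powr p) r \<le>
    2 * (p\<^sup>2/4 * exp B * (p\<^sup>2/2 * exp B) powr (p/2 - 1)) * 2 powr (p/2) * cmean (\<lambda>z. norm (f z) powr p) r"
proof (rule eps_powr_limit[where a="p/2" and C="2 * (p\<^sup>2/4 * exp B * (p\<^sup>2/2 * exp B) powr (p/2 - 1)) * 2 powr (p/2) + 2"])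
  define a where "a = p / 2"
  \<comment> \<open>This makes exp B * a^2 * \<delta> equal to 1/2, so that the part containing
    \<open>F\<close> occurs with coefficient 1/2 and can be absorbed. \<open>C\<close> is the
    coefficient that Young's inequality then leaves for \<open>f\<close>.\<close>
  define \<delta> where "\<delta> = 1 / (2 * a\<^sup>2 * exp B)"
  define C where "C = a\<^sup>2 * exp B * \<delta> powr (1 - a)"
  have a: "1 \<le> a" using p by (auto simp: a_def)
  have a0: "0 \<le> a" using a by simp
  have d0: "\<delta> > 0" using a by (simp add: \<delta>_def)
  have C0: "C \<ge> 0" using a by (simp add: C_def)
  have Ceq: "C = p\<^sup>2/4 * exp B * (p\<^sup>2/2 * exp B) powr (p/2 - 1)"
  proof -
    have "\<delta> powr (1 - a) = inverse \<delta> powr (a - 1)" using d0 by (simp add: powr_def ln_inverse left_diff_distrib algebra_simps)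
    then show ?thesis by (simp add: C_def a_def \<delta>_def power2_eq_square)
  qed
  show "0 < p/2" using p by simp
  show "0 \<le> 2 * (p\<^sup>2/4 * exp B * (p\<^sup>2/2 * exp B) powr (p/2 - 1)) * 2 powr (p/2) + 2" using C0 unfolding Ceq by simp
  fix \<epsilon> :: real assume e: "\<epsilon> > 0"
  define s where "s = (\<lambda>z. (norm (f z))\<^sup>2 + \<epsilon>)"
  define t where "t = (\<lambda>z. (norm (F z))\<^sup>2 + \<epsilon>)"
  define V where "V = (\<lambda>z. 1/2 * (ephi z * t z powr a) + C * (ephi z * s z powr a))"
  define W where "W = (\<lambda>z. t z powr a)"
  have s0: "s z > 0" "t z > 0" for z using e by (simp_all add: s_def t_def add_nonneg_pos)
  obtain Ex Ey LE where E: "has_lap (\<lambda>w. ephi (exp w) * s (exp w) powr a) Ex Ey LE S"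
    "\<And>w. w \<in> S \<Longrightarrow> LE w \<ge> 4 * (norm (deriv (\<lambda>w. g (exp w)) w))\<^sup>2 * (ephi (exp w) * s (exp w) powr a)"
    unfolding ephi_def s_def using has_lap_exp_potential[OF fe ge Ge open_halfspace_Re_lt e, OF a0] by blast
  obtain Tx Ty LT where T: "has_lap (\<lambda>w. ephi (exp w) * t (exp w) powr a) Tx Ty LT S"
    "\<And>w. w \<in> S \<Longrightarrow> LT w \<ge> 4 * (norm (deriv (\<lambda>w. g (exp w)) w))\<^sup>2 * (ephi (exp w) * t (exp w) powr a)"
    unfolding ephi_def t_def using has_lap_exp_potential[OF Fe ge Ge open_halfspace_Re_lt e, OF a0] by blast
  define LW where "LW = (\<lambda>w. 4 * (norm (deriv (\<lambda>w. F (exp w)) w))\<^sup>2 *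
      t (exp w) powr (a - 2) * (a * \<epsilon> + a\<^sup>2 * (norm (F (exp w)))\<^sup>2))"
  obtain Wx Wy where W: "has_lap (\<lambda>w. W (exp w)) Wx Wy LW S"
    unfolding W_def t_def LW_def using has_lap_norm_sq_eps_powr[OF Fe open_halfspace_Re_lt e] by blast
  define LV where "LV = (\<lambda>w. 1/2 * LT w + C * LE w)"
  obtain Vx Vy where V: "has_lap (\<lambda>w. V (exp w)) Vx Vy LV S"
    unfolding V_def LV_def using has_lap_add[OF has_lap_cmult[OF T(1), of "1/2"] has_lap_cmult[OF E(1), of C]] by blast
  \<comment> \<open>If \<open>x\<close> \<le> \<delta> y the first summand suffices. Otherwise y
    \<le> x / \<delta>, and the second one does.\<close>
  have young: "y powr (a - 1) * x \<le> \<delta> * y powr a + \<delta> powr (1 - a) * x powr a" if "x > 0" "y > 0" for x y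
  proof (cases "x \<le> \<delta> * y")
    case True
    then have "y powr (a - 1) * x \<le> y powr (a - 1) * (\<delta> * y)" by (intro mult_left_mono) auto
    also have "\<dots> = \<delta> * y powr a" using powr_mult_base[of y "a - 1"] that by (simp add: mult_ac)
    finally show ?thesis by (simp add: add_increasing2)
  next
    case False
    then have "y \<le> x / \<delta>" using d0 by (simp add: field_simps)
    then have "y powr (a - 1) * x \<le> (x / \<delta>) powr (a - 1) * x"
      using that a by (intro mult_right_mono powr_mono2) auto
    also have "\<dots> = \<delta> powr (1 - a) * x powr a"
    proof -
      have "(x / \<delta>) powr (a - 1) = x powr (a - 1) * \<delta> powr (1 - a)"
        using that d0 powr_minus_divide[of \<delta> "a - 1"] by (simp add: powr_divide)
      then show ?thesis using powr_mult_base[of x "a - 1"] that by (simp add: mult_ac)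
    qed
    finally show ?thesis using d0 by (simp add: add_increasing)
  qed
  have le: "LW w \<le> LV w" if w: "Re w < ln R" for w
  proof -
    define x where "x = exp w"
    define g' where "g' = (norm (deriv (\<lambda>w. g (exp w)) w))\<^sup>2"
    have nn: "g' \<ge> 0" by (auto simp: g'_def)
    have F': "(norm (deriv (\<lambda>w. F (exp w)) w))\<^sup>2 = (norm (f x))\<^sup>2 * g'"
      using dFe[of w] w by (simp add: x_def g'_def norm_mult power_mult_distrib)
    have xb: "exp (- B) \<le> ephi x" using w exp_in_ball[of w] ephi_bounds(1)[of x] by (simp add: x_def)
    have "t x powr (a - 2) * (a * \<epsilon> + a\<^sup>2 * (norm (F x))\<^sup>2) \<le> a * a * t x powr (a - 1)"
      using regularised_power_bounds(2)[OF e, of a "(norm (F x))\<^sup>2"] a by (simp add: t_def max_def)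
    then have "LW w \<le> 4 * ((norm (f x))\<^sup>2 * g') * (a * a * t x powr (a - 1))"
      unfolding LW_def F' x_def[symmetric] mult.assoc using nn by (intro mult_left_mono) auto
    also have "\<dots> \<le> 4 * (s x * g') * (a * a * t x powr (a - 1))"
      using nn e a by (intro mult_right_mono mult_left_mono) (auto simp: s_def)
    also have "\<dots> = 4 * a * a * g' * (t x powr (a - 1) * s x)" by (simp add: mult_ac)
    also have "\<dots> \<le> 4 * a * a * g' * (\<delta> * t x powr a + \<delta> powr (1 - a) * s x powr a)"
      using nn a s0 by (intro mult_left_mono young) auto
    also have "\<dots> = exp B * a\<^sup>2 * \<delta> * (4 * g' * (exp (- B) * t x powr a)) + C * (4 * g' * (exp (-B) * s x powr a))"
    proof -
      have "4 * a * a * g' * (\<delta> * t x powr a + \<delta> powr (1 - a) * s x powr a) =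
         (exp B * exp (- B)) * (4 * a * a * g' * (\<delta> * t x powr a + \<delta> powr (1 - a) * s x powr a))"
        by (simp flip: exp_add)
      also have "\<dots> = exp B * a\<^sup>2 * \<delta> * (4 * g' * (exp (- B) * t x powr a)) + C * (4 * g' * (exp (-B) * s x powr a))"
        by (simp only: C_def algebra_simps power2_eq_square)
      finally show ?thesis .
    qed
    also have "exp B * a\<^sup>2 * \<delta> = 1/2" using a by (simp add: \<delta>_def)
    also have "1/2 * (4 * g' * (exp (- B) * t x powr a)) + C * (4 * g' * (exp (-B) * s x powr a)) \<le> LV w"
      unfolding LV_def
    proof (intro add_mono mult_left_mono C0)
      show "4 * g' * (exp (- B) * t x powr a) \<le> LT w"
      proof -
        have "4 * g' * (exp (- B) * t x powr a) \<le> 4 * g' * (ephi x * t x powr a)"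
          using nn xb by (intro mult_left_mono mult_right_mono) auto
        also have "\<dots> \<le> LT w" using T(2)[of w] w by (simp add: x_def g'_def)
        finally show ?thesis .
      qed
      show "4 * g' * (exp (- B) * s x powr a) \<le> LE w"
      proof -
        have "4 * g' * (exp (- B) * s x powr a) \<le> 4 * g' * (ephi x * s x powr a)"
          using nn xb by (intro mult_left_mono mult_right_mono) auto
        also have "\<dots> \<le> LE w" using E(2)[of w] w by (simp add: x_def g'_def)
        finally show ?thesis .
      qed
    qed simp
    finally show ?thesis .
  qed
  have cs: "continuous_on (ball 0 R) (\<lambda>z. s z powr a)" "continuous_on (ball 0 R) (\<lambda>z. t z powr a)"
    unfolding s_def t_def by (intro continuous_on_norm_sq_eps_powr cont e)+
  have cW: "continuous_on (ball 0 R) W" unfolding W_def by (rule cs)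
  have cV: "continuous_on (ball 0 R) V" unfolding V_def
    by (intro cs continuous_on_add continuous_on_mult continuous_on_const cont_ephi)
  have sub: "sphere 0 r \<subseteq> ball 0 R" using r by (auto simp: subset_iff)
  have V0: "0 \<le> V 0" using C0 ephi_bounds(3) by (simp add: V_def)
  have W0: "W 0 = \<epsilon> powr a" by (simp add: W_def t_def F0)
  have "cmean W r \<le> cmean V r + \<epsilon> powr a"
    using cmean_lap_comparison[OF W V le cW cV r] V0 W0 by simp
  also have "cmean V r \<le> cmean (\<lambda>z. 1/2 * W z + C * s z powr a) r"
  proof (intro cmean_mono continuous_on_subset[OF cV sub] continuous_on_subset[OF _ sub] continuous_on_add continuous_on_mult continuous_on_const cs cW r)
    fix z :: complex assume "norm z = r"
    then have "ephi z * t z powr a \<le> 1 * t z powr a" "ephi z * s z powr a \<le> 1 * s z powr a"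
      using ephi_bounds(2)[of z] r by (intro mult_right_mono; auto)+
    then show "V z \<le> 1/2 * W z + C * s z powr a"
      unfolding V_def W_def using C0 by (intro add_mono mult_left_mono) auto
  qed
  also have "\<dots> = 1/2 * cmean W r + C * cmean (\<lambda>z. s z powr a) r"
  proof -
    have "cmean (\<lambda>z. 1/2 * W z + C * s z powr a) r = cmean (\<lambda>z. 1/2 * W z) r + cmean (\<lambda>z. C * s z powr a) r"
      by (intro cmean_add continuous_on_mult continuous_on_const continuous_on_subset[OF cW sub]
          continuous_on_subset[OF cs(1) sub] r)
    then show ?thesis by (simp only: cmean_cmult)
  qed
  \<comment> \<open>Half of the mean of \<open>W\<close> on the right is moved to the left, which
    doubles the remaining constants.\<close>
  finally have "cmean W r \<le> 2 * C * cmean (\<lambda>z. s z powr a) r + 2 * \<epsilon> powr a" by simp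
  also have "2 * C * cmean (\<lambda>z. s z powr a) r \<le> 2 * C * (2 powr a * cmean (\<lambda>z. norm (f z) powr p) r + 2 powr a * \<epsilon> powr a)"
    unfolding s_def a_def using p C0 by (intro mult_left_mono cmean_norm_sq_eps_powr_le conts r e) auto
  finally have "cmean W r \<le> 2 * C * (2 powr a * cmean (\<lambda>z. norm (f z) powr p) r + 2 powr a * \<epsilon> powr a) + 2 * \<epsilon> powr a"
    by simp
  moreover have "cmean (\<lambda>z. norm (F z) powr p) r \<le> cmean W r"
  proof (intro cmean_mono continuous_on_norm_powr conts r continuous_on_subset[OF cW sub])
    fix z
    have "norm (F z) powr p = ((norm (F z))\<^sup>2) powr a" by (simp add: norm_sq_powr a_def)
    also have "\<dots> \<le> W z" unfolding W_def t_def using a e by (intro powr_mono2) auto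
    finally show "norm (F z) powr p \<le> W z" .
  qed (use p in auto)
  ultimately show "cmean (\<lambda>z. norm (F z) powr p) r \<le>
      2 * (p\<^sup>2/4 * exp B * (p\<^sup>2/2 * exp B) powr (p/2 - 1)) * 2 powr (p/2) * cmean (\<lambda>z. norm (f z) powr p) r
       + (2 * (p\<^sup>2/4 * exp B * (p\<^sup>2/2 * exp B) powr (p/2 - 1)) * 2 powr (p/2) + 2) * \<epsilon> powr (p/2)"
    unfolding Ceq[symmetric] by (simp add: a_def algebra_simps)
qed

end

text \<open>The exponents are balanced so that, for \<open>s = |h|\<^sup>2 + \<epsilon>\<close> and \<open>T = \<lambda> s powr (p/q)\<close>, the factor
  \<open>T powr (q/2 - 1) |h|\<^sup>2\<close> stays bounded by a constant.\<close>
lemma volterra_mean_mixed: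
  fixes h F \<kappa> :: "complex \<Rightarrow> complex" and p q \<Lambda> :: real
  assumes h: "h holomorphic_on ball 0 R" and F: "F holomorphic_on ball 0 R" and R: "R > 0" and F0: "F 0 = 0"
    and dF: "\<And>w. Re w < ln R \<Longrightarrow> deriv (\<lambda>w. F (exp w)) w = h (exp w) * \<kappa> w"
    and Z: "has_lap (\<lambda>w. Z (exp w)) Zx Zy LZ {w. Re w < ln R}" and LZ: "\<And>w. Re w < ln R \<Longrightarrow> (norm (\<kappa> w))\<^sup>2 \<le> LZ w"
    and cZ: "continuous_on (ball 0 R) Z" and Z0: "Z 0 \<ge> 0"
    and p: "1 \<le> p" and q: "q = 2 * p / (p + 2)" and \<Lambda>: "\<Lambda> > 0" and r: "0 \<le> r" "r < R"
  shows "cmean (\<lambda>z. norm (F z) powr q) r \<le> 4 * \<Lambda> powr (q/2 - 1) * cmean Z r +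
    4 * (1 + p/2)\<^sup>2 * \<Lambda> powr (q/2) * 2 powr (p/2) * cmean (\<lambda>z. norm (h z) powr p) r"
proof (rule eps_powr_limit[where a="p/2" and C="4 * (1 + p/2)\<^sup>2 * \<Lambda> powr (q/2) * 2 powr (p/2)"])
  let ?S = "{w::complex. Re w < ln R}"
  define a where "a = q / 2"
  define \<alpha> where "\<alpha> = 1 + p / 2"
  have a: "0 < a" "a \<le> 1" using p by (auto simp: a_def q field_simps)
  have \<alpha>: "\<alpha> \<ge> 1" using p by (simp add: \<alpha>_def)
  \<comment> \<open>As \<alpha> = p/q, the first identity turns the regularising term into a power
    of size |h|^p, and the second cancels exactly the factor |h|^2 that comes from |F'|^2.\<close>
  have e1: "\<alpha> * a = p / 2" and e2: "\<alpha> * (a - 1) = -1"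
    using p by (simp_all add: a_def q \<alpha>_def field_simps)
  show "0 < p / 2" using p by simp
  show "0 \<le> 4 * (1 + p/2)\<^sup>2 * \<Lambda> powr (q/2) * 2 powr (p/2)" by simp
  fix \<epsilon> :: real assume e: "\<epsilon> > 0"
  define s where "s = (\<lambda>z. (norm (h z))\<^sup>2 + \<epsilon>)"
  define W where "W = (\<lambda>z. ((norm (F z))\<^sup>2 + \<Lambda> * s z powr \<alpha>) powr a)"
  \<comment> \<open>\<open>Z\<close> may be any function whose Laplacian dominates the squared
    derivative of the symbol. A small \<Lambda> makes the term with \<open>h\<close> small, at the
    price of a large coefficient of \<open>Z\<close>.\<close>
  define V where "V = (\<lambda>z. 4 * \<Lambda> powr (a - 1) * Z z + 4 * \<alpha>\<^sup>2 * \<Lambda> powr a * s z powr (p/2))"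
  have s0: "s z > 0" for z using e by (simp add: s_def add_nonneg_pos)
  have T0: "\<Lambda> * s z powr \<alpha> > 0" for z using s0[of z] \<Lambda> by simp
  note he = holomorphic_comp_exp(1)[OF h R] and Fe = holomorphic_comp_exp(1)[OF F R]
  obtain Yx Yy where Y: "has_lap (\<lambda>w. s (exp w) powr \<alpha>) Yx Yy (\<lambda>w. 4 * (norm (deriv (\<lambda>w. h (exp w)) w))\<^sup>2 *
      s (exp w) powr (\<alpha> - 2) * (\<alpha> * \<epsilon> + \<alpha>\<^sup>2 * (norm (h (exp w)))\<^sup>2)) ?S"
    unfolding s_def using has_lap_norm_sq_eps_powr[OF he open_halfspace_Re_lt e] by blast
  obtain Px Py where P: "has_lap (\<lambda>w. s (exp w) powr (p/2)) Px Py (\<lambda>w. 4 * (norm (deriv (\<lambda>w. h (exp w)) w))\<^sup>2 *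
      s (exp w) powr (p/2 - 2) * (p/2 * \<epsilon> + (p/2)\<^sup>2 * (norm (h (exp w)))\<^sup>2)) ?S"
    unfolding s_def using has_lap_norm_sq_eps_powr[OF he open_halfspace_Re_lt e] by blast
  obtain Ax Ay where A: "has_lap (\<lambda>w. (norm (F (exp w)))\<^sup>2) Ax Ay (\<lambda>w. 4 * (norm (deriv (\<lambda>w. F (exp w)) w))\<^sup>2) ?S"
    using has_lap_norm_sq[OF Fe open_halfspace_Re_lt] by blast
  define LY where "LY = (\<lambda>w. 4 * (norm (deriv (\<lambda>w. F (exp w)) w))\<^sup>2 + \<Lambda> * (4 * (norm (deriv (\<lambda>w. h (exp w)) w))\<^sup>2 *
      s (exp w) powr (\<alpha> - 2) * (\<alpha> * \<epsilon> + \<alpha>\<^sup>2 * (norm (h (exp w)))\<^sup>2)))"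
  define LW where "LW = (\<lambda>w. a * ((norm (F (exp w)))\<^sup>2 + \<Lambda> * s (exp w) powr \<alpha>) powr (a - 1) * LY w +
      a * (a - 1) * ((norm (F (exp w)))\<^sup>2 + \<Lambda> * s (exp w) powr \<alpha>) powr (a - 2) *
        ((Ax w + \<Lambda> * Yx w)\<^sup>2 + (Ay w + \<Lambda> * Yy w)\<^sup>2))"
  obtain Wx Wy where W: "has_lap (\<lambda>w. W (exp w)) Wx Wy LW ?S"
    unfolding W_def LW_def LY_def using has_lap_powr[OF has_lap_add[OF A has_lap_cmult[OF Y, of \<Lambda>]], of a] T0
    by (blast intro: add_nonneg_pos zero_le_power2)
  define LV where "LV = (\<lambda>w. 4 * \<Lambda> powr (a - 1) * LZ w + 4 * \<alpha>\<^sup>2 * \<Lambda> powr a * (4 * (norm (deriv (\<lambda>w. h (exp w)) w))\<^sup>2 *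
      s (exp w) powr (p/2 - 2) * (p/2 * \<epsilon> + (p/2)\<^sup>2 * (norm (h (exp w)))\<^sup>2)))"
  obtain Vx Vy where V: "has_lap (\<lambda>w. V (exp w)) Vx Vy LV ?S"
    unfolding V_def LV_def using has_lap_add[OF has_lap_cmult[OF Z, of "4 * \<Lambda> powr (a - 1)"] has_lap_cmult[OF P, of "4 * \<alpha>\<^sup>2 * \<Lambda> powr a"]] by blast
  have le: "LW w \<le> LV w" if w: "Re w < ln R" for w
  proof -
    define x where "x = exp w"
    define h' where "h' = (norm (deriv (\<lambda>w. h (exp w)) w))\<^sup>2"
    define k where "k = (norm (\<kappa> w))\<^sup>2"
    define T where "T = \<Lambda> * s x powr \<alpha>"
    have nn: "h' \<ge> 0" "k \<ge> 0" by (auto simp: h'_def k_def)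
    have Tpos: "T > 0" using T0 by (simp add: T_def)
    have F': "(norm (deriv (\<lambda>w. F (exp w)) w))\<^sup>2 = (norm (h x))\<^sup>2 * k"
      using dF[OF w] by (simp add: x_def k_def norm_mult power_mult_distrib)
    have LYeq: "LY w = 4 * ((norm (h x))\<^sup>2 * k) + \<Lambda> * (4 * h' * s x powr (\<alpha> - 2) * (\<alpha> * \<epsilon> + \<alpha>\<^sup>2 * (norm (h x))\<^sup>2))"
      by (simp only: LY_def F' x_def h'_def)
    have LY0: "LY w \<ge> 0" unfolding LYeq using nn e \<alpha> \<Lambda> by simp
    have LYle: "LY w \<le> 4 * (s x * k) + \<Lambda> * (4 * h' * (\<alpha>\<^sup>2 * s x powr (\<alpha> - 1)))"
    proof -
      have 1: "(norm (h x))\<^sup>2 * k \<le> s x * k" using nn e by (intro mult_right_mono) (auto simp: s_def)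
      have 2: "s x powr (\<alpha> - 2) * (\<alpha> * \<epsilon> + \<alpha>\<^sup>2 * (norm (h x))\<^sup>2) \<le> \<alpha>\<^sup>2 * s x powr (\<alpha> - 1)"
        using regularised_power_bounds(2)[OF e, of \<alpha> "(norm (h x))\<^sup>2"] \<alpha> by (simp add: s_def max_def power2_eq_square)
      have "\<Lambda> * (4 * h' * (s x powr (\<alpha> - 2) * (\<alpha> * \<epsilon> + \<alpha>\<^sup>2 * (norm (h x))\<^sup>2))) \<le> \<Lambda> * (4 * h' * (\<alpha>\<^sup>2 * s x powr (\<alpha> - 1)))"
        using nn \<Lambda> by (intro mult_left_mono 2) auto
      then show ?thesis unfolding LYeq using 1 by (simp only: mult.assoc)
    qed
    have Ta: "T powr (a - 1) = \<Lambda> powr (a - 1) * s x powr (-1)"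
      using \<Lambda> s0[of x] e2 by (simp add: T_def powr_mult powr_powr)
    have "a * (a - 1) * ((norm (F x))\<^sup>2 + T) powr (a - 2) * ((Ax w + \<Lambda> * Yx w)\<^sup>2 + (Ay w + \<Lambda> * Yy w)\<^sup>2) \<le> 0"
      using a by (intro mult_nonpos_nonneg mult_nonneg_nonpos) auto
    then have "LW w \<le> a * ((norm (F x))\<^sup>2 + T) powr (a - 1) * LY w"
      unfolding LW_def x_def[symmetric] T_def[symmetric] by simp
    also have "\<dots> \<le> 1 * T powr (a - 1) * LY w"
      using a Tpos LY0 by (intro mult_right_mono mult_mono powr_mono2') auto
    also have "\<dots> \<le> 1 * T powr (a - 1) * (4 * (s x * k) + \<Lambda> * (4 * h' * (\<alpha>\<^sup>2 * s x powr (\<alpha> - 1))))"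
      using LYle by (intro mult_left_mono) auto
    also have "\<dots> = 4 * \<Lambda> powr (a - 1) * k + 4 * \<alpha>\<^sup>2 * \<Lambda> powr a * (h' * s x powr (p/2 - 1))"
    proof -
      have 1: "s x powr (-1) * s x = 1" using s0[of x] powr_mult_base[of "s x" "-1"] by (simp add: mult.commute)
      have 2: "\<Lambda> powr (a - 1) * \<Lambda> = \<Lambda> powr a" using \<Lambda> powr_mult_base[of \<Lambda> "a - 1"] by (simp add: mult.commute)
      have 3: "s x powr (-1) * s x powr (\<alpha> - 1) = s x powr (p/2 - 1)"
        unfolding powr_add[symmetric] by (simp add: \<alpha>_def)
      have "1 * T powr (a - 1) * (4 * (s x * k) + \<Lambda> * (4 * h' * (\<alpha>\<^sup>2 * s x powr (\<alpha> - 1)))) =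
        4 * \<Lambda> powr (a - 1) * k * (s x powr (-1) * s x) + 4 * \<alpha>\<^sup>2 * (\<Lambda> powr (a - 1) * \<Lambda>) * (h' * (s x powr (-1) * s x powr (\<alpha> - 1)))"
        unfolding Ta by (simp only: algebra_simps)
      then show ?thesis unfolding 1 2 3 by simp
    qed
    also have "\<dots> \<le> LV w" unfolding LV_def x_def[symmetric] h'_def[symmetric]
    proof (intro add_mono mult_left_mono)
      show "k \<le> LZ w" using LZ[OF w] by (simp add: k_def)
      \<comment> \<open>For p \<ge> 1 the lower constant of the regularised Laplacian is at least
        1/4, which its factor 4 compensates.\<close>
      have "1/4 \<le> p/2 * min 1 (p/2)" using p mult_mono[of "1/2" "p/2" "1/2" "p/2"] by (auto simp: min_def)
      then have "1/4 * s x powr (p/2 - 1) \<le> p/2 * min 1 (p/2) * s x powr (p/2 - 1)" by (intro mult_right_mono) auto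
      also have "\<dots> \<le> s x powr (p/2 - 2) * (p/2 * \<epsilon> + (p/2)\<^sup>2 * (norm (h x))\<^sup>2)"
        using regularised_power_bounds(1)[OF e, of "p/2" "(norm (h x))\<^sup>2"] p by (simp add: s_def)
      finally have "4 * h' * (1/4 * s x powr (p/2 - 1)) \<le> 4 * h' * (s x powr (p/2 - 2) * (p/2 * \<epsilon> + (p/2)\<^sup>2 * (norm (h x))\<^sup>2))"
        using nn by (intro mult_left_mono) auto
      then show "h' * s x powr (p/2 - 1) \<le> 4 * h' * s x powr (p/2 - 2) * (p/2 * \<epsilon> + (p/2)\<^sup>2 * (norm (h x))\<^sup>2)"
        by (simp add: mult.assoc)
    qed auto
    finally show ?thesis .
  qed
  have ch: "continuous_on (ball 0 R) h" "continuous_on (ball 0 R) F"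
    using h F by (auto intro: holomorphic_on_imp_continuous_on)
  have cs: "continuous_on (ball 0 R) (\<lambda>z. s z powr b)" for b
    unfolding s_def by (intro continuous_on_norm_sq_eps_powr ch e)
  have cT: "continuous_on (ball 0 R) (\<lambda>z. (norm (F z))\<^sup>2 + \<Lambda> * s z powr \<alpha>)"
    by (intro continuous_on_add continuous_on_mult continuous_on_const cs continuous_on_power continuous_on_norm ch)
  have cW: "continuous_on (ball 0 R) W" unfolding W_def
    using T0 by (intro continuous_on_powr cT continuous_on_const) (metis add_nonneg_pos less_irrefl zero_le_power2)
  have cV: "continuous_on (ball 0 R) V" unfolding V_def
    by (intro cs continuous_on_add continuous_on_mult continuous_on_const cZ)
  have sub: "sphere 0 r \<subseteq> ball 0 R" using r by (auto simp: subset_iff)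
  have "W 0 \<le> V 0"
  proof -
    have "W 0 = \<Lambda> powr a * s 0 powr (p/2)" using \<Lambda> s0[of 0] by (simp add: W_def F0 powr_mult powr_powr e1)
    also have "\<dots> \<le> 4 * \<alpha>\<^sup>2 * (\<Lambda> powr a * s 0 powr (p/2))"
    proof -
      have "1 * (\<Lambda> powr a * s 0 powr (p/2)) \<le> 4 * \<alpha>\<^sup>2 * (\<Lambda> powr a * s 0 powr (p/2))"
        using one_le_power[OF \<alpha>, of 2] by (intro mult_right_mono) auto
      then show ?thesis by simp
    qed
    finally show ?thesis using Z0 by (simp add: V_def mult.assoc add_increasing)
  qed
  then have "cmean W r \<le> cmean V r"
    using cmean_lap_comparison[OF W V le cW cV r] by simp
  also have "\<dots> = 4 * \<Lambda> powr (a - 1) * cmean Z r + 4 * \<alpha>\<^sup>2 * \<Lambda> powr a * cmean (\<lambda>z. s z powr (p/2)) r"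
  proof -
    have "cmean V r = cmean (\<lambda>z. 4 * \<Lambda> powr (a - 1) * Z z) r + cmean (\<lambda>z. 4 * \<alpha>\<^sup>2 * \<Lambda> powr a * s z powr (p/2)) r"
      unfolding V_def by (intro cmean_add continuous_on_mult continuous_on_const continuous_on_subset[OF cZ sub]
          continuous_on_subset[OF cs sub] r)
    then show ?thesis by (simp only: cmean_cmult)
  qed
  also have "\<dots> \<le> 4 * \<Lambda> powr (a - 1) * cmean Z r + 4 * \<alpha>\<^sup>2 * \<Lambda> powr a *
      (2 powr (p/2) * cmean (\<lambda>z. norm (h z) powr p) r + 2 powr (p/2) * \<epsilon> powr (p/2))"
    unfolding s_def using p continuous_on_subset[OF ch(1) sub] r e
    by (intro add_left_mono mult_left_mono cmean_norm_sq_eps_powr_le) auto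
  finally have "cmean W r \<le> \<dots>" .
  moreover have "cmean (\<lambda>z. norm (F z) powr q) r \<le> cmean W r"
  proof (intro cmean_mono continuous_on_norm_powr continuous_on_subset[OF ch(2) sub] r continuous_on_subset[OF cW sub])
    show "0 < q" using a by (simp add: a_def)
    fix z
    have "norm (F z) powr q = ((norm (F z))\<^sup>2) powr a" by (simp add: norm_sq_powr a_def)
    also have "\<dots> \<le> W z" unfolding W_def using a T0[of z] by (intro powr_mono2) auto
    finally show "norm (F z) powr q \<le> W z" .
  qed
  ultimately show "cmean (\<lambda>z. norm (F z) powr q) r \<le> 4 * \<Lambda> powr (q/2 - 1) * cmean Z r +
    4 * (1 + p/2)\<^sup>2 * \<Lambda> powr (q/2) * 2 powr (p/2) * cmean (\<lambda>z. norm (h z) powr p) r +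
    4 * (1 + p/2)\<^sup>2 * \<Lambda> powr (q/2) * 2 powr (p/2) * \<epsilon> powr (p/2)"
    by (simp add: a_def \<alpha>_def algebra_simps)
qed

text \<open>The symbol is P + u and the function is z^N h. In the logarithmic coordinate z^(N+1) has
  derivative (N+1) z^(N+1), so K^2/(N+1)^2 |z^(N+1)|^2 has Laplacian 4 K^2 |z^(N+1)|^2. A high order
  of vanishing thus makes the smooth part of the symbol negligible, however large \<open>K\<close>
  is. In the part with \<open>u\<close> the factor z^N is bounded by 1.\<close>

lemma volterra_mean_high_order:
  fixes h F g u :: "complex \<Rightarrow> complex" and p q \<Lambda> K :: real
  assumes h: "h holomorphic_on ball 0 1" and F: "F holomorphic_on ball 0 1" and F0: "F 0 = 0"
    and P: "P holomorphic_on ball 0 1" and u: "u holomorphic_on ball 0 1"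
    and dF: "\<And>z. z \<in> ball 0 1 \<Longrightarrow> deriv F z = z ^ N * h z * (deriv P z + deriv u z)"
    and K: "\<And>z. z \<in> ball 0 1 \<Longrightarrow> norm (deriv P z) \<le> K"
    and p: "1 \<le> p" and q: "q = 2 * p / (p + 2)" and \<Lambda>: "\<Lambda> > 0" and r: "0 \<le> r" "r < 1"
  shows "cmean (\<lambda>z. norm (F z) powr q) r \<le> 4 * \<Lambda> powr (q/2 - 1) *
      (cmean (\<lambda>z. (norm (u z))\<^sup>2) r + K\<^sup>2 / (real N + 1)\<^sup>2) +
    4 * (1 + p/2)\<^sup>2 * \<Lambda> powr (q/2) * 2 powr (p/2) * cmean (\<lambda>z. norm (h z) powr p) r"
proof -
  define c where "c = K\<^sup>2 / (real N + 1)\<^sup>2"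
  define Z where "Z = (\<lambda>z::complex. (norm (u z))\<^sup>2 + c * (norm (z ^ (N + 1)))\<^sup>2)"
  define \<kappa> where "\<kappa> = (\<lambda>w::complex. exp w ^ N * (deriv P (exp w) + deriv u (exp w)) * exp w)"
  define E where "E = (\<lambda>w::complex. exp (of_nat (N + 1) * w))"
  have R: "(0::real) < 1" by simp
  have Eh: "E holomorphic_on {w. Re w < ln 1}" unfolding E_def by (intro holomorphic_intros)
  have dE: "deriv E w = of_nat (N + 1) * E w" for w
    unfolding E_def by (rule DERIV_imp_deriv) (auto intro!: derivative_eq_intros)
  have E: "E w = exp w ^ (N + 1)" for w unfolding E_def by (rule exp_of_nat_mult)
  obtain Ux Uy where U: "has_lap (\<lambda>w. (norm (u (exp w)))\<^sup>2) Ux Uy (\<lambda>w. 4 * (norm (deriv (\<lambda>w. u (exp w)) w))\<^sup>2) {w. Re w < ln 1}"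
    using has_lap_norm_sq[OF holomorphic_comp_exp(1)[OF u R] open_halfspace_Re_lt] by blast
  obtain Ex Ey where EL: "has_lap (\<lambda>w. (norm (E w))\<^sup>2) Ex Ey (\<lambda>w. 4 * (norm (deriv E w))\<^sup>2) {w. Re w < ln 1}"
    using has_lap_norm_sq[OF Eh open_halfspace_Re_lt] by blast
  obtain Zx Zy where Zl: "has_lap (\<lambda>w. Z (exp w)) Zx Zy
     (\<lambda>w. 4 * (norm (deriv (\<lambda>w. u (exp w)) w))\<^sup>2 + c * (4 * (norm (deriv E w))\<^sup>2)) {w. Re w < ln 1}"
    unfolding Z_def E[symmetric] using has_lap_add[OF U has_lap_cmult[OF EL, of c]] by blast
  have inb: "exp w \<in> ball 0 1" if "Re w < ln 1" for w :: complex using that by (simp add: norm_exp_eq_Re)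
  have A: "cmean (\<lambda>z. norm (F z) powr q) r \<le> 4 * \<Lambda> powr (q/2 - 1) * cmean Z r +
    4 * (1 + p/2)\<^sup>2 * \<Lambda> powr (q/2) * 2 powr (p/2) * cmean (\<lambda>z. norm (h z) powr p) r"
  proof (rule volterra_mean_mixed[OF h F R F0 _ Zl _ _ _ p q \<Lambda> r])
    show "deriv (\<lambda>w. F (exp w)) w = h (exp w) * \<kappa> w" if "Re w < ln 1" for w
      using holomorphic_comp_exp(2)[OF F R that] dF[OF inb[OF that]] by (simp add: \<kappa>_def mult_ac)
    show "(norm (\<kappa> w))\<^sup>2 \<le> 4 * (norm (deriv (\<lambda>w. u (exp w)) w))\<^sup>2 + c * (4 * (norm (deriv E w))\<^sup>2)" if w: "Re w < ln 1" for w
    proof -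
      define x where "x = exp w"
      have x: "norm x < 1" using inb[OF w] by (simp add: x_def)
      have "norm (\<kappa> w) = norm (x ^ N * deriv P x * x + x ^ N * (deriv u x * x))"
        by (simp add: \<kappa>_def x_def algebra_simps)
      also have "\<dots> \<le> norm (x ^ N * deriv P x * x) + norm (x ^ N * (deriv u x * x))" by (rule norm_triangle_ineq)
      also have "\<dots> \<le> K * norm (x ^ (N + 1)) + 1 * norm (deriv u x * x)"
      proof (rule add_mono)
        have "norm (deriv P x) * norm (x ^ (N + 1)) \<le> K * norm (x ^ (N + 1))"
          using K[of x] x by (intro mult_right_mono) auto
        then show "norm (x ^ N * deriv P x * x) \<le> K * norm (x ^ (N + 1))" by (simp add: norm_mult mult_ac)
        have "norm x ^ N * norm (deriv u x * x) \<le> 1 * norm (deriv u x * x)"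
          using x by (intro mult_right_mono power_le_one) auto
        then show "norm (x ^ N * (deriv u x * x)) \<le> 1 * norm (deriv u x * x)" by (simp add: norm_mult norm_power)
      qed
      finally have 1: "norm (\<kappa> w) \<le> K * norm (E w) + norm (deriv (\<lambda>w. u (exp w)) w)"
        using holomorphic_comp_exp(2)[OF u R w] by (simp add: x_def E)
      have "(norm (\<kappa> w))\<^sup>2 \<le> (K * norm (E w) + norm (deriv (\<lambda>w. u (exp w)) w))\<^sup>2"
        using 1 by (intro power_mono) auto
      also have "\<dots> \<le> 4 * (K * norm (E w))\<^sup>2 + 4 * (norm (deriv (\<lambda>w. u (exp w)) w))\<^sup>2"
      proof -
        have "(x + y)\<^sup>2 \<le> 4 * x\<^sup>2 + 4 * y\<^sup>2" for x y :: real
          using sum_squares_bound[of x y] zero_le_power2[of x] zero_le_power2[of y] unfolding power2_sum by linarith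
        then show ?thesis .
      qed
      also have "4 * (K * norm (E w))\<^sup>2 = c * (4 * (norm (deriv E w))\<^sup>2)"
        unfolding dE c_def norm_mult power_mult_distrib norm_of_nat by (simp add: field_simps)
      finally show ?thesis by simp
    qed
    show "continuous_on (ball 0 1) Z" unfolding Z_def
      using u by (intro continuous_intros holomorphic_on_imp_continuous_on)
    show "0 \<le> Z 0" by (simp add: Z_def)
  qed
  have "cmean Z r \<le> cmean (\<lambda>z. (norm (u z))\<^sup>2 + c) r"
  proof (intro cmean_mono r)
    have "continuous_on (sphere 0 r) u" using continuous_on_sphere_comp[OF u] r by simp
    then show "continuous_on (sphere 0 r) Z" "continuous_on (sphere 0 r) (\<lambda>z. (norm (u z))\<^sup>2 + c)"
      unfolding Z_def by (auto intro!: continuous_intros)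
    fix z :: complex assume "norm z = r"
    then have "norm (z ^ (N + 1)) \<le> 1" using r unfolding norm_power by (intro power_le_one) auto
    then have "(norm (z ^ (N + 1)))\<^sup>2 \<le> 1" by (intro power_le_one) auto
    then show "Z z \<le> (norm (u z))\<^sup>2 + c"
      unfolding Z_def by (intro add_left_mono mult_left_le) (auto simp: c_def)
  qed
  also have "\<dots> = cmean (\<lambda>z. (norm (u z))\<^sup>2) r + c"
    using continuous_on_sphere_comp[OF u, of r] r by (subst cmean_add) (auto intro!: continuous_intros)
  finally have "4 * \<Lambda> powr (q/2 - 1) * cmean Z r \<le> 4 * \<Lambda> powr (q/2 - 1) * (cmean (\<lambda>z. (norm (u z))\<^sup>2) r + c)"
    by (intro mult_left_mono) auto
  with A show ?thesis unfolding c_def by linarith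
qed

subsection \<open>Poisson integrals and the BMOA potential\<close>

text \<open>For an antiderivative \<open>A\<close> the integral over a period is A (u + 2 pi) - A u,
  and this has derivative 0 in \<open>u\<close>. The number \<open>N\<close> gives a compact
  interval that contains both periods.\<close>

lemma integral_periodic_shift:
  fixes q :: "real \<Rightarrow> real"
  assumes q: "continuous_on UNIV q" and per: "\<And>x. q (x + 2*pi) = q x"
  shows "integral {c..c + 2*pi} q = integral {0..2*pi} q"
proof -
  define N where "N = \<bar>c\<bar> + 2*pi"
  have cq: "continuous_on S q" for S using q continuous_on_subset by blast
  obtain A where A: "\<And>x. x \<in> {-N..N} \<Longrightarrow> (A has_vector_derivative q x) (at x within {-N..N})"
    using antiderivative_continuous[OF cq[of "{-N..N}"]] by blast
  have ftc: "integral {u..u + 2*pi} q = A (u + 2*pi) - A u" if "u \<in> {-N..N - 2*pi}" for u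
  proof (rule integral_unique[OF fundamental_theorem_of_calculus])
    show "(A has_vector_derivative q x) (at x within {u..u + 2*pi})" if "x \<in> {u..u+2*pi}" for x
      using has_vector_derivative_within_subset[OF A[of x], of "{u..u+2*pi}"] that \<open>u \<in> _\<close> pi_gt_zero by auto
  qed simp
  define D where "D u = A (u + 2*pi) - A u" for u
  have dD: "(D has_vector_derivative 0) (at u within {-N..N - 2*pi})" if u: "u \<in> {-N..N - 2*pi}" for u
  proof -
    have "(A has_vector_derivative q (u + 2*pi)) (at (u + 2*pi) within (\<lambda>u. u + 2*pi) ` {-N..N - 2*pi})"
    proof (rule has_vector_derivative_within_subset[OF A])
      have "- N \<le> u + 2*pi" using u pi_gt_zero unfolding atLeastAtMost_iff by linarith
      then show "u + 2*pi \<in> {-N..N}" using u by auto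
      show "(\<lambda>u. u + 2*pi) ` {-N..N - 2*pi} \<subseteq> {-N..N}"
      proof (rule image_subsetI)
        fix x assume "x \<in> {-N..N - 2*pi}"
        then show "x + 2*pi \<in> {-N..N}" using pi_gt_zero unfolding atLeastAtMost_iff by linarith
      qed
    qed
    moreover have "((\<lambda>u. u + 2*pi) has_vector_derivative 1) (at u within {-N..N - 2*pi})"
      by (auto intro!: derivative_eq_intros)
    ultimately have "(A \<circ> (\<lambda>u. u + 2*pi) has_vector_derivative 1 *\<^sub>R q (u + 2*pi)) (at u within {-N..N - 2*pi})"
      by (intro vector_diff_chain_within)
    moreover have "(A has_vector_derivative q u) (at u within {-N..N - 2*pi})"
    proof (rule has_vector_derivative_within_subset[OF A])
      show "u \<in> {-N..N}" "{-N..N - 2*pi} \<subseteq> {-N..N}" using u pi_gt_zero by (simp; linarith)+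
    qed
    ultimately have "((\<lambda>u. (A \<circ> (\<lambda>u. u + 2*pi)) u - A u) has_vector_derivative 1 *\<^sub>R q (u + 2*pi) - q u) (at u within {-N..N - 2*pi})"
      by (rule has_vector_derivative_diff)
    then show ?thesis by (simp add: D_def[abs_def] o_def per)
  qed
  obtain k where k: "\<And>u. u \<in> {-N..N - 2*pi} \<Longrightarrow> D u = k"
    using has_vector_derivative_zero_constant[of "{-N..N - 2*pi}" D] dD by auto
  have cN: "c \<in> {-N..N - 2*pi}" "0 \<in> {-N..N - 2*pi}"
    using pi_gt_zero unfolding atLeastAtMost_iff N_def by linarith+
  have "integral {c..c + 2*pi} q = D c" "integral {0..0 + 2*pi} q = D 0" using ftc cN by (simp_all only: D_def)
  then show ?thesis using k[OF cN(1)] k[OF cN(2)] by simp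
qed

text \<open>Monotonicity of means applies to a harmonic function and to its negative.\<close>

lemma cmean_Re_holomorphic:
  assumes "h holomorphic_on ball 0 R" "0 \<le> r" "r < R"
  shows "cmean (\<lambda>z. Re (h z)) r = Re (h 0)"
proof -
  have R: "R > 0" using assms by simp
  have c: "continuous_on (ball 0 R) h" using assms(1) by (rule holomorphic_on_imp_continuous_on)
  then have i: "isCont h 0" using R by (simp add: continuous_on_eq_continuous_at)
  note lap = has_lap_Re_holomorphic[OF holomorphic_comp_exp(1)[OF assms(1) R] open_halfspace_Re_lt]
  have "cmean (\<lambda>z. Re (h z)) 0 \<le> cmean (\<lambda>z. Re (h z)) r"
    by (rule cmean_mono_lap[OF lap]) (use assms R i in auto)
  moreover have "cmean (\<lambda>z. -1 * Re (h z)) 0 \<le> cmean (\<lambda>z. -1 * Re (h z)) r"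
    by (rule cmean_mono_lap[OF has_lap_cmult[OF lap, of "-1"]]) (use assms R i in auto)
  ultimately show ?thesis by (simp add: cmean_uminus)
qed

text \<open>The classical kernel at the point \<open>a\<close> of the disc and the angle \<theta>,
  with total mass 2 pi. It enters as the angular speed of \<open>disc_aut a\<close> along the unit
  circle.\<close>

definition poisson_kernel :: "complex \<Rightarrow> real \<Rightarrow> real" where
  "poisson_kernel a \<theta> = (1 - (norm a)\<^sup>2) / (norm (1 - cnj a * cis \<theta>))\<^sup>2"

lemma one_minus_cnj_mult_nonzero:
  assumes "norm a < 1" "norm z \<le> 1"
  shows "1 - cnj a * z \<noteq> 0"
proof
  assume "1 - cnj a * z = 0"
  then have "norm (cnj a * z) = 1" by (metis eq_iff_diff_eq_0 norm_one)
  moreover have "norm a * norm z \<le> norm a" using assms by (intro mult_left_le) auto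
  ultimately show False using assms by (simp add: norm_mult)
qed

lemma poisson_kernel_nonneg: "norm a < 1 \<Longrightarrow> 0 \<le> poisson_kernel a \<theta>"
  unfolding poisson_kernel_def by (simp add: power_le_one abs_square_le_1)

lemma continuous_on_poisson_kernel: "norm a < 1 \<Longrightarrow> continuous_on S (poisson_kernel a)"
  unfolding poisson_kernel_def[abs_def] using one_minus_cnj_mult_nonzero[of a "cis _"]
  by (intro continuous_intros) auto

text \<open>The first form is holomorphic in cis \<theta> and yields the total mass by the mean
  value property. The second is holomorphic in \<open>a\<close> and makes Poisson integrals real
  parts of holomorphic functions. The two fractions are complex conjugates of each other.\<close>

lemma poisson_kernel_Re:
  assumes "norm a < 1"
  shows "poisson_kernel a \<theta> = Re ((1 + cnj a * cis \<theta>) / (1 - cnj a * cis \<theta>))"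
    and "poisson_kernel a \<theta> = Re ((cis \<theta> + a) / (cis \<theta> - a))"
proof -
  define z where "z = cis \<theta>"
  have z: "z * cnj z = 1" by (simp add: z_def cis_cnj cis_mult)
  have key: "Re ((1 + w) / (1 - w)) = (1 - (norm w)\<^sup>2) / (norm (1 - w))\<^sup>2" for w :: complex
  proof -
    have "Re ((1 + w) / (1 - w)) = ((1 + Re w) * (1 - Re w) - Im w * Im w) / ((1 - Re w)\<^sup>2 + (Im w)\<^sup>2)"
      by (simp add: Re_divide)
    then show ?thesis unfolding cmod_power2 by (simp add: power2_eq_square algebra_simps)
  qed
  have n: "norm (cnj a * z) = norm a" by (simp add: z_def norm_mult)
  show 1: "poisson_kernel a \<theta> = Re ((1 + cnj a * cis \<theta>) / (1 - cnj a * cis \<theta>))"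
    using key[of "cnj a * z"] n by (simp add: poisson_kernel_def z_def)
  have "(z + a) / (z - a) = (z * (1 + a * cnj z)) / (z * (1 - a * cnj z))"
    using z by (simp add: algebra_simps)
  also have "\<dots> = cnj ((1 + cnj a * z) / (1 - cnj a * z))" using z by (simp add: z_def)
  finally show "poisson_kernel a \<theta> = Re ((cis \<theta> + a) / (cis \<theta> - a))"
    unfolding 1 z_def by (metis complex_cnj complex.sel(1) cnj.sel(1))
qed

lemma integral_poisson_kernel:
  assumes "norm a < 1"
  shows "integral {0..2*pi} (poisson_kernel a) = 2 * pi"
proof -
  \<comment> \<open>The quotient is holomorphic up to its pole at distance 1/|a|. For a = 0 any
    radius above 1 serves.\<close>
  define \<rho> where "\<rho> = (if a = 0 then 2 else 1 / norm a)"
  have r: "\<rho> > 1" using assms by (simp add: \<rho>_def)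
  have "norm (cnj a * z) < 1" if "norm z < \<rho>" for z
    using that by (cases "a = 0") (auto simp: \<rho>_def norm_mult field_simps)
  then have "(\<lambda>z. (1 + cnj a * z) / (1 - cnj a * z)) holomorphic_on ball 0 \<rho>"
    by (intro holomorphic_intros) fastforce
  from cmean_Re_holomorphic[OF this, of 1] r
  have "integral {0..2*pi} (\<lambda>\<theta>. Re ((1 + cnj a * cis \<theta>) / (1 - cnj a * cis \<theta>))) = 2 * pi"
    by (simp add: cmean_def field_simps)
  then show ?thesis unfolding poisson_kernel_Re(1)[OF assms, symmetric] .
qed

section \<open>Change of variables by disc automorphisms\<close>

lemma disc_aut_in_disc:
  assumes "norm a < 1"
  shows "norm z = 1 \<Longrightarrow> norm (disc_aut a z) = 1" and "norm z < 1 \<Longrightarrow> norm (disc_aut a z) < 1"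
    and "norm z \<le> 1 \<Longrightarrow> disc_aut a (disc_aut a z) = z"
proof -
  \<comment> \<open>The right side vanishes on the unit circle and is positive inside, which gives
    both invariance statements.\<close>
  have id: "(norm (1 - cnj a * z))\<^sup>2 - (norm (a - z))\<^sup>2 = (1 - (norm a)\<^sup>2) * (1 - (norm z)\<^sup>2)"
    unfolding cmod_power2 by (simp add: algebra_simps power2_eq_square)
  have nz: "norm (1 - cnj a * z) > 0" if "norm z \<le> 1"
    using one_minus_cnj_mult_nonzero[OF assms that] by simp
  have a1: "1 - (norm a)\<^sup>2 > 0" using assms by (simp add: abs_square_less_1)
  show "norm (disc_aut a z) = 1" if "norm z = 1"
  proof -
    have "(norm (1 - cnj a * z))\<^sup>2 = (norm (a - z))\<^sup>2" using id that by simp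
    then have "norm (1 - cnj a * z) = norm (a - z)" by (simp add: power2_eq_iff_nonneg)
    then show ?thesis using nz that by (simp add: disc_aut_def norm_divide)
  qed
  show "norm (disc_aut a z) < 1" if "norm z < 1"
  proof -
    have "(norm (1 - cnj a * z))\<^sup>2 - (norm (a - z))\<^sup>2 > 0"
      unfolding id using that a1 by (intro mult_pos_pos) (auto simp: abs_square_less_1)
    then have "norm (a - z) < norm (1 - cnj a * z)" using power_less_imp_less_base[of "norm (a - z)" 2 "norm (1 - cnj a * z)"] by simp
    then show ?thesis using nz that by (simp add: disc_aut_def norm_divide)
  qed
  show "disc_aut a (disc_aut a z) = z" if "norm z \<le> 1"
  proof -
    define d where "d = 1 - cnj a * z"
    have d: "d \<noteq> 0" using one_minus_cnj_mult_nonzero[OF assms that] by (simp add: d_def)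
    have c: "1 - cnj a * a \<noteq> 0" using one_minus_cnj_mult_nonzero[OF assms, of a] assms by simp
    have "a - (a - z) / d = (a * d - (a - z)) / d" using d by (simp add: field_simps)
    also have "a * d - (a - z) = z * (1 - cnj a * a)" by (simp add: d_def algebra_simps)
    finally have 1: "a - (a - z) / d = z * (1 - cnj a * a) / d" .
    have "1 - cnj a * ((a - z) / d) = (d - cnj a * (a - z)) / d" using d by (simp add: field_simps)
    also have "d - cnj a * (a - z) = 1 - cnj a * a" by (simp add: d_def algebra_simps)
    finally have 2: "1 - cnj a * ((a - z) / d) = (1 - cnj a * a) / d" .
    show ?thesis unfolding disc_aut_def d_def[symmetric] 1 2 using c d by simp
  qed
qed

text \<open>A point moving on the unit circle has velocity \<i> times itself times a real angular
  speed. That this speed is the Poisson kernel makes the kernel the Jacobian of the boundary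
  map.\<close>

lemma disc_aut_cis_derivative:
  assumes "norm a < 1"
  shows "((\<lambda>\<theta>. disc_aut a (cis \<theta>)) has_vector_derivative \<i> * of_real (poisson_kernel a \<theta>) * disc_aut a (cis \<theta>)) (at \<theta> within T)"
proof -
  define z where "z = cis \<theta>"
  define d where "d = 1 - cnj a * z"
  have zz: "z * cnj z = 1" by (simp add: z_def cis_cnj cis_mult)
  have d: "d \<noteq> 0" using one_minus_cnj_mult_nonzero[OF assms, of z] by (simp add: d_def z_def)
  have "(disc_aut a has_field_derivative - (1 - cnj a * a) / d\<^sup>2) (at z)"
    unfolding disc_aut_def[abs_def] using d
    by (auto intro!: derivative_eq_intros simp: d_def power2_eq_square field_simps)
  moreover have "(cis has_vector_derivative \<i> * z) (at \<theta> within T)"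
    using has_derivative_cis[OF has_derivative_ident, of \<theta> T] by (simp add: has_vector_derivative_def z_def)
  ultimately have "((disc_aut a \<circ> cis) has_vector_derivative \<i> * z * (- (1 - cnj a * a) / d\<^sup>2)) (at \<theta> within T)"
    by (intro field_vector_diff_chain_within) (auto simp: z_def intro: has_field_derivative_at_within)
  moreover have "\<i> * z * (- (1 - cnj a * a) / d\<^sup>2) = \<i> * of_real (poisson_kernel a \<theta>) * disc_aut a z"
  proof -
    have pk: "of_real (poisson_kernel a \<theta>) = (1 - cnj a * a) / (d * cnj d)"
      unfolding poisson_kernel_def z_def[symmetric] d_def[symmetric]
      by (simp only: of_real_divide of_real_diff of_real_1 complex_norm_square mult.commute[of a "cnj a"])
    have "- z * cnj d = a - z" using zz by (simp add: d_def algebra_simps)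
    then have "disc_aut a z = - z * cnj d / d" by (simp add: disc_aut_def d_def)
    then show ?thesis unfolding pk using d by (simp add: field_simps power2_eq_square)
  qed
  ultimately show ?thesis by (simp add: o_def z_def)
qed

lemma integral_disc_aut_kernel:
  fixes Q :: "complex \<Rightarrow> real"
  assumes a: "norm a < 1" and Q: "continuous_on (sphere 0 1) Q"
  shows "integral {0..2*pi} (\<lambda>\<theta>. Q (disc_aut a (cis \<theta>)) * poisson_kernel a \<theta>) = integral {0..2*pi} (\<lambda>\<theta>. Q (cis \<theta>))"
proof -
  define t0 where "t0 = Arg (disc_aut a (cis 0))"
  \<comment> \<open>\<open>t\<close> integrates the angular speed, starting from the argument of the
    image of 1. Then cis (t \<theta>) solves the same differential equation as the boundary map, and
    their quotient \<open>E\<close> has derivative 0 and initial value 1.\<close>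
  define t where "t = (\<lambda>\<theta>. t0 + integral {0..\<theta>} (poisson_kernel a))"
  have t0: "disc_aut a (cis 0) = cis t0"
    using rcis_cmod_Arg[of "disc_aut a (cis 0)"] disc_aut_in_disc(1)[OF a, of "cis 0"] by (simp add: t0_def rcis_def)
  have dt: "(t has_vector_derivative poisson_kernel a \<theta>) (at \<theta> within {0..2*pi})" if "\<theta> \<in> {0..2*pi}" for \<theta>
    unfolding t_def using integral_has_vector_derivative[OF continuous_on_poisson_kernel[OF a] that]
    by (auto intro!: derivative_eq_intros)
  define E where "E = (\<lambda>\<theta>. cis (- t \<theta>) * disc_aut a (cis \<theta>))"
  have dE: "(E has_vector_derivative 0) (at \<theta> within {0..2*pi})" if "\<theta> \<in> {0..2*pi}" for \<theta>
  proof -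
    have "((\<lambda>\<theta>. - t \<theta>) has_vector_derivative - poisson_kernel a \<theta>) (at \<theta> within {0..2*pi})"
      using dt[OF that] by (auto intro!: derivative_eq_intros)
    then have "((\<lambda>\<theta>. cis (- t \<theta>)) has_vector_derivative (- poisson_kernel a \<theta>) *\<^sub>R (\<i> * cis (- t \<theta>))) (at \<theta> within {0..2*pi})"
      unfolding has_vector_derivative_def by (auto dest!: has_derivative_cis simp: mult.commute)
    from has_vector_derivative_mult[OF this disc_aut_cis_derivative[OF a, of \<theta> "{0..2*pi}"]]
    show ?thesis unfolding E_def by (simp add: scaleR_conv_of_real algebra_simps)
  qed
  obtain k where k: "\<And>\<theta>. \<theta> \<in> {0..2*pi} \<Longrightarrow> E \<theta> = k"
    using has_vector_derivative_zero_constant[of "{0..2*pi}" E] dE by auto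
  have "E 0 = 1" using t0 by (simp add: E_def t_def cis_mult)
  then have E1: "E \<theta> = 1" if "\<theta> \<in> {0..2*pi}" for \<theta> using k[of 0] k[OF that] by simp
  have eq: "disc_aut a (cis \<theta>) = cis (t \<theta>)" if "\<theta> \<in> {0..2*pi}" for \<theta>
  proof -
    have "cis (t \<theta>) * E \<theta> = disc_aut a (cis \<theta>)" by (simp add: E_def cis_mult flip: mult.assoc)
    then show ?thesis using E1[OF that] by simp
  qed
  have t2: "t (2*pi) = t 0 + 2*pi" "t 0 = t0" using integral_poisson_kernel[OF a] by (simp_all add: t_def)
  have mono: "t x \<le> t y" if "0 \<le> x" "x \<le> y" "y \<le> 2*pi" for x y
  proof -
    have i: "poisson_kernel a integrable_on {0..y}" for y
      by (rule integrable_continuous_real[OF continuous_on_poisson_kernel[OF a]])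
    have "integral {0..x} (poisson_kernel a) \<le> integral {0..y} (poisson_kernel a)"
      by (rule integral_subset_le) (use that i poisson_kernel_nonneg[OF a] in auto)
    then show ?thesis by (simp add: t_def)
  qed
  have cq: "continuous_on S (\<lambda>s. Q (cis s))" for S :: "real set"
    by (rule continuous_on_compose2[OF Q]) (auto intro!: continuous_intros)
  have "((\<lambda>\<theta>. poisson_kernel a \<theta> *\<^sub>R Q (cis (t \<theta>))) has_integral
      (integral {t 0..t (2*pi)} (\<lambda>s. Q (cis s)) - integral {t (2*pi)..t 0} (\<lambda>s. Q (cis s)))) {0..2*pi}"
  proof (rule has_integral_substitution_general[where s="{}" and c="t 0" and d="t (2*pi)"])
    show "t ` {0..2*pi} \<subseteq> {t 0..t (2*pi)}" using mono by auto
    show "continuous_on {0..2*pi} t" using dt by (rule continuous_on_vector_derivative)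
    show "(t has_real_derivative poisson_kernel a x) (at x within {0..2*pi})" if "x \<in> {0..2*pi} - {}" for x
      using dt[of x] that by (simp add: has_real_derivative_iff_has_vector_derivative)
  qed (auto intro: cq)
  then have "integral {0..2*pi} (\<lambda>\<theta>. poisson_kernel a \<theta> *\<^sub>R Q (cis (t \<theta>))) = integral {t0..t0 + 2*pi} (\<lambda>s. Q (cis s))"
    using t2 by (simp add: integral_unique)
  also have "\<dots> = integral {0..2*pi} (\<lambda>s. Q (cis s))"
    by (rule integral_periodic_shift) (auto intro: cq simp flip: cis_mult)
  finally show ?thesis
    using integral_cong[of "{0..2*pi}" "\<lambda>\<theta>. Q (disc_aut a (cis \<theta>)) * poisson_kernel a \<theta>" "\<lambda>\<theta>. poisson_kernel a \<theta> *\<^sub>R Q (cis (t \<theta>))"] eq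
    by (auto simp: mult.commute)
qed

lemma continuous_on_disc_aut:
  assumes "norm a < 1"
  shows "continuous_on (cball 0 1) (disc_aut a)"
  unfolding disc_aut_def[abs_def] using one_minus_cnj_mult_nonzero[OF assms]
  by (intro continuous_intros) auto

text \<open>The automorphism is an involution, so the preceding substitution, applied to the
  composed function, moves the kernel to the other side. The mean of the composition is thus a
  Poisson integral.\<close>

lemma integral_disc_aut:
  fixes Q :: "complex \<Rightarrow> real"
  assumes a: "norm a < 1" and Q: "continuous_on (sphere 0 1) Q"
  shows "integral {0..2*pi} (\<lambda>\<theta>. Q (disc_aut a (cis \<theta>))) = integral {0..2*pi} (\<lambda>\<theta>. Q (cis \<theta>) * poisson_kernel a \<theta>)"
proof -
  have "continuous_on (sphere 0 1) (\<lambda>z. Q (disc_aut a z))"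
    by (rule continuous_on_compose2[OF Q])
      (use disc_aut_in_disc(1)[OF a] in \<open>auto intro!: continuous_on_subset[OF continuous_on_disc_aut[OF a]]\<close>)
  from integral_disc_aut_kernel[OF a this] show ?thesis
    using disc_aut_in_disc(3)[OF a] by simp
qed

section \<open>Poisson integrals of powers of holomorphic functions\<close>

lemma open_contains_bigger_ball:
  assumes "open U" "cball 0 1 \<subseteq> U"
  obtains \<rho> where "\<rho> > (1::real)" "ball (0::complex) \<rho> \<subseteq> U"
proof -
  obtain e where e: "e > 0" "(\<Union>x\<in>cball (0::complex) 1. ball x e) \<subseteq> U"
    using compact_subset_open_imp_ball_epsilon_subset[OF compact_cball assms] by blast
  have "ball 0 (1 + e) \<subseteq> (\<Union>x\<in>cball (0::complex) 1. ball x e)"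
  proof
    fix z :: complex assume z: "z \<in> ball 0 (1 + e)"
    show "z \<in> (\<Union>x\<in>cball (0::complex) 1. ball x e)"
    proof (cases "norm z \<le> 1")
      case True then show ?thesis using e by (intro UN_I[of z]) auto
    next
      case False
      then have z0: "z \<noteq> 0" by (metis norm_zero zero_le_one)
      have "z - z / of_real (norm z) = z * of_real (1 - 1 / norm z)" using z0 by (simp add: field_simps)
      then have "norm (z - z / of_real (norm z)) = norm z * \<bar>1 - 1 / norm z\<bar>" by (simp only: norm_mult norm_of_real)
      also have "\<dots> = norm z - 1" using False z0 by (simp add: field_simps abs_if)
      finally have "dist (z / of_real (norm z)) z < e" using z by (simp add: dist_norm norm_minus_commute)
      then show ?thesis using z0 by (intro UN_I[of "z / of_real (norm z)"]) (auto simp: norm_divide)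
    qed
  qed
  then show ?thesis using that[of "1 + e"] e by auto
qed

text \<open>By compactness a disc larger than the closed unit disc is still mapped into the domain
  of \<open>f\<close>. The mean value statements on the unit circle need this room.\<close>

lemma holomorphic_comp_disc_aut:
  assumes f: "f holomorphic_on ball 0 R'" and R: "0 \<le> R" "R < R'" and a: "norm a < 1"
  obtains \<rho> where "\<rho> > 1" "(\<lambda>z. f (of_real R * disc_aut a z)) holomorphic_on ball 0 \<rho>"
    "(\<lambda>z. of_real R * disc_aut a z) holomorphic_on ball 0 \<rho>" "\<And>z. z \<in> ball 0 \<rho> \<Longrightarrow> norm (of_real R * disc_aut a z) < R'"
proof -
  define D where "D = {z. 1 - cnj a * z \<noteq> 0}"
  have oD: "open D" unfolding D_def by (intro open_Collect_neq continuous_intros)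
  have hol: "(\<lambda>z. of_real R * disc_aut a z) holomorphic_on D"
    unfolding disc_aut_def D_def by (intro holomorphic_intros) auto
  define U where "U = D \<inter> (\<lambda>z. of_real R * disc_aut a z) -` ball 0 R'"
  have oU: "open U" unfolding U_def
    by (intro continuous_open_preimage holomorphic_on_imp_continuous_on[OF hol] oD open_ball)
  have "cball 0 1 \<subseteq> U"
  proof
    fix z :: complex assume z: "z \<in> cball 0 1"
    have "norm (disc_aut a z) \<le> 1"
    proof (cases "norm z = 1")
      case False
      then show ?thesis using disc_aut_in_disc(2)[OF a, of z] z by auto
    qed (use disc_aut_in_disc(1)[OF a, of z] in simp)
    then have "R * norm (disc_aut a z) \<le> R * 1" using R by (intro mult_left_mono) auto
    then show "z \<in> U" unfolding U_def D_def using one_minus_cnj_mult_nonzero[OF a, of z] z R by (auto simp: norm_mult)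
  qed
  then obtain \<rho> where r: "\<rho> > 1" "ball 0 \<rho> \<subseteq> U" using open_contains_bigger_ball[OF oU] by blast
  have h1: "(\<lambda>z. of_real R * disc_aut a z) holomorphic_on ball 0 \<rho>"
    by (rule holomorphic_on_subset[OF hol]) (use r U_def in auto)
  have lt: "norm (of_real R * disc_aut a z) < R'" if "z \<in> ball 0 \<rho>" for z
    using r that by (auto simp: U_def)
  have "(f \<circ> (\<lambda>z. of_real R * disc_aut a z)) holomorphic_on ball 0 \<rho>"
    by (rule holomorphic_on_compose_gen[OF h1 f]) (use lt in auto)
  then show ?thesis using that[OF r(1) _ h1 lt] by (simp add: o_def)
qed

lemma disc_aut_zero [simp]: "disc_aut a 0 = a"
  by (simp add: disc_aut_def)

lemma poisson_mean_eq:
  fixes Q :: "complex \<Rightarrow> real"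
  assumes a: "norm a < 1" and Q: "continuous_on (sphere 0 R) Q" and R: "0 \<le> R"
  shows "cmean (\<lambda>z. Q (of_real R * disc_aut a z)) 1 =
     1 / (2*pi) * integral {0..2*pi} (\<lambda>\<theta>. Q (of_real R * cis \<theta>) * poisson_kernel a \<theta>)"
proof -
  have "continuous_on (sphere 0 1) (\<lambda>z. Q (of_real R * z))"
    by (rule continuous_on_compose2[OF Q]) (use R in \<open>auto intro!: continuous_intros simp: norm_mult\<close>)
  from integral_disc_aut[OF a this] show ?thesis by (simp add: cmean_def)
qed

text \<open>The composed function takes the value f (R a) at 0, and means of its p-th power increase
  from the centre outwards.\<close>

lemma poisson_inequality:
  assumes f: "f holomorphic_on ball 0 R'" and R: "0 \<le> R" "R < R'" and a: "norm a < 1" and p: "p > 0"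
  shows "norm (f (of_real R * a)) powr p \<le> cmean (\<lambda>z. norm (f (of_real R * disc_aut a z)) powr p) 1"
proof -
  obtain \<rho> where r: "\<rho> > 1" "(\<lambda>z. f (of_real R * disc_aut a z)) holomorphic_on ball 0 \<rho>"
    using holomorphic_comp_disc_aut[OF f R a] by metis
  from cmean_norm_powr_mono[OF r(2) p, of 0 1] r(1) show ?thesis by simp
qed

lemma poisson_extension:
  assumes f: "f holomorphic_on ball 0 R'" and R: "0 < R" "R < R'"
  obtains G where "G holomorphic_on ball 0 R"
    "\<And>a. norm a < 1 \<Longrightarrow> Re (G (of_real R * a)) = cmean (\<lambda>z. (norm (f (of_real R * disc_aut a z)))\<^sup>2) 1"
    "Re (G 0) = cmean (\<lambda>z. (norm (f z))\<^sup>2) R"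
proof -
  define q where "q = (\<lambda>\<theta>. (norm (f (of_real R * cis \<theta>)))\<^sup>2)"
  have cf: "continuous_on (sphere 0 R) f" using continuous_on_sphere_comp[OF f R(2)] .
  have cq: "continuous_on S q" for S unfolding q_def
    by (intro continuous_intros continuous_on_compose2[OF cf]) (use R in \<open>auto simp: norm_mult\<close>)
  \<comment> \<open>The Herglotz kernel weighted by \<open>q\<close>: it is holomorphic in
    \<open>z\<close>, and its real part is the weighted Poisson kernel. \<open>k'\<close> is its
    derivative in \<open>z\<close>.\<close>
  define k where "k = (\<lambda>z \<theta>. of_real (q \<theta>) * ((cis \<theta> + z / of_real R) / (cis \<theta> - z / of_real R)))"
  define k' where "k' = (\<lambda>z \<theta>. of_real (q \<theta>) * ((1 / of_real R * (cis \<theta> - z / of_real R) + (cis \<theta> + z / of_real R) * (1 / of_real R)) /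
      (cis \<theta> - z / of_real R)\<^sup>2))"
  have nz: "cis \<theta> - z / of_real R \<noteq> 0" if "z \<in> ball 0 R" for z \<theta>
  proof
    assume "cis \<theta> - z / of_real R = 0"
    then have "norm (z / of_real R) = 1" by (metis eq_iff_diff_eq_0 norm_cis)
    then show False using that R by (simp add: norm_divide)
  qed
  define G where "G = (\<lambda>z. of_real (1 / (2*pi)) * integral {0..2*pi} (k z))"
  have ck: "continuous_on {0..2*pi} (k z)" if "z \<in> ball 0 R" for z
    unfolding k_def using nz[OF that] R by (intro continuous_intros cq) auto
  have "(\<lambda>z. integral (cbox 0 (2*pi)) (k z)) holomorphic_on ball 0 R"
  proof (rule leibniz_rule_holomorphic[where fx=k'])
    show "((\<lambda>z. k z \<theta>) has_field_derivative k' z \<theta>) (at z within ball 0 R)" if "z \<in> ball 0 R" for z \<theta>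
      unfolding k_def k'_def using nz[OF that, of \<theta>] R
      by (auto intro!: derivative_eq_intros simp: power2_eq_square distrib_left)
    show "k z integrable_on cbox 0 (2*pi)" if "z \<in> ball 0 R" for z
      using ck[OF that] by (auto intro: integrable_continuous_real)
    show "continuous_on (ball 0 R \<times> cbox 0 (2*pi)) (\<lambda>(z, \<theta>). k' z \<theta>)"
      unfolding k'_def case_prod_beta using nz R
      by (intro continuous_intros continuous_on_compose2[OF cq[of UNIV]]) auto
  qed auto
  then have G: "G holomorphic_on ball 0 R" unfolding G_def by (auto intro!: holomorphic_intros)
  have eq: "Re (G (of_real R * a)) = cmean (\<lambda>z. (norm (f (of_real R * disc_aut a z)))\<^sup>2) 1" if a: "norm a < 1" for a
  proof -
    have "of_real R * a \<in> ball 0 R" using a R by (simp add: norm_mult)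
    note c = integrable_continuous_real[OF ck[OF this]]
    have "Re (G (of_real R * a)) = 1 / (2*pi) * Re (integral {0..2*pi} (k (of_real R * a)))"
      by (simp add: G_def)
    also have "Re (integral {0..2*pi} (k (of_real R * a))) = integral {0..2*pi} (\<lambda>\<theta>. Re (k (of_real R * a) \<theta>))"
      using integral_linear[OF c bounded_linear_Re] by (simp add: o_def)
    also have "(\<lambda>\<theta>. Re (k (of_real R * a) \<theta>)) = (\<lambda>\<theta>. (norm (f (of_real R * cis \<theta>)))\<^sup>2 * poisson_kernel a \<theta>)"
    proof
      fix \<theta>
      have rm: "Re (of_real x * w) = x * Re w" for x w by simp
      have ra: "of_real R * a / of_real R = a" using R by simp
      show "Re (k (of_real R * a) \<theta>) = (norm (f (of_real R * cis \<theta>)))\<^sup>2 * poisson_kernel a \<theta>"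
        by (simp only: k_def rm ra poisson_kernel_Re(2)[OF a] q_def)
    qed
    also have "1 / (2*pi) * integral {0..2*pi} \<dots> = cmean (\<lambda>z. (norm (f (of_real R * disc_aut a z)))\<^sup>2) 1"
      using R by (subst poisson_mean_eq[OF a]) (auto intro!: continuous_intros cf)
    finally show ?thesis .
  qed
  have "Re (G 0) = cmean (\<lambda>z. (norm (f (of_real R * - z)))\<^sup>2) 1" using eq[of 0] by (simp add: disc_aut_def)
  moreover have "cmean (\<lambda>z. (norm (f (of_real R * disc_aut 0 z)))\<^sup>2) 1 =
     1 / (2*pi) * integral {0..2*pi} (\<lambda>\<theta>. (norm (f (of_real R * cis \<theta>)))\<^sup>2 * poisson_kernel 0 \<theta>)"
    using R by (subst poisson_mean_eq) (auto intro!: continuous_intros cf)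
  ultimately have "Re (G 0) = cmean (\<lambda>z. (norm (f z))\<^sup>2) R"
    by (simp add: cmean_def disc_aut_def poisson_kernel_def)
  then show ?thesis using that[OF G eq] by blast
qed

text \<open>A variance identity. The cross term is the mean of Re (cnj (h 0) h), which is |h 0|^2 by
  the mean value property.\<close>

lemma cmean_norm_sq_diff_const:
  assumes h: "h holomorphic_on ball 0 R" and r: "0 \<le> r" "r < R"
  shows "cmean (\<lambda>z. (norm (h z - h 0))\<^sup>2) r = cmean (\<lambda>z. (norm (h z))\<^sup>2) r - (norm (h 0))\<^sup>2"
proof -
  have ch: "continuous_on (sphere 0 r) h" using continuous_on_sphere_comp[OF h r(2)] .
  have eq: "(norm (z - c))\<^sup>2 = (norm z)\<^sup>2 + (-2 * Re (cnj c * z) + (norm c)\<^sup>2)" for z c :: complex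
    unfolding cmod_power2 by (simp add: algebra_simps power2_eq_square)
  have "cmean (\<lambda>z. (norm (h z - h 0))\<^sup>2) r = cmean (\<lambda>z. (norm (h z))\<^sup>2) r + (-2 * cmean (\<lambda>z. Re (cnj (h 0) * h z)) r + (norm (h 0))\<^sup>2)"
  proof -
    have "cmean (\<lambda>z. (norm (h z))\<^sup>2 + (-2 * Re (cnj (h 0) * h z) + (norm (h 0))\<^sup>2)) r =
      cmean (\<lambda>z. (norm (h z))\<^sup>2) r + cmean (\<lambda>z. -2 * Re (cnj (h 0) * h z) + (norm (h 0))\<^sup>2) r"
      by (intro cmean_add continuous_intros ch r)
    also have "cmean (\<lambda>z. -2 * Re (cnj (h 0) * h z) + (norm (h 0))\<^sup>2) r =
      cmean (\<lambda>z. -2 * Re (cnj (h 0) * h z)) r + cmean (\<lambda>z. (norm (h 0))\<^sup>2) r"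
      by (intro cmean_add continuous_intros ch r)
    finally show ?thesis unfolding eq by (simp only: cmean_cmult cmean_const)
  qed
  also have "cmean (\<lambda>z. Re (cnj (h 0) * h z)) r = Re (cnj (h 0) * h 0)"
    by (rule cmean_Re_holomorphic[OF _ r]) (intro holomorphic_intros h)
  also have "Re (cnj (h 0) * h 0) = (norm (h 0))\<^sup>2" unfolding cmod_power2 by (simp add: power2_eq_square)
  finally show ?thesis by simp
qed

text \<open>\<open>B\<close> bounds the square of the BMOA seminorm, circle by circle.\<close>

definition bmoa_bound :: "(complex \<Rightarrow> complex) \<Rightarrow> real \<Rightarrow> bool" where
  "bmoa_bound g B \<longleftrightarrow> (\<forall>a\<in>ball 0 1. \<forall>r\<in>{0..<1}. cmean (\<lambda>z. (norm (g (disc_aut a z) - g a))\<^sup>2) r \<le> B)"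

text \<open>\<open>Re G\<close> is the Poisson integral of \<open>|g|\<^sup>2\<close> over the circle of radius \<open>R\<close>; the upper bound is
  Littlewood's subordination principle, as \<open>z \<mapsto> R \<sigma>\<^sub>a z\<close> factors through \<open>\<sigma>\<^sub>b\<close> with \<open>b = R a\<close>.\<close>
lemma bmoa_potential:
  assumes g: "g holomorphic_on ball 0 1" and B: "bmoa_bound g B" and R: "0 < R" "R < 1"
  obtains G where "G holomorphic_on ball 0 R"
    "\<And>z. z \<in> ball 0 R \<Longrightarrow> 0 \<le> Re (G z) - (norm (g z))\<^sup>2 \<and> Re (G z) - (norm (g z))\<^sup>2 \<le> B"
proof -
  obtain G where G: "G holomorphic_on ball 0 R"
    "\<And>a. norm a < 1 \<Longrightarrow> Re (G (of_real R * a)) = cmean (\<lambda>z. (norm (g (of_real R * disc_aut a z)))\<^sup>2) 1"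
    using poisson_extension[OF g R] by metis
  have "0 \<le> Re (G b) - (norm (g b))\<^sup>2 \<and> Re (G b) - (norm (g b))\<^sup>2 \<le> B" if b: "b \<in> ball 0 R" for b
  proof -
    define a where "a = b / of_real R"
    have a: "norm a < 1" and Ra: "of_real R * a = b" using b R by (auto simp: a_def norm_divide)
    have b1: "norm b < 1" using b R by simp
    obtain \<rho> where r: "\<rho> > 1" and k: "(\<lambda>z. g (of_real R * disc_aut a z)) holomorphic_on ball 0 \<rho>"
      and \<sigma>: "(\<lambda>z. of_real R * disc_aut a z) holomorphic_on ball 0 \<rho>"
      and lt: "\<And>z. z \<in> ball 0 \<rho> \<Longrightarrow> norm (of_real R * disc_aut a z) < 1"
      using holomorphic_comp_disc_aut[OF g _ R(2) a] R by (metis less_imp_le)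
    \<comment> \<open>By the variance identity the potential at \<open>b\<close> is a mean of
      squares, hence nonnegative. Only the upper bound remains.\<close>
    have eq: "Re (G b) - (norm (g b))\<^sup>2 = cmean (\<lambda>z. (norm (g (of_real R * disc_aut a z) - g b))\<^sup>2) 1"
      using cmean_norm_sq_diff_const[OF k, of 1] r G(2)[OF a] by (simp add: Ra)
    \<comment> \<open>\<open>\<kappa>\<close> is the function controlled by the BMOA bound. As
      \<open>disc_aut b\<close> is an involution, \<kappa> after \<omega> is the function averaged
      in \<open>eq\<close>, and \<omega> fixes 0.\<close>
    define \<kappa> where "\<kappa> = (\<lambda>z. g (disc_aut b z) - g b)"
    define \<omega> where "\<omega> = (\<lambda>z. disc_aut b (of_real R * disc_aut a z))"
    have \<kappa>: "\<kappa> holomorphic_on ball 0 1"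
    proof -
      have "disc_aut b holomorphic_on ball 0 1"
        unfolding disc_aut_def[abs_def] using one_minus_cnj_mult_nonzero[OF b1]
        by (intro holomorphic_intros) auto
      moreover have "disc_aut b ` ball 0 1 \<subseteq> ball 0 1" using disc_aut_in_disc(2)[OF b1] by auto
      ultimately have "(\<lambda>z. g (disc_aut b z)) holomorphic_on ball 0 1"
        using holomorphic_on_compose_gen[OF _ g] by (auto simp: o_def)
      then show ?thesis unfolding \<kappa>_def by (intro holomorphic_intros)
    qed
    have \<omega>: "\<omega> holomorphic_on ball 0 \<rho>"
    proof -
      have "disc_aut b holomorphic_on ball 0 1"
        unfolding disc_aut_def[abs_def] using one_minus_cnj_mult_nonzero[OF b1]
        by (intro holomorphic_intros) auto
      moreover have "(\<lambda>z. of_real R * disc_aut a z) ` ball 0 \<rho> \<subseteq> ball 0 1" using lt by auto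
      ultimately show ?thesis unfolding \<omega>_def using holomorphic_on_compose_gen[OF \<sigma>] by (auto simp: o_def)
    qed
    have \<omega>lt: "norm (\<omega> z) < 1" if "z \<in> ball 0 \<rho>" for z
      unfolding \<omega>_def using disc_aut_in_disc(2)[OF b1 lt[OF that]] .
    have \<kappa>\<omega>: "\<kappa> (\<omega> z) = g (of_real R * disc_aut a z) - g b" if "z \<in> ball 0 \<rho>" for z
      using disc_aut_in_disc(3)[OF b1, of "of_real R * disc_aut a z"] lt[OF that] by (simp add: \<kappa>_def \<omega>_def)
    have \<omega>0: "\<omega> 0 = 0" by (simp add: \<omega>_def Ra) (simp add: disc_aut_def)
    have cw: "continuous_on (cball 0 1) \<omega>"
      by (rule continuous_on_subset[OF holomorphic_on_imp_continuous_on[OF \<omega>]]) (use r in auto)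
    \<comment> \<open>By compactness \<omega> maps the closed disc into one of radius
      \<open>R2\<close> < 1, on which |\<kappa>|^2 has a harmonic majorant Re H. Composed with
      \<omega> the majorant stays harmonic, and its mean is Re (H 0), the mean of |\<kappa>|^2 over
      the circle of radius \<open>R2\<close>.\<close>
    obtain x where x: "x \<in> cball 0 1" "\<And>z. z \<in> cball 0 1 \<Longrightarrow> norm (\<omega> z) \<le> norm (\<omega> x)"
      using continuous_attains_sup[OF compact_cball _ continuous_on_norm[OF cw]] by (metis cball_eq_empty not_less zero_le_one)
    have "norm (\<omega> x) < 1" using \<omega>lt[of x] x(1) r by auto
    then obtain R2 where R2: "norm (\<omega> x) < R2" "R2 < 1" using dense by blast
    have R20: "R2 > 0" using R2 by (meson le_less_trans norm_ge_zero)
    obtain H where H: "H holomorphic_on ball 0 R2"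
       "\<And>a. norm a < 1 \<Longrightarrow> Re (H (of_real R2 * a)) = cmean (\<lambda>z. (norm (\<kappa> (of_real R2 * disc_aut a z)))\<^sup>2) 1"
       "Re (H 0) = cmean (\<lambda>z. (norm (\<kappa> z))\<^sup>2) R2"
      using poisson_extension[OF \<kappa> R20 R2(2)] by metis
    have maj: "(norm (\<kappa> z))\<^sup>2 \<le> Re (H z)" if "norm z < R2" for z
    proof -
      have "norm (z / of_real R2) < 1" using that R20 by (simp add: norm_divide)
      from poisson_inequality[OF \<kappa> _ R2(2) this, of 2] H(2)[OF this] R20 show ?thesis by simp
    qed
    obtain \<rho>2 where r2: "\<rho>2 > 1" "ball 0 \<rho>2 \<subseteq> ball 0 \<rho> \<inter> \<omega> -` ball 0 R2"
    proof (rule open_contains_bigger_ball)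
      show "open (ball 0 \<rho> \<inter> \<omega> -` ball 0 R2)"
        by (intro continuous_open_preimage holomorphic_on_imp_continuous_on[OF \<omega>]) auto
      show "cball 0 1 \<subseteq> ball 0 \<rho> \<inter> \<omega> -` ball 0 R2" using r x(2) R2 by force
    qed
    have "(H \<circ> \<omega>) holomorphic_on ball 0 \<rho>2"
      by (rule holomorphic_on_compose_gen[OF holomorphic_on_subset[OF \<omega>] H(1)]) (use r2 in auto)
    then have H\<omega>: "(\<lambda>z. H (\<omega> z)) holomorphic_on ball 0 \<rho>2" by (simp add: o_def)
    have "cmean (\<lambda>z. (norm (g (of_real R * disc_aut a z) - g b))\<^sup>2) 1 \<le> cmean (\<lambda>z. Re (H (\<omega> z))) 1"
    proof (rule cmean_mono)
      show "continuous_on (sphere 0 1) (\<lambda>z. (norm (g (of_real R * disc_aut a z) - g b))\<^sup>2)"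
        using continuous_on_sphere_comp[OF k, of 1] r by (intro continuous_intros)
      show "continuous_on (sphere 0 1) (\<lambda>z. Re (H (\<omega> z)))"
        using continuous_on_sphere_comp[OF H\<omega>, of 1] r2 by (intro continuous_intros)
      fix z :: complex assume z: "norm z = 1"
      then have "z \<in> ball 0 \<rho>" "norm (\<omega> z) < R2" using r x(2)[of z] R2 by auto
      then show "(norm (g (of_real R * disc_aut a z) - g b))\<^sup>2 \<le> Re (H (\<omega> z))" using maj \<kappa>\<omega> by metis
    qed simp
    also have "\<dots> = Re (H 0)" using cmean_Re_holomorphic[OF H\<omega>, of 1] r2 by (simp add: \<omega>0)
    also have "\<dots> \<le> B" unfolding H(3) using B b1 R2 R20 unfolding bmoa_bound_def \<kappa>_def by simp
    finally show ?thesis unfolding eq by (auto intro!: cmean_nonneg)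
  qed
  then show ?thesis using that[OF G(1)] by blast
qed

lemma BMOA_imp_bmoa_bound:
  assumes "g \<in> BMOA"
  obtains B where "g holomorphic_on ball 0 1" "bmoa_bound g B"
proof -
  have "bdd_above {hardy_mean 2 (\<lambda>z. g (disc_aut a z) - g a) r | a r. a \<in> ball 0 1 \<and> 0 \<le> r \<and> r < 1}"
    using assms by (simp add: BMOA_def)
  then obtain B where "\<And>a r. a \<in> ball 0 1 \<Longrightarrow> 0 \<le> r \<Longrightarrow> r < 1 \<Longrightarrow> hardy_mean 2 (\<lambda>z. g (disc_aut a z) - g a) r \<le> B"
    unfolding bdd_above_def by blast
  then have "bmoa_bound g B" unfolding bmoa_bound_def hardy_mean_eq_cmean by auto
  then show ?thesis using that assms by (auto simp: BMOA_def)
qed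

subsection \<open>Uniform integrability\<close>

text \<open>The Poisson integral of \<open>v\<close> at the point t cis \<theta>. If
  \<open>v\<close> holds the values on a circle of radius R, it yields values on the circle of
  radius R t, so two inner circles are compared.\<close>

definition pint :: "real \<Rightarrow> (real \<Rightarrow> real) \<Rightarrow> real \<Rightarrow> real" where
  "pint t v \<theta> = 1 / (2*pi) * integral {0..2*pi} (\<lambda>\<phi>. v \<phi> * poisson_kernel (of_real t * cis \<theta>) \<phi>)"

text \<open>Conjugating the denominator interchanges the angles, which makes the Poisson integral a
  symmetric operator on L^2.\<close>

lemma poisson_kernel_sym: "poisson_kernel (of_real t * cis \<theta>) \<phi> = poisson_kernel (of_real t * cis \<phi>) \<theta>"
proof -
  have "cnj (1 - cnj (of_real t * cis \<theta>) * cis \<phi>) = 1 - cnj (of_real t * cis \<phi>) * cis \<theta>"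
    by (simp add: mult_ac)
  then have "norm (1 - cnj (of_real t * cis \<theta>) * cis \<phi>) = norm (1 - cnj (of_real t * cis \<phi>) * cis \<theta>)"
    by (metis complex_mod_cnj)
  then show ?thesis by (simp only: poisson_kernel_def norm_mult norm_cis)
qed

context
  fixes t :: real
  assumes t: "0 \<le> t" "t < 1"
begin

lemma norm_t: "norm (of_real t * cis \<theta>) < 1" using t by (simp add: norm_mult)

lemma continuous_on_poisson_kernel2:
  "continuous_on S (\<lambda>x. poisson_kernel (of_real t * cis (fst x)) (snd x))"
  unfolding poisson_kernel_def using one_minus_cnj_mult_nonzero[OF norm_t, of "cis _"]
  by (intro continuous_intros) auto

lemma continuous_on_pint_integrand:
  assumes "continuous_on {0..2*pi} v"
  shows "continuous_on {0..2*pi} (\<lambda>\<phi>. v \<phi> * poisson_kernel (of_real t * cis \<theta>) \<phi>)"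
  by (intro continuous_intros assms continuous_on_poisson_kernel norm_t)

lemma continuous_on_pint:
  assumes "continuous_on {0..2*pi} v"
  shows "continuous_on {0..2*pi} (pint t v)"
proof -
  have "continuous_on {0..2*pi} (\<lambda>\<theta>. integral (cbox 0 (2*pi)) (\<lambda>\<phi>. v \<phi> * poisson_kernel (of_real t * cis \<theta>) \<phi>))"
    by (rule integral_continuous_on_param, unfold case_prod_beta)
      (intro continuous_on_mult continuous_on_poisson_kernel2 continuous_on_compose2[OF assms], auto intro: continuous_intros)
  then show ?thesis unfolding pint_def[abs_def] by (intro continuous_intros) simp
qed

lemma pint_const: "pint t (\<lambda>_. c) \<theta> = c"
  using integral_poisson_kernel[OF norm_t] by (simp add: pint_def)

lemma pint_mono:
  assumes "continuous_on {0..2*pi} u" "continuous_on {0..2*pi} v" "\<And>\<phi>. \<phi> \<in> {0..2*pi} \<Longrightarrow> u \<phi> \<le> v \<phi>"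
  shows "pint t u \<theta> \<le> pint t v \<theta>"
  unfolding pint_def
  by (intro mult_left_mono integral_le integrable_continuous_real continuous_on_pint_integrand mult_right_mono assms
      poisson_kernel_nonneg norm_t) auto

lemma pint_adjoint:
  assumes "continuous_on {0..2*pi} u" "continuous_on {0..2*pi} v"
  shows "integral {0..2*pi} (\<lambda>\<theta>. v \<theta> * pint t u \<theta>) = integral {0..2*pi} (\<lambda>\<theta>. u \<theta> * pint t v \<theta>)"
proof -
  let ?k = "\<lambda>\<theta> \<phi>. poisson_kernel (of_real t * cis \<theta>) \<phi>"
  have c: "continuous_on (cbox (0,0) (2*pi,2*pi)) (\<lambda>(\<theta>,\<phi>). v \<theta> * (u \<phi> * ?k \<theta> \<phi>))"
    unfolding case_prod_beta
    by (intro continuous_on_mult continuous_on_poisson_kernel2 continuous_on_compose2[OF assms(1)] continuous_on_compose2[OF assms(2)])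
      (auto intro: continuous_intros)
  have "integral {0..2*pi} (\<lambda>\<theta>. v \<theta> * pint t u \<theta>) =
     1 / (2*pi) * integral (cbox 0 (2*pi)) (\<lambda>\<theta>. integral (cbox 0 (2*pi)) (\<lambda>\<phi>. v \<theta> * (u \<phi> * ?k \<theta> \<phi>)))"
    by (simp add: pint_def algebra_simps flip: integral_mult_right)
  also have "\<dots> = 1 / (2*pi) * integral (cbox 0 (2*pi)) (\<lambda>\<phi>. integral (cbox 0 (2*pi)) (\<lambda>\<theta>. v \<theta> * (u \<phi> * ?k \<theta> \<phi>)))"
    by (subst integral_swap_continuous[OF c]) simp
  also have "\<dots> = 1 / (2*pi) * integral (cbox 0 (2*pi)) (\<lambda>\<phi>. integral (cbox 0 (2*pi)) (\<lambda>\<theta>. u \<phi> * (v \<theta> * ?k \<phi> \<theta>)))"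
  proof -
    have "v \<theta> * (u \<phi> * ?k \<theta> \<phi>) = u \<phi> * (v \<theta> * ?k \<phi> \<theta>)" for \<theta> \<phi>
      by (subst poisson_kernel_sym) (simp add: mult_ac)
    then show ?thesis by (simp only:)
  qed
  also have "\<dots> = integral {0..2*pi} (\<lambda>\<theta>. u \<theta> * pint t v \<theta>)"
    by (simp add: pint_def algebra_simps flip: integral_mult_right)
  finally show ?thesis .
qed

text \<open>Jensen's inequality for the probability measure given by the kernel, obtained from the
  integral of (u - y)^2 with \<open>y\<close> the average of \<open>u\<close>.\<close>

lemma pint_square_le:
  assumes u: "continuous_on {0..2*pi} u"
  shows "(pint t u \<theta>)\<^sup>2 \<le> pint t (\<lambda>\<phi>. (u \<phi>)\<^sup>2) \<theta>"
proof -
  define y where "y = pint t u \<theta>"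
  let ?k = "\<lambda>\<phi>. poisson_kernel (of_real t * cis \<theta>) \<phi>"
  have i: "(\<lambda>\<phi>. v \<phi> * ?k \<phi>) integrable_on {0..2*pi}" if "continuous_on {0..2*pi} v" for v
    by (rule integrable_continuous_real[OF continuous_on_pint_integrand[OF that]])
  have "0 \<le> pint t (\<lambda>\<phi>. (u \<phi> - y)\<^sup>2) \<theta>"
    unfolding pint_def by (intro mult_nonneg_nonneg integral_nonneg i continuous_intros u poisson_kernel_nonneg norm_t) auto
  also have "pint t (\<lambda>\<phi>. (u \<phi> - y)\<^sup>2) \<theta> = 1/(2*pi) * integral {0..2*pi} (\<lambda>\<phi>. (u \<phi>)\<^sup>2 * ?k \<phi> + ((-2*y) * (u \<phi> * ?k \<phi>) + y\<^sup>2 * ?k \<phi>))"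
    unfolding pint_def by (simp add: power2_eq_square algebra_simps)
  also have "\<dots> = 1/(2*pi) * (integral {0..2*pi} (\<lambda>\<phi>. (u \<phi>)\<^sup>2 * ?k \<phi>) + ((-2*y) * integral {0..2*pi} (\<lambda>\<phi>. u \<phi> * ?k \<phi>) + y\<^sup>2 * (2*pi)))"
    using i[of "\<lambda>_. 1"]
    by (subst integral_add integral_mult_right; (intro integrable_add integrable_on_mult_right i continuous_intros u)?)+
       (simp_all add: integral_poisson_kernel[OF norm_t])
  also have "\<dots> = pint t (\<lambda>\<phi>. (u \<phi>)\<^sup>2) \<theta> + ((-2*y) * pint t u \<theta> + y\<^sup>2)"
    unfolding pint_def by (simp add: field_simps)
  finally show ?thesis by (simp add: y_def[symmetric] power2_eq_square)
qed

text \<open>The Poisson integral is a symmetric contraction of \<open>L\<^sup>2\<close>, so the distance from \<open>v\<close> to \<open>P u\<close>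
  is controlled by the increase of the norm.\<close>
lemma pint_L2_gap:
  assumes u: "continuous_on {0..2*pi} u" and v: "continuous_on {0..2*pi} v"
    and le: "\<And>\<theta>. \<theta> \<in> {0..2*pi} \<Longrightarrow> (u \<theta>)\<^sup>2 \<le> u \<theta> * pint t v \<theta>"
  shows "integral {0..2*pi} (\<lambda>\<theta>. (v \<theta> - pint t u \<theta>)\<^sup>2) \<le> integral {0..2*pi} (\<lambda>\<theta>. (v \<theta>)\<^sup>2) - integral {0..2*pi} (\<lambda>\<theta>. (u \<theta>)\<^sup>2)"
proof -
  note cp = continuous_on_pint[OF u] continuous_on_pint[OF v]
  have i: "w integrable_on {0..2*pi}" if "continuous_on {0..2*pi} w" for w :: "real \<Rightarrow> real"
    using that by (rule integrable_continuous_real)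
  \<comment> \<open>Writing P for the Poisson integral, symmetry gives that the inner product of v
    and P u is at least the squared norm of u. Contraction bounds P u by u in norm. Both enter the
    expanded square of v - P u.\<close>
  have 1: "integral {0..2*pi} (\<lambda>\<theta>. (u \<theta>)\<^sup>2) \<le> integral {0..2*pi} (\<lambda>\<theta>. v \<theta> * pint t u \<theta>)"
    unfolding pint_adjoint[OF u v] by (intro integral_le i continuous_intros u cp le)
  have "integral {0..2*pi} (\<lambda>\<theta>. (pint t u \<theta>)\<^sup>2) \<le> integral {0..2*pi} (\<lambda>\<theta>. 1 * pint t (\<lambda>\<phi>. (u \<phi>)\<^sup>2) \<theta>)"
    by (intro integral_le i continuous_intros cp continuous_on_pint u) (simp add: pint_square_le[OF u])
  also have "\<dots> = integral {0..2*pi} (\<lambda>\<theta>. (u \<theta>)\<^sup>2 * pint t (\<lambda>\<phi>. 1) \<theta>)"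
    by (rule pint_adjoint) (intro continuous_intros u)+
  finally have 2: "integral {0..2*pi} (\<lambda>\<theta>. (pint t u \<theta>)\<^sup>2) \<le> integral {0..2*pi} (\<lambda>\<theta>. (u \<theta>)\<^sup>2)"
    by (simp add: pint_const)
  have "integral {0..2*pi} (\<lambda>\<theta>. (v \<theta> - pint t u \<theta>)\<^sup>2) =
     integral {0..2*pi} (\<lambda>\<theta>. (v \<theta>)\<^sup>2 + ((-2) * (v \<theta> * pint t u \<theta>) + (pint t u \<theta>)\<^sup>2))"
    by (simp add: power2_eq_square algebra_simps)
  also have "\<dots> = integral {0..2*pi} (\<lambda>\<theta>. (v \<theta>)\<^sup>2) + ((-2) * integral {0..2*pi} (\<lambda>\<theta>. v \<theta> * pint t u \<theta>) + integral {0..2*pi} (\<lambda>\<theta>. (pint t u \<theta>)\<^sup>2))"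
    by (subst integral_add integral_mult_right; (intro integrable_add integrable_on_mult_right i continuous_intros u v cp)?)+ simp
  finally show ?thesis using 1 2 by linarith
qed

end

lemma cmean_disc_aut_pint:
  fixes Q :: "complex \<Rightarrow> real"
  assumes "continuous_on (sphere 0 R) Q" "0 \<le> R" "0 \<le> t" "t < 1"
  shows "cmean (\<lambda>z. Q (of_real R * disc_aut (of_real t * cis \<theta>) z)) 1 = pint t (\<lambda>\<phi>. Q (of_real R * cis \<phi>)) \<theta>"
  using poisson_mean_eq[of "of_real t * cis \<theta>" R Q] assms by (simp add: pint_def norm_mult)

text \<open>No boundary values are needed: on a circle of radius \<open>R > r\<close> the function \<open>|f| powr (p/2)\<close>
  is \<open>L\<^sup>2\<close>-close to the Poisson integral of its values on the circle of radius \<open>r\<close>, which is bounded.\<close>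
lemma hardy_uniformly_integrable:
  assumes f: "f holomorphic_on ball 0 1" and p: "p > 0" and bd: "bdd_above (cmean (\<lambda>z. norm (f z) powr p) ` {0..<1})"
    and \<eta>: "\<eta> > 0"
  obtains C where "C \<ge> 0" "\<And>R \<psi>. 0 \<le> R \<Longrightarrow> R < 1 \<Longrightarrow> continuous_on (sphere 0 R) \<psi> \<Longrightarrow>
     (\<And>z. norm z = R \<Longrightarrow> 0 \<le> \<psi> z \<and> \<psi> z \<le> 1) \<Longrightarrow>
     cmean (\<lambda>z. \<psi> z * norm (f z) powr p) R \<le> C * cmean \<psi> R + \<eta>"
proof -
  define m where "m = cmean (\<lambda>z. norm (f z) powr p)"
  define S where "S = (SUP r\<in>{0..<1}. m r)"
  have mS: "m r \<le> S" if "0 \<le> r" "r < 1" for r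
    unfolding S_def using bd that by (intro cSUP_upper) (auto simp: m_def)
  \<comment> \<open>The means increase towards \<open>S\<close>, so beyond this radius they gain
    less than \<eta>/2. The final estimate doubles this gain.\<close>
  obtain r where r: "0 \<le> r" "r < 1" "S - \<eta>/2 < m r"
  proof -
    have "\<exists>x\<in>m ` {0..<1}. S - \<eta>/2 < x"
      unfolding S_def using \<eta> bd by (intro less_cSupD) (auto simp: m_def)
    then show ?thesis using that by auto
  qed
  have cf: "continuous_on (cball 0 r) f"
    by (rule continuous_on_subset[OF holomorphic_on_imp_continuous_on[OF f]]) (use r in auto)
  obtain x where x: "x \<in> cball 0 r" "\<And>z. z \<in> cball 0 r \<Longrightarrow> norm (f z) \<le> norm (f x)"
    using continuous_attains_sup[OF compact_cball _ continuous_on_norm[OF cf]] r(1) by (metis cball_eq_empty not_less)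
  define l where "l = norm (f x) powr (p/2)"
  have l0: "l \<ge> 0" by (simp add: l_def)
  have wl: "norm (f z) powr (p/2) \<le> l" if "norm z \<le> r" for z
    unfolding l_def using x(2)[of z] that p by (intro powr_mono2) auto
  have sq: "(norm (f z) powr (p/2))\<^sup>2 = norm (f z) powr p" for z
    by (simp add: power2_eq_square flip: powr_add)
  have main: "cmean (\<lambda>z. \<psi> z * norm (f z) powr p) R \<le> (2 * l\<^sup>2) * cmean \<psi> R + \<eta>"
    if R: "0 \<le> R" "R < 1" and c\<psi>: "continuous_on (sphere 0 R) \<psi>" and \<psi>: "\<And>z. norm z = R \<Longrightarrow> 0 \<le> \<psi> z \<and> \<psi> z \<le> 1" for R \<psi>
  proof -
    have cR: "continuous_on (sphere 0 R) f" using continuous_on_sphere_comp[OF f R(2)] .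
    have cR': "continuous_on (sphere 0 R) (\<lambda>z. norm (f z) powr b)" if "b > 0" for b
      by (rule continuous_on_norm_powr[OF cR that])
    show ?thesis
    proof (cases "R \<le> r")
      case True
      have "cmean (\<lambda>z. \<psi> z * norm (f z) powr p) R \<le> cmean (\<lambda>z. (2 * l\<^sup>2) * \<psi> z) R"
      proof (intro cmean_mono R)
        fix z :: complex assume z: "norm z = R"
        have "norm (f z) powr p \<le> l\<^sup>2" unfolding sq[symmetric] using wl[of z] z True by (intro power_mono) auto
        then have "\<psi> z * norm (f z) powr p \<le> \<psi> z * (2 * l\<^sup>2)" using \<psi>[OF z] l0 by (intro mult_left_mono) (auto intro: order_trans)
        then show "\<psi> z * norm (f z) powr p \<le> (2 * l\<^sup>2) * \<psi> z" by (simp add: mult.commute)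
      qed (intro continuous_intros c\<psi> cR' p)+
      then show ?thesis using \<eta> by (simp add: cmean_cmult)
    next
      case False
      \<comment> \<open>The Poisson integral with this \<open>t\<close> leads from the circle of
        radius \<open>R\<close> to that of radius \<open>r\<close>, so \<open>u\<close> is at most
        the Poisson integral of \<open>v\<close>. Applied to \<open>u\<close> it gives the
        approximation to \<open>v\<close>, bounded by \<open>l\<close>.\<close>
      define t where "t = r / R"
      have t: "0 \<le> t" "t < 1" "R * t = r" using False r by (auto simp: t_def)
      define u where "u = (\<lambda>\<theta>. norm (f (of_real r * cis \<theta>)) powr (p/2))"
      define v where "v = (\<lambda>\<theta>. norm (f (of_real R * cis \<theta>)) powr (p/2))"
      have cu: "continuous_on {0..2*pi} u" unfolding u_def
        by (rule cmean_integrable(2)[where W="\<lambda>z. norm (f z) powr (p/2)"])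
          (use r p in \<open>auto intro!: continuous_on_norm_powr continuous_on_subset[OF cf]\<close>)
      have cv: "continuous_on {0..2*pi} v" unfolding v_def
        by (rule cmean_integrable(2)[where W="\<lambda>z. norm (f z) powr (p/2)"]) (use R p in \<open>auto intro!: cR'\<close>)
      have uv: "u \<theta> \<le> pint t v \<theta>" for \<theta>
      proof -
        have "norm (of_real t * cis \<theta>) < 1" using t by (simp add: norm_mult)
        from poisson_inequality[OF f R this, of "p/2"]
        have "norm (f (of_real (R * t) * cis \<theta>)) powr (p/2) \<le>
            cmean (\<lambda>z. norm (f (of_real R * disc_aut (of_real t * cis \<theta>) z)) powr (p/2)) 1" using p by (simp add: mult.assoc)
        also have "\<dots> = pint t v \<theta>"
          unfolding v_def using p by (intro cmean_disc_aut_pint[where Q="\<lambda>z. norm (f z) powr (p/2)"] cR' R t) auto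
        finally show ?thesis by (simp add: u_def t(3))
      qed
      have gap: "integral {0..2*pi} (\<lambda>\<theta>. (v \<theta> - pint t u \<theta>)\<^sup>2) \<le> integral {0..2*pi} (\<lambda>\<theta>. (v \<theta>)\<^sup>2) - integral {0..2*pi} (\<lambda>\<theta>. (u \<theta>)\<^sup>2)"
        by (rule pint_L2_gap[OF t(1,2) cu cv])
          (auto simp: power2_eq_square u_def intro!: mult_left_mono uv[unfolded u_def])
      have "integral {0..2*pi} (\<lambda>\<theta>. (v \<theta>)\<^sup>2) = 2*pi * m R" "integral {0..2*pi} (\<lambda>\<theta>. (u \<theta>)\<^sup>2) = 2*pi * m r"
        by (simp_all add: v_def u_def sq m_def cmean_def)
      with gap have gap': "integral {0..2*pi} (\<lambda>\<theta>. (v \<theta> - pint t u \<theta>)\<^sup>2) \<le> 2*pi * (m R - m r)" by (simp add: algebra_simps)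
      have yl: "0 \<le> pint t u \<theta>" "pint t u \<theta> \<le> l" for \<theta>
      proof -
        have "pint t (\<lambda>_. 0) \<theta> \<le> pint t u \<theta>" by (rule pint_mono[OF t(1,2) _ cu]) (auto simp: u_def)
        then show "0 \<le> pint t u \<theta>" by (simp add: pint_const[OF t(1,2)])
        have "pint t u \<theta> \<le> pint t (\<lambda>_. l) \<theta>"
          by (rule pint_mono[OF t(1,2) cu]) (use r in \<open>auto simp: u_def norm_mult intro!: wl\<close>)
        then show "pint t u \<theta> \<le> l" by (simp add: pint_const[OF t(1,2)])
      qed
      have c\<psi>': "continuous_on {0..2*pi} (\<lambda>\<theta>. \<psi> (of_real R * cis \<theta>))" by (rule cmean_integrable(2)[OF c\<psi> R(1)])
      have cp: "continuous_on {0..2*pi} (pint t u)" by (rule continuous_on_pint[OF t(1,2) cu])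
      have "integral {0..2*pi} (\<lambda>\<theta>. \<psi> (of_real R * cis \<theta>) * (v \<theta>)\<^sup>2) \<le>
         integral {0..2*pi} (\<lambda>\<theta>. 2 * l\<^sup>2 * \<psi> (of_real R * cis \<theta>) + 2 * (v \<theta> - pint t u \<theta>)\<^sup>2)"
      proof (intro integral_le integrable_continuous_real continuous_intros cv cp c\<psi>')
        fix \<theta>
        define y where "y = pint t u \<theta>"
        define \<psi>' where "\<psi>' = \<psi> (of_real R * cis \<theta>)"
        have p': "0 \<le> \<psi>'" "\<psi>' \<le> 1" using \<psi>[of "of_real R * cis \<theta>"] R by (auto simp: \<psi>'_def norm_mult)
        \<comment> \<open>The difference of the two sides is (v - 2 y)^2.\<close>
        have "(v \<theta>)\<^sup>2 \<le> 2 * y\<^sup>2 + 2 * (v \<theta> - y)\<^sup>2"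
          using zero_le_power2[of "v \<theta> - 2 * y"] by (simp add: power2_eq_square algebra_simps)
        also have "y\<^sup>2 \<le> l\<^sup>2" using yl[of \<theta>] by (intro power_mono) (auto simp: y_def)
        finally have "\<psi>' * (v \<theta>)\<^sup>2 \<le> \<psi>' * (2 * l\<^sup>2 + 2 * (v \<theta> - y)\<^sup>2)" using p' by (intro mult_left_mono) auto
        also have "\<dots> \<le> 2 * l\<^sup>2 * \<psi>' + 1 * (2 * (v \<theta> - y)\<^sup>2)"
          unfolding distrib_left using p' by (intro add_mono mult_right_mono) (auto simp: mult_ac)
        finally show "\<psi> (of_real R * cis \<theta>) * (v \<theta>)\<^sup>2 \<le> 2 * l\<^sup>2 * \<psi> (of_real R * cis \<theta>) + 2 * (v \<theta> - pint t u \<theta>)\<^sup>2"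
          by (simp add: y_def \<psi>'_def)
      qed
      also have "\<dots> = 2 * l\<^sup>2 * integral {0..2*pi} (\<lambda>\<theta>. \<psi> (of_real R * cis \<theta>)) + 2 * integral {0..2*pi} (\<lambda>\<theta>. (v \<theta> - pint t u \<theta>)\<^sup>2)"
        by (subst integral_add; (intro integrable_continuous_real continuous_intros cv cp c\<psi>')?) simp
      also have "\<dots> \<le> 2 * l\<^sup>2 * integral {0..2*pi} (\<lambda>\<theta>. \<psi> (of_real R * cis \<theta>)) + 2 * (2*pi * (m R - m r))"
        using gap' by simp
      finally have "1/(2*pi) * integral {0..2*pi} (\<lambda>\<theta>. \<psi> (of_real R * cis \<theta>) * (v \<theta>)\<^sup>2) \<le>
         1/(2*pi) * (2 * l\<^sup>2 * integral {0..2*pi} (\<lambda>\<theta>. \<psi> (of_real R * cis \<theta>)) + 2 * (2*pi * (m R - m r)))"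
        by (intro mult_left_mono) auto
      then have "cmean (\<lambda>z. \<psi> z * norm (f z) powr p) R \<le> 2 * l\<^sup>2 * cmean \<psi> R + 2 * (m R - m r)"
        by (simp add: cmean_def v_def sq field_simps)
      moreover have "2 * (m R - m r) \<le> \<eta>" using mS[OF R] r(3) by simp
      ultimately show ?thesis by simp
    qed
  qed
  show ?thesis by (rule that[of "2 * l\<^sup>2"]) (use main in auto)
qed

section \<open>Distance of a function to its dilations in H^2\<close>

lemma pint_Re_holomorphic:
  assumes h: "h holomorphic_on ball 0 1" and R: "0 \<le> R" "R < 1" and t: "0 \<le> t" "t < 1"
  shows "pint t (\<lambda>\<phi>. Re (h (of_real R * cis \<phi>))) \<theta> = Re (h (of_real (R * t) * cis \<theta>))"
proof -
  define a where "a = of_real t * cis \<theta>"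
  have a: "norm a < 1" using t by (simp add: a_def norm_mult)
  obtain \<rho> where r: "\<rho> > 1" "(\<lambda>z. h (of_real R * disc_aut a z)) holomorphic_on ball 0 \<rho>"
    using holomorphic_comp_disc_aut[OF h R a] by metis
  have "pint t (\<lambda>\<phi>. Re (h (of_real R * cis \<phi>))) \<theta> = cmean (\<lambda>z. Re (h (of_real R * disc_aut a z))) 1"
    unfolding a_def using continuous_on_sphere_comp[OF h R(2)]
    by (intro cmean_disc_aut_pint[symmetric, where Q="\<lambda>z. Re (h z)"] R t continuous_intros)
  also have "\<dots> = Re (h (of_real R * a))"
    using cmean_Re_holomorphic[OF r(2), of 1] r(1) by simp
  finally show ?thesis by (simp add: a_def mult.assoc)
qed

text \<open>On harmonic functions the Poisson integral is dilation by \<open>t\<close>. It takes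
  \<open>v\<close> to \<open>u\<close>, and \<open>u\<close> to the dilation of \<open>h\<close> by
  t^2. The L^2 gap estimate then bounds the distance of \<open>h\<close> from this dilation by the
  increase of the means.\<close>

lemma cmean_dilation_gap_Re:
  assumes h: "h holomorphic_on ball 0 1" and R: "0 \<le> R" "R < 1" and t: "0 \<le> t" "t < 1"
  shows "cmean (\<lambda>z. (Re (h z - h (of_real (t\<^sup>2) * z)))\<^sup>2) R \<le> cmean (\<lambda>z. (Re (h z))\<^sup>2) R - cmean (\<lambda>z. (Re (h z))\<^sup>2) (R * t)"
proof -
  define u where "u = (\<lambda>\<theta>. Re (h (of_real (R * t) * cis \<theta>)))"
  define v where "v = (\<lambda>\<theta>. Re (h (of_real R * cis \<theta>)))"
  have Rt: "0 \<le> R * t" "R * t < 1" using R t mult_le_one[of R t] by (auto, metis less_eq_real_def mult_less_cancel_left1 mult_left_le order_less_le_trans not_less)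
  have c: "continuous_on {0..2*pi} u" "continuous_on {0..2*pi} v"
    unfolding u_def v_def
    using cmean_integrable(2)[of "R*t" "\<lambda>z. Re (h z)"] cmean_integrable(2)[of R "\<lambda>z. Re (h z)"]
      continuous_on_sphere_comp[OF h R(2)] continuous_on_sphere_comp[OF h Rt(2)] R Rt
    by (auto intro: continuous_intros)
  have Pv: "pint t v \<theta> = u \<theta>" and Pu: "pint t u \<theta> = Re (h (of_real (R * t * t) * cis \<theta>))" for \<theta>
    unfolding u_def v_def using pint_Re_holomorphic[OF h R t] pint_Re_holomorphic[OF h Rt t] by auto
  have "integral {0..2*pi} (\<lambda>\<theta>. (v \<theta> - pint t u \<theta>)\<^sup>2) \<le> integral {0..2*pi} (\<lambda>\<theta>. (v \<theta>)\<^sup>2) - integral {0..2*pi} (\<lambda>\<theta>. (u \<theta>)\<^sup>2)"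
    by (rule pint_L2_gap[OF t c]) (simp add: Pv power2_eq_square)
  then have "1/(2*pi) * integral {0..2*pi} (\<lambda>\<theta>. (v \<theta> - pint t u \<theta>)\<^sup>2) \<le>
     1/(2*pi) * (integral {0..2*pi} (\<lambda>\<theta>. (v \<theta>)\<^sup>2) - integral {0..2*pi} (\<lambda>\<theta>. (u \<theta>)\<^sup>2))" by (intro mult_left_mono) auto
  then show ?thesis unfolding Pu unfolding cmean_def right_diff_distrib u_def v_def by (simp add: mult_ac power2_eq_square)
qed

lemma cmean_dilation_gap:
  assumes h: "h holomorphic_on ball 0 1" and R: "0 \<le> R" "R < 1" and t: "0 \<le> t" "t < 1"
  shows "cmean (\<lambda>z. (norm (h z - h (of_real (t\<^sup>2) * z)))\<^sup>2) R \<le> cmean (\<lambda>z. (norm (h z))\<^sup>2) R - cmean (\<lambda>z. (norm (h z))\<^sup>2) (R * t)"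
proof -
  have h': "(\<lambda>z. - \<i> * h z) holomorphic_on ball 0 1" using h by (intro holomorphic_intros)
  have n: "(norm z)\<^sup>2 = (Re z)\<^sup>2 + (Re (- \<i> * z))\<^sup>2" for z by (simp add: cmod_power2)
  have dil: "(\<lambda>z. h (of_real (t\<^sup>2) * z)) holomorphic_on ball 0 1"
  proof -
    have "norm (of_real (t\<^sup>2) * z) < 1" if "norm z < 1" for z :: complex
      using t that mult_le_cancel_right1[of "t\<^sup>2" "norm z"] power_le_one[of t 2]
      by (smt (verit) norm_ge_zero norm_mult norm_of_real zero_le_power2 mult_left_le_one_le)
    then have "(h \<circ> (\<lambda>z. of_real (t\<^sup>2) * z)) holomorphic_on ball 0 1"
      by (intro holomorphic_on_compose_gen[OF _ h] holomorphic_intros) auto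
    then show ?thesis by (simp add: o_def)
  qed
  have Rt: "0 \<le> R * t" "R * t < 1" using R t by (auto, metis less_eq_real_def mult_less_cancel_left1 mult_left_le order_less_le_trans not_less)
  have c: "continuous_on (sphere 0 r) h" "continuous_on (sphere 0 r) (\<lambda>z. h (of_real (t\<^sup>2) * z))" if "r < 1" for r
    using continuous_on_sphere_comp[OF h that] continuous_on_sphere_comp[OF dil that] by auto
  have a: "cmean (\<lambda>z. (norm (k z))\<^sup>2) r = cmean (\<lambda>z. (Re (k z))\<^sup>2) r + cmean (\<lambda>z. (Re (- \<i> * k z))\<^sup>2) r"
    if "continuous_on (sphere 0 r) k" "0 \<le> r" for k :: "complex \<Rightarrow> complex" and r
    unfolding n by (intro cmean_add continuous_intros that)
  have "cmean (\<lambda>z. (norm (h z - h (of_real (t\<^sup>2) * z)))\<^sup>2) R =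
    cmean (\<lambda>z. (Re (h z - h (of_real (t\<^sup>2) * z)))\<^sup>2) R + cmean (\<lambda>z. (Re (- \<i> * h z - - \<i> * h (of_real (t\<^sup>2) * z)))\<^sup>2) R"
    using a[OF continuous_on_diff[OF c[OF R(2)]] R(1)] by (simp add: algebra_simps)
  also have "\<dots> \<le> (cmean (\<lambda>z. (Re (h z))\<^sup>2) R - cmean (\<lambda>z. (Re (h z))\<^sup>2) (R * t)) +
     (cmean (\<lambda>z. (Re (- \<i> * h z))\<^sup>2) R - cmean (\<lambda>z. (Re (- \<i> * h z))\<^sup>2) (R * t))"
    by (intro add_mono cmean_dilation_gap_Re[OF h R t] cmean_dilation_gap_Re[OF h' R t])
  also have "\<dots> = cmean (\<lambda>z. (norm (h z))\<^sup>2) R - cmean (\<lambda>z. (norm (h z))\<^sup>2) (R * t)"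
    using a[OF c(1)[OF R(2)] R(1)] a[OF c(1)[OF Rt(2)] Rt(1)] by simp
  finally show ?thesis .
qed

subsection \<open>Hardy spaces\<close>

text \<open>The integrand has a primitive on the disc, and the segment integral is its increment.
  From here on the operator is used through the derivative and the value at 0.\<close>

lemma volterra_primitive:
  assumes f: "f holomorphic_on ball 0 1" and g: "g holomorphic_on ball 0 1"
  shows "volterra g f holomorphic_on ball 0 1"
    and "\<And>z. z \<in> ball 0 1 \<Longrightarrow> deriv (volterra g f) z = f z * deriv g z"
    and "volterra g f 0 = 0"
proof -
  have "(\<lambda>z. f z * deriv g z) holomorphic_on ball 0 1"
    using f g by (intro holomorphic_intros) auto
  then obtain \<Phi> where \<Phi>: "\<And>z. z \<in> ball 0 1 \<Longrightarrow> (\<Phi> has_field_derivative f z * deriv g z) (at z within ball 0 1)"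
    using holomorphic_convex_primitive'[of "ball 0 1" "\<lambda>z. f z * deriv g z"] by auto
  have eq: "volterra g f z = \<Phi> z - \<Phi> 0" if z: "z \<in> ball 0 1" for z
  proof -
    have in_ball: "of_real t * z \<in> ball 0 1" if "t \<in> {0..1}" for t :: real
    proof -
      have "t * norm z \<le> 1 * norm z" using that by (intro mult_right_mono) auto
      then show ?thesis using z that by (simp add: norm_mult)
    qed
    have "((\<lambda>t::real. f (of_real t * z) * deriv g (of_real t * z) * z) has_integral (\<Phi> (of_real 1 * z) - \<Phi> (of_real 0 * z))) {0..1}"
    proof (rule fundamental_theorem_of_calculus)
      fix t :: real assume t: "t \<in> {0..1}"
      have "(\<Phi> has_field_derivative f (of_real t * z) * deriv g (of_real t * z)) (at (of_real t * z))"
        using \<Phi>[OF in_ball[OF t]] at_within_open[OF in_ball[OF t] open_ball] by simp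
      moreover have "((\<lambda>t::real. of_real t * z) has_vector_derivative z) (at t within {0..1})"
        by (auto intro!: derivative_eq_intros simp: has_vector_derivative_def scaleR_conv_of_real)
      ultimately have "((\<Phi> \<circ> (\<lambda>t::real. of_real t * z)) has_vector_derivative z * (f (of_real t * z) * deriv g (of_real t * z))) (at t within {0..1})"
        by (intro field_vector_diff_chain_within) (auto intro: has_field_derivative_at_within)
      then show "((\<lambda>t::real. \<Phi> (of_real t * z)) has_vector_derivative f (of_real t * z) * deriv g (of_real t * z) * z) (at t within {0..1})"
        by (simp add: o_def mult_ac)
    qed simp
    from integral_unique[OF this] show ?thesis
      using z unfolding volterra_def by (simp only: if_True of_real_1 of_real_0 mult_1_left mult_zero_left)
  qed
  have d: "(volterra g f has_field_derivative f z * deriv g z) (at z)" if z: "z \<in> ball 0 1" for z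
  proof (rule has_field_derivative_transform_within_open[where S="ball 0 1"])
    show "((\<lambda>z. \<Phi> z - \<Phi> 0) has_field_derivative f z * deriv g z) (at z)"
      using \<Phi>[OF z] at_within_open[OF z open_ball] by (auto intro!: derivative_eq_intros)
  qed (use z eq in auto)
  then show "volterra g f holomorphic_on ball 0 1" unfolding holomorphic_on_open[OF open_ball] by blast
  show "deriv (volterra g f) z = f z * deriv g z" if "z \<in> ball 0 1" for z
    using d[OF that] by (rule DERIV_imp_deriv)
  show "volterra g f 0 = 0" using eq[of 0] by simp
qed

text \<open>The p-th power of the Hardy norm. Estimates are made at this level; roots are taken only
  where the notions of the theorem demand them.\<close>

definition hpow :: "real \<Rightarrow> (complex \<Rightarrow> complex) \<Rightarrow> real" where
  "hpow p f = (SUP r\<in>{0..<1}. cmean (\<lambda>z. norm (f z) powr p) r)"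

lemma hardy_norm_eq: "hardy_norm p f = hpow p f powr (1 / p)"
  by (simp add: hardy_norm_def hpow_def hardy_mean_eq_cmean)

lemma hardyD:
  assumes "f \<in> hardy p"
  shows "f holomorphic_on ball 0 1" "\<And>z. z \<notin> ball 0 1 \<Longrightarrow> f z = 0"
    "bdd_above (cmean (\<lambda>z. norm (f z) powr p) ` {0..<1})"
    "\<And>r. 0 \<le> r \<Longrightarrow> r < 1 \<Longrightarrow> cmean (\<lambda>z. norm (f z) powr p) r \<le> hpow p f"
proof -
  show "f holomorphic_on ball 0 1" "\<And>z. z \<notin> ball 0 1 \<Longrightarrow> f z = 0" using assms by (auto simp: hardy_def)
  show b: "bdd_above (cmean (\<lambda>z. norm (f z) powr p) ` {0..<1})"
    using assms by (auto simp: hardy_def hardy_mean_eq_cmean)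
  show "cmean (\<lambda>z. norm (f z) powr p) r \<le> hpow p f" if "0 \<le> r" "r < 1" for r
    unfolding hpow_def using that by (intro cSUP_upper b) auto
qed

lemma hardyI:
  assumes "f holomorphic_on ball 0 1" "\<And>z. z \<notin> ball 0 1 \<Longrightarrow> f z = 0"
    "\<And>r. 0 \<le> r \<Longrightarrow> r < 1 \<Longrightarrow> cmean (\<lambda>z. norm (f z) powr p) r \<le> C"
  shows "f \<in> hardy p" and "hpow p f \<le> C"
  using assms by (auto simp: hardy_def hardy_mean_eq_cmean hpow_def intro!: bdd_aboveI2[where M=C] cSUP_least)

lemma hpow_nonneg: "f \<in> hardy p \<Longrightarrow> 0 \<le> hpow p f"
  using hardyD(4)[of f p 0] by (auto intro: order_trans[OF powr_ge_zero])

lemma hardy_norm_powr: "f \<in> hardy p \<Longrightarrow> p > 0 \<Longrightarrow> hardy_norm p f powr p = hpow p f"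
  using hpow_nonneg[of f p] by (simp add: hardy_norm_eq powr_powr)

lemma continuous_on_sphere_hardy:
  "f \<in> hardy p \<Longrightarrow> r < 1 \<Longrightarrow> continuous_on (sphere 0 r) f"
  using continuous_on_sphere_comp[OF hardyD(1)] .

lemma hardy_scale:
  assumes f: "f \<in> hardy p" and p: "p > 0"
  shows "(\<lambda>z. c * f z) \<in> hardy p" and "hpow p (\<lambda>z. c * f z) = norm c powr p * hpow p f"
proof -
  have eq: "cmean (\<lambda>z. norm (d * h z) powr p) r = norm d powr p * cmean (\<lambda>z. norm (h z) powr p) r" for d r and h :: "complex \<Rightarrow> complex"
    by (simp add: norm_mult powr_mult cmean_cmult)
  have le: "(\<lambda>z. d * h z) \<in> hardy p \<and> hpow p (\<lambda>z. d * h z) \<le> norm d powr p * hpow p h" if "h \<in> hardy p" for d h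
  proof -
    have 1: "(\<lambda>z. d * h z) holomorphic_on ball 0 1" using hardyD(1)[OF that] by (intro holomorphic_intros)
    have 2: "cmean (\<lambda>z. norm (d * h z) powr p) r \<le> norm d powr p * hpow p h" if "0 \<le> r" "r < 1" for r
      unfolding eq using hardyD(4)[OF \<open>h \<in> hardy p\<close> that] by (intro mult_left_mono) auto
    show ?thesis using hardyI[OF 1 _ 2] hardyD(2)[OF that] by auto
  qed
  show c: "(\<lambda>z. c * f z) \<in> hardy p" using le[OF f] by blast
  show "hpow p (\<lambda>z. c * f z) = norm c powr p * hpow p f"
  proof (cases "c = 0")
    case False
    \<comment> \<open>Equality follows from the inequality applied to the inverse factor.\<close>
    have "hpow p (\<lambda>z. inverse c * (c * f z)) \<le> norm (inverse c) powr p * hpow p (\<lambda>z. c * f z)" using le[OF c] by blast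
    moreover have "norm (inverse c) powr p = 1 / norm c powr p"
      using False by (simp add: norm_divide inverse_eq_divide powr_divide)
    ultimately have "hpow p f \<le> hpow p (\<lambda>z. c * f z) / norm c powr p" using False by (simp flip: mult.assoc)
    then have "norm c powr p * hpow p f \<le> hpow p (\<lambda>z. c * f z)" using False by (simp add: field_simps)
    then show ?thesis using le[OF f, of c] by (intro antisym) auto
  qed (use p in \<open>simp add: hpow_def\<close>)
qed

lemma hardy_add:
  assumes f: "f \<in> hardy p" and g: "g \<in> hardy p" and p: "p > 0"
  shows "(\<lambda>z. f z + g z) \<in> hardy p" and "hpow p (\<lambda>z. f z + g z) \<le> 2 powr p * (hpow p f + hpow p g)"
proof -
  have *: "cmean (\<lambda>z. norm (f z + g z) powr p) r \<le> 2 powr p * (hpow p f + hpow p g)" if r: "0 \<le> r" "r < 1" for r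
  proof -
    note c = continuous_on_norm_powr[OF continuous_on_sphere_hardy[OF f r(2)] p] continuous_on_norm_powr[OF continuous_on_sphere_hardy[OF g r(2)] p]
    have "cmean (\<lambda>z. norm (f z + g z) powr p) r \<le> cmean (\<lambda>z. 2 powr p * (norm (f z) powr p + norm (g z) powr p)) r"
    proof (intro cmean_mono r)
      show "continuous_on (sphere 0 r) (\<lambda>z. norm (f z + g z) powr p)"
        by (intro continuous_on_norm_powr continuous_on_add continuous_on_sphere_hardy[OF f r(2)] continuous_on_sphere_hardy[OF g r(2)] p)
      show "continuous_on (sphere 0 r) (\<lambda>z. 2 powr p * (norm (f z) powr p + norm (g z) powr p))"
        by (intro continuous_on_mult continuous_on_const continuous_on_add c)
      fix z
      have "norm (f z + g z) powr p \<le> (norm (f z) + norm (g z)) powr p"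
        using p by (intro powr_mono2 norm_triangle_ineq) auto
      also have "\<dots> \<le> 2 powr p * (norm (f z) powr p + norm (g z) powr p)" using p by (intro add_powr_le) auto
      finally show "norm (f z + g z) powr p \<le> 2 powr p * (norm (f z) powr p + norm (g z) powr p)" .
    qed
    also have "\<dots> = 2 powr p * (cmean (\<lambda>z. norm (f z) powr p) r + cmean (\<lambda>z. norm (g z) powr p) r)"
      by (simp only: cmean_cmult cmean_add[OF c r(1)])
    also have "\<dots> \<le> 2 powr p * (hpow p f + hpow p g)"
      using hardyD(4)[OF f r] hardyD(4)[OF g r] by (intro mult_left_mono add_mono) auto
    finally show ?thesis .
  qed
  show "(\<lambda>z. f z + g z) \<in> hardy p" "hpow p (\<lambda>z. f z + g z) \<le> 2 powr p * (hpow p f + hpow p g)"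
    using hardyI[of "\<lambda>z. f z + g z" p, OF _ _ *] hardyD(1,2)[OF f] hardyD(1,2)[OF g] by (auto intro!: holomorphic_intros)
qed

lemma hardy_zero: "(\<lambda>z. 0) \<in> hardy p" "hpow p (\<lambda>z. 0) = 0"
  using hardyI[of "\<lambda>z. 0" p 0] hpow_nonneg[of "\<lambda>z. 0" p] by auto

lemma hardy_sum:
  assumes "finite A" "\<And>i. i \<in> A \<Longrightarrow> F i \<in> hardy p" "p > 0"
  shows "(\<lambda>z. \<Sum>i\<in>A. c i * F i z) \<in> hardy p"
  using assms
proof (induction A rule: finite_induct)
  case (insert x A)
  have "(\<lambda>z. c x * F x z + (\<Sum>i\<in>A. c i * F i z)) \<in> hardy p"
    by (rule hardy_add(1)[OF hardy_scale(1)]) (use insert in auto)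
  then show ?case using insert by simp
qed (simp add: hardy_zero)

text \<open>The Poisson inequality on the circle halfway between \<open>z\<close> and the boundary,
  with the kernel replaced by an upper bound. Convergence in H^p therefore implies uniform
  convergence on smaller discs.\<close>

lemma hardy_point_bound:
  assumes f: "f \<in> hardy p" and p: "p > 0" and z: "norm z < 1"
  shows "norm (f z) powr p \<le> 4 / (1 - norm z)\<^sup>2 * hpow p f"
proof -
  define R where "R = (1 + norm z) / 2"
  define a where "a = z / of_real R"
  have R: "0 \<le> R" "R < 1" "R > 0" using z by (auto simp: R_def add_pos_nonneg)
  have az: "of_real R * a = z" using R by (simp add: a_def)
  have "norm a = norm z / R" using R by (simp add: a_def norm_divide)
  then have na: "norm a = 2 * norm z / (1 + norm z)" by (simp add: R_def)
  have a1: "1 - norm a \<ge> (1 - norm z) / 2"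
  proof -
    have "0 < 1 + norm z" by (simp add: add_pos_nonneg)
    then have "1 - norm a = (1 - norm z) / (1 + norm z)" unfolding na by (simp add: field_simps)
    also have "\<dots> \<ge> (1 - norm z) / 2" using z \<open>0 < 1 + norm z\<close> by (intro divide_left_mono) auto
    finally show ?thesis .
  qed
  have a: "norm a < 1" using a1 z by simp
  have hf: "f holomorphic_on ball 0 1" using hardyD(1)[OF f] .
  have c: "continuous_on (sphere 0 R) (\<lambda>z. norm (f z) powr p)"
    by (rule continuous_on_norm_powr[OF continuous_on_sphere_hardy[OF f R(2)] p])
  have pk: "poisson_kernel a \<theta> \<le> 4 / (1 - norm z)\<^sup>2" for \<theta>
  proof -
    have "1 - norm a \<le> norm (1 - cnj a * cis \<theta>)"
      using norm_triangle_ineq2[of 1 "cnj a * cis \<theta>"] by (simp add: norm_mult)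
    then have "(1 - norm z) / 2 \<le> norm (1 - cnj a * cis \<theta>)" using a1 by linarith
    then have "((1 - norm z) / 2)\<^sup>2 \<le> (norm (1 - cnj a * cis \<theta>))\<^sup>2" using z by (intro power_mono) auto
    then have "(1 - (norm a)\<^sup>2) / (norm (1 - cnj a * cis \<theta>))\<^sup>2 \<le> 1 / ((1 - norm z) / 2)\<^sup>2"
      using z a by (intro frac_le) (auto simp: abs_square_le_1)
    then show ?thesis by (simp add: poisson_kernel_def power_divide)
  qed
  have "norm (f z) powr p \<le> cmean (\<lambda>z. norm (f (of_real R * disc_aut a z)) powr p) 1"
    using poisson_inequality[OF hf R(1,2) a p] by (simp add: az)
  also have "\<dots> = 1 / (2*pi) * integral {0..2*pi} (\<lambda>\<theta>. norm (f (of_real R * cis \<theta>)) powr p * poisson_kernel a \<theta>)"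
    by (rule poisson_mean_eq[OF a c R(1)])
  also have "\<dots> \<le> 1 / (2*pi) * integral {0..2*pi} (\<lambda>\<theta>. 4 / (1 - norm z)\<^sup>2 * norm (f (of_real R * cis \<theta>)) powr p)"
  proof (intro mult_left_mono integral_le integrable_continuous_real continuous_on_mult continuous_on_const
      cmean_integrable(2)[OF c R(1)] continuous_on_poisson_kernel[OF a])
    fix \<theta>
    show "norm (f (of_real R * cis \<theta>)) powr p * poisson_kernel a \<theta> \<le> 4 / (1 - norm z)\<^sup>2 * norm (f (of_real R * cis \<theta>)) powr p"
      using mult_left_mono[OF pk[of \<theta>], of "norm (f (of_real R * cis \<theta>)) powr p"] by (simp add: mult.commute)
  qed auto
  also have "\<dots> = 4 / (1 - norm z)\<^sup>2 * cmean (\<lambda>z. norm (f z) powr p) R" by (simp add: cmean_def)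
  also have "\<dots> \<le> 4 / (1 - norm z)\<^sup>2 * hpow p f" by (intro mult_left_mono hardyD(4)[OF f R(1,2)]) auto
  finally show ?thesis .
qed

lemma hpow_eq_0:
  assumes "f \<in> hardy p" "p > 0" "hpow p f \<le> 0"
  shows "f = (\<lambda>z. 0)"
proof
  fix z
  show "f z = 0"
  proof (cases "norm z < 1")
    case True
    have "norm (f z) powr p \<le> 4 / (1 - norm z)\<^sup>2 * hpow p f" by (rule hardy_point_bound[OF assms(1,2) True])
    also have "\<dots> \<le> 0" using assms(3) by (intro mult_nonneg_nonpos) auto
    finally show ?thesis by simp
  qed (use hardyD(2)[OF assms(1)] in auto)
qed

section \<open>The operator on Hardy spaces and the splitting of its symbol\<close>

lemma volterra_bounded:
  assumes g: "g holomorphic_on ball 0 1" "bmoa_bound g B" and p: "p \<ge> 1"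
  obtains K where "K > 0" "\<And>f. f \<in> hardy p \<Longrightarrow> volterra g f \<in> hardy p \<and> hpow p (volterra g f) \<le> K * hpow p f"
proof -
  define K1 where "K1 = (p/2 * exp B + 2/p) * 2 powr (p/2)"
  define K2 where "K2 = 2 * (p\<^sup>2/4 * exp B * (p\<^sup>2/2 * exp B) powr (p/2 - 1)) * 2 powr (p/2)"
  have K: "K1 > 0" "K2 \<ge> 0" using p by (auto simp: K1_def K2_def add_pos_pos)
  have main: "volterra g f \<in> hardy p \<and> hpow p (volterra g f) \<le> (K1 + K2) * hpow p f" if fH: "f \<in> hardy p" for f
  proof -
    note hf = hardyD(1)[OF fH]
    have "cmean (\<lambda>z. norm (volterra g f z) powr p) r \<le> (K1 + K2) * hpow p f" if r: "0 \<le> r" "r < 1" for r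
    proof -
      \<comment> \<open>The potential exists on every disc of radius \<open>R\<close> < 1 with the
        same bound \<open>B\<close>, so the constants do not depend on \<open>r\<close>.\<close>
      define R where "R = (1 + r) / 2"
      have Rr: "0 < R" "R < 1" "r < R" using r by (auto simp: R_def)
      have sub: "ball (0::complex) R \<subseteq> ball 0 1" using Rr by auto
      obtain G where G: "G holomorphic_on ball 0 R"
        "\<And>z. z \<in> ball 0 R \<Longrightarrow> 0 \<le> Re (G z) - (norm (g z))\<^sup>2 \<and> Re (G z) - (norm (g z))\<^sup>2 \<le> B"
        using bmoa_potential[OF g Rr(1,2)] by metis
      interpret volterra_pair_potential R f g "volterra g f" G B
        using volterra_primitive[OF hf g(1)] Rr sub hf g(1) G
        by unfold_locales (auto intro: holomorphic_on_subset)
      define m where "m = cmean (\<lambda>z. norm (f z) powr p) r"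
      have m: "0 \<le> m" "m \<le> hpow p f" unfolding m_def using hardyD(4)[OF fH r] r by (auto intro!: cmean_nonneg)
      have "cmean (\<lambda>z. norm (volterra g f z) powr p) r \<le> (K1 + K2) * m"
      proof (cases "p \<le> 2")
        case True
        then have "cmean (\<lambda>z. norm (volterra g f z) powr p) r \<le> K1 * m"
          unfolding K1_def m_def using volterra_mean_le_small[of p r] p r Rr by simp
        also have "\<dots> \<le> (K1 + K2) * m" using K m by (intro mult_right_mono) auto
        finally show ?thesis .
      next
        case False
        then have "cmean (\<lambda>z. norm (volterra g f z) powr p) r \<le> K2 * m"
          unfolding K2_def m_def using volterra_mean_le_large[of p r] r Rr by simp
        also have "\<dots> \<le> (K1 + K2) * m" using K m by (intro mult_right_mono) auto
        finally show ?thesis .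
      qed
      also have "\<dots> \<le> (K1 + K2) * hpow p f" using K m by (intro mult_left_mono) auto
      finally show ?thesis .
    qed
    then show ?thesis using hardyI[of "volterra g f" p] volterra_primitive(1)[OF hf g(1)] by (auto simp: volterra_def)
  qed
  show ?thesis by (rule that[of "K1 + K2"]) (use K main in auto)
qed

text \<open>\<open>P\<close> is a dilation of \<open>g\<close>, holomorphic beyond the closed disc,
  so its derivative is bounded. The remainder is small in H^2 because the means of |g|^2 are bounded
  and hence nearly constant close to the boundary.\<close>

lemma bmoa_split:
  assumes g: "g holomorphic_on ball 0 1" "bmoa_bound g B" and \<delta>: "\<delta> > 0"
  obtains P u K where "P holomorphic_on ball 0 1" "u holomorphic_on ball 0 1" "\<And>z. g z = P z + u z"
    "\<And>z. z \<in> ball 0 1 \<Longrightarrow> norm (deriv P z) \<le> K" "\<And>r. 0 \<le> r \<Longrightarrow> r < 1 \<Longrightarrow> cmean (\<lambda>z. (norm (u z))\<^sup>2) r \<le> \<delta>"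
proof -
  define m where "m = cmean (\<lambda>z. (norm (g z))\<^sup>2)"
  have mono: "cmean (\<lambda>z. (norm (h z))\<^sup>2) s \<le> cmean (\<lambda>z. (norm (h z))\<^sup>2) r" if "0 \<le> s" "s \<le> r" "r < 1" "h holomorphic_on ball 0 1" for s r h
    using cmean_norm_powr_mono[OF that(4) _ that(1-3), of 2] by simp
  \<comment> \<open>Re G is a harmonic majorant of |g|^2 that exceeds it by at most \<open>B\<close>
    at the centre.\<close>
  have bd: "m r \<le> (norm (g 0))\<^sup>2 + B" if r: "0 \<le> r" "r < 1" for r
  proof -
    define R where "R = (1 + r) / 2"
    have R: "0 < R" "R < 1" "r < R" using r by (auto simp: R_def)
    obtain G where G: "G holomorphic_on ball 0 R"
        "\<And>z. z \<in> ball 0 R \<Longrightarrow> 0 \<le> Re (G z) - (norm (g z))\<^sup>2 \<and> Re (G z) - (norm (g z))\<^sup>2 \<le> B"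
      using bmoa_potential[OF g R(1,2)] by metis
    have "m r \<le> cmean (\<lambda>z. Re (G z)) r" unfolding m_def
    proof (intro cmean_mono r)
      show "continuous_on (sphere 0 r) (\<lambda>z. (norm (g z))\<^sup>2)" "continuous_on (sphere 0 r) (\<lambda>z. Re (G z))"
        using continuous_on_sphere_comp[OF g(1) r(2)] continuous_on_sphere_comp[OF G(1) R(3)] by (auto intro: continuous_intros)
      show "(norm (g z))\<^sup>2 \<le> Re (G z)" if "norm z = r" for z using G(2)[of z] that R by auto
    qed
    also have "\<dots> = Re (G 0)" using cmean_Re_holomorphic[OF G(1) r(1) R(3)] .
    also have "\<dots> \<le> (norm (g 0))\<^sup>2 + B" using G(2)[of 0] R by auto
    finally show ?thesis .
  qed
  have bdd: "bdd_above (m ` {0..<1})" using bd by (intro bdd_aboveI2) auto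
  define S where "S = (SUP r\<in>{0..<1}. m r)"
  have mS: "m r \<le> S" if "0 \<le> r" "r < 1" for r unfolding S_def using bdd that by (intro cSUP_upper) auto
  obtain r1 where r1: "0 \<le> r1" "r1 < 1" "S - \<delta> < m r1"
  proof -
    have "\<exists>x\<in>m ` {0..<1}. S - \<delta> < x"
      unfolding S_def using \<delta> bdd by (intro less_cSupD) auto
    then show ?thesis using that by auto
  qed
  \<comment> \<open>For \<open>r\<close> \<ge> \<open>t\<close> the product r t is at least t * t
    \<ge> \<open>r1\<close>, so both radii lie where the means differ by less than \<delta>. The 1/2
    keeps \<open>t\<close> positive.\<close>
  define t where "t = sqrt (max r1 (1/2))"
  have t: "0 < t" "t < 1" "t * t = max r1 (1/2)" using r1 by (auto simp: t_def)
  have mt: "S - \<delta> < m (t * t)"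
    using r1 mono[of r1 "max r1 (1/2)" g] g(1) unfolding t(3) m_def by auto
  define P where "P = (\<lambda>z. g (of_real (t\<^sup>2) * z))"
  define u where "u = (\<lambda>z. g z - P z)"
  have tt: "t\<^sup>2 < 1" "0 < t\<^sup>2" using t using mult_strict_mono[of t 1 t 1] by (auto simp: power2_eq_square)
  have hP: "P holomorphic_on ball 0 (1 / t\<^sup>2)"
  proof -
    have "(g \<circ> (\<lambda>z. of_real (t\<^sup>2) * z)) holomorphic_on ball 0 (1 / t\<^sup>2)"
      by (intro holomorphic_on_compose_gen[OF _ g(1)] holomorphic_intros)
        (use tt in \<open>auto simp: norm_mult field_simps norm_power\<close>)
    then show ?thesis by (simp add: P_def o_def)
  qed
  have big: "1 < 1 / t\<^sup>2" using tt by simp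
  have hP1: "P holomorphic_on ball 0 1" by (rule holomorphic_on_subset[OF hP]) (use big in auto)
  have "continuous_on (cball 0 1) (deriv P)"
    by (rule continuous_on_subset[OF holomorphic_on_imp_continuous_on[OF holomorphic_deriv[OF hP open_ball]]]) (use big in auto)
  then have "bounded (deriv P ` cball 0 1)" by (intro compact_imp_bounded compact_continuous_image compact_cball)
  then obtain K where "\<forall>x\<in>deriv P ` cball 0 1. norm x \<le> K" unfolding bounded_iff by blast
  then have K: "\<And>z. z \<in> cball 0 1 \<Longrightarrow> norm (deriv P z) \<le> K" by blast
  have hu: "u holomorphic_on ball 0 1" unfolding u_def by (intro holomorphic_intros g hP1)
  have gap: "cmean (\<lambda>z. (norm (u z))\<^sup>2) r \<le> \<delta>" if r: "t \<le> r" "r < 1" for r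
  proof -
    have "cmean (\<lambda>z. (norm (u z))\<^sup>2) r \<le> m r - m (r * t)"
      unfolding u_def P_def m_def using r t by (intro cmean_dilation_gap g) auto
    moreover have "m (t * t) \<le> m (r * t)" unfolding m_def
    proof (rule mono[OF _ _ _ g(1)])
      show "t * t \<le> r * t" using r t(1) by (intro mult_right_mono) auto
      show "r * t < 1" using r t(1,2) mult_strict_mono[of r 1 t 1] by simp
    qed simp
    ultimately show ?thesis using mS[of r] mt r t by auto
  qed
  show ?thesis
  proof (rule that[OF hP1 hu])
    show "g z = P z + u z" for z by (simp add: u_def)
    show "norm (deriv P z) \<le> K" if "z \<in> ball 0 1" for z using K that by auto
    show "cmean (\<lambda>z. (norm (u z))\<^sup>2) r \<le> \<delta>" if r: "0 \<le> r" "r < 1" for r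
    proof (cases "t \<le> r")
      case False
      then have "cmean (\<lambda>z. (norm (u z))\<^sup>2) r \<le> cmean (\<lambda>z. (norm (u z))\<^sup>2) t" using r t hu by (intro mono) auto
      also have "\<dots> \<le> \<delta>" using gap[of t] t by simp
      finally show ?thesis .
    qed (use gap r in auto)
  qed
qed

text \<open>Compactness of the operator from \<open>H\<^sup>p\<close> to the larger space \<open>H\<^sup>q\<close>, where \<open>1/q = 1/p + 1/2\<close>.\<close>
lemma volterra_small_high_order:
  assumes g: "g holomorphic_on ball 0 1" "bmoa_bound g B" and p: "p \<ge> 1" and q: "q = 2 * p / (p + 2)" and \<epsilon>: "\<epsilon> > 0"
  obtains N where "\<And>f h r. f \<in> hardy p \<Longrightarrow> hpow p f \<le> 1 \<Longrightarrow> h holomorphic_on ball 0 1 \<Longrightarrow>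
    (\<And>z. z \<in> ball 0 1 \<Longrightarrow> f z = z ^ N * h z) \<Longrightarrow> 0 \<le> r \<Longrightarrow> r < 1 \<Longrightarrow> cmean (\<lambda>z. norm (volterra g f z) powr q) r \<le> \<epsilon>"
proof -
  have q0: "q > 0" using p by (simp add: q)
  \<comment> \<open>Twice the coefficient of the preceding estimate, as the mean of |h|^p will be at
    most 2. \<Lambda> makes this term \<epsilon>/2. After it \<delta> and then \<open>N\<close> are
    chosen, so that the other term, with two contributions of at most \<delta>, is at most
    \<epsilon>/2 too.\<close>
  define C where "C = 8 * (1 + p/2)\<^sup>2 * 2 powr (p/2)"
  have C: "C > 0" using p by (simp add: C_def)
  define \<Lambda> where "\<Lambda> = (\<epsilon> / (2 * C)) powr (2 / q)"
  have \<Lambda>: "\<Lambda> > 0" using \<epsilon> C by (simp add: \<Lambda>_def)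
  have L1: "C * \<Lambda> powr (q/2) = \<epsilon> / 2" using \<epsilon> C q0 by (simp add: \<Lambda>_def powr_powr)
  define \<delta> where "\<delta> = \<epsilon> / (16 * \<Lambda> powr (q/2 - 1))"
  have \<delta>: "\<delta> > 0" using \<epsilon> \<Lambda> by (simp add: \<delta>_def)
  obtain P u K where PuK: "P holomorphic_on ball 0 1" "u holomorphic_on ball 0 1" "\<And>z. g z = P z + u z"
    "\<And>z. z \<in> ball 0 1 \<Longrightarrow> norm (deriv P z) \<le> K" "\<And>r. 0 \<le> r \<Longrightarrow> r < 1 \<Longrightarrow> cmean (\<lambda>z. (norm (u z))\<^sup>2) r \<le> \<delta>"
    using bmoa_split[OF g \<delta>] by metis
  obtain N where N: "K\<^sup>2 / \<delta> < real N" using reals_Archimedean2 by blast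
  have N': "K\<^sup>2 / (real N + 1)\<^sup>2 \<le> \<delta>"
  proof -
    have "K\<^sup>2 \<le> \<delta> * (real N + 1)" using N \<delta> by (simp add: field_simps)
    also have "\<dots> \<le> \<delta> * (real N + 1)\<^sup>2" using \<delta> by (intro mult_left_mono) (auto simp: power2_eq_square)
    finally show ?thesis by (simp add: field_simps)
  qed
  have dg: "deriv g z = deriv P z + deriv u z" if "z \<in> ball 0 1" for z
  proof -
    have "g = (\<lambda>z. P z + u z)" using PuK(3) by blast
    then show ?thesis
      using holomorphic_derivI[OF PuK(1) open_ball that] holomorphic_derivI[OF PuK(2) open_ball that]
      by (auto intro!: DERIV_imp_deriv derivative_eq_intros)
  qed
  have main: "cmean (\<lambda>z. norm (volterra g f z) powr q) r \<le> \<epsilon>"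
    if f: "f \<in> hardy p" "hpow p f \<le> 1" and h: "h holomorphic_on ball 0 1"
      and fh: "\<And>z. z \<in> ball 0 1 \<Longrightarrow> f z = z ^ N * h z" and r: "0 \<le> r" "r < 1" for f h r
  proof -
    \<comment> \<open>For |z| \<ge> \<open>c\<close> one has |z|^(N p) \<ge> 1/2, so dividing by z^N
      costs at most a factor 2 in the mean. The added 1 covers N = 0. Smaller circles are reached by
      monotonicity, whence the maximum \<open>s\<close>.\<close>
    define c where "c = (1/2::real) powr (1 / (real N * p + 1))"
    have e: "1 / (real N * p + 1) > 0" using p add_nonneg_pos[of "real N * p" 1] by auto
    then have "1 / (real N * p + 1) * ln (1/2) < 0" by (intro mult_pos_neg) auto
    then have c: "0 < c" "c < 1" by (simp_all only: c_def powr_def exp_less_one_iff exp_gt_zero) auto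
    define s where "s = max r c"
    have s: "0 < s" "s < 1" "r \<le> s" "c \<le> s" using c r by (auto simp: s_def)
    have sN: "1/2 \<le> s powr (real N * p)"
    proof -
      have "real N * p + 1 \<noteq> 0" using p add_nonneg_pos[of "real N * p" 1] by auto
      then have "1/2 = c powr (real N * p + 1)" by (simp add: c_def powr_powr)
      also have "\<dots> \<le> c powr (real N * p)" using c by (intro powr_mono') auto
      also have "\<dots> \<le> s powr (real N * p)" using c s p by (intro powr_mono2) auto
      finally show ?thesis .
    qed
    have "s powr (real N * p) * cmean (\<lambda>z. norm (h z) powr p) s = cmean (\<lambda>z. norm (f z) powr p) s"
      unfolding cmean_cmult[symmetric]
    proof (rule cmean_cong)
      fix z :: complex assume z: "norm z = s"
      have "norm (f z) powr p = (s ^ N) powr p * norm (h z) powr p"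
        using fh[of z] z s by (simp add: norm_mult norm_power powr_mult)
      also have "(s ^ N) powr p = s powr (real N * p)" using s by (simp add: powr_powr flip: powr_realpow)
      finally show "s powr (real N * p) * norm (h z) powr p = norm (f z) powr p" by simp
    qed (use s in auto)
    also have "\<dots> \<le> 1" using hardyD(4)[OF f(1), of s] f(2) s by simp
    finally have "1/2 * cmean (\<lambda>z. norm (h z) powr p) s \<le> 1"
      using mult_right_mono[OF sN, of "cmean (\<lambda>z. norm (h z) powr p) s"] s cmean_nonneg[of s "\<lambda>z. norm (h z) powr p"] by auto
    then have hs: "cmean (\<lambda>z. norm (h z) powr p) s \<le> 2" by simp
    note V = volterra_primitive[OF hardyD(1)[OF f(1)] g(1)]
    have "cmean (\<lambda>z. norm (volterra g f z) powr q) r \<le> cmean (\<lambda>z. norm (volterra g f z) powr q) s"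
      by (rule cmean_norm_powr_mono[OF V(1) q0 r(1) s(3,2)])
    also have "\<dots> \<le> 4 * \<Lambda> powr (q/2 - 1) * (cmean (\<lambda>z. (norm (u z))\<^sup>2) s + K\<^sup>2 / (real N + 1)\<^sup>2) +
      4 * (1 + p/2)\<^sup>2 * \<Lambda> powr (q/2) * 2 powr (p/2) * cmean (\<lambda>z. norm (h z) powr p) s"
      using s V(2) fh dg by (intro volterra_mean_high_order[OF h V(1) V(3) PuK(1,2) _ PuK(4) p q \<Lambda>]) auto
    also have "\<dots> \<le> 4 * \<Lambda> powr (q/2 - 1) * (\<delta> + \<delta>) + 4 * (1 + p/2)\<^sup>2 * \<Lambda> powr (q/2) * 2 powr (p/2) * 2"
      using PuK(5)[of s] s N' hs by (intro add_mono mult_left_mono) auto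
    also have "4 * \<Lambda> powr (q/2 - 1) * (\<delta> + \<delta>) = \<epsilon> / 2" using \<Lambda> by (simp add: \<delta>_def)
    also have "4 * (1 + p/2)\<^sup>2 * \<Lambda> powr (q/2) * 2 powr (p/2) * 2 = C * \<Lambda> powr (q/2)" by (simp add: C_def)
    also have "\<epsilon> / 2 + C * \<Lambda> powr (q/2) = \<epsilon>" unfolding L1 by simp
    finally show ?thesis .
  qed
  show ?thesis by (rule that[of N]) (use main in auto)
qed

section \<open>Backward shifts, and elements of \<open>M\<close> that vanish to high order\<close>

definition zero_quot :: "(complex \<Rightarrow> complex) \<Rightarrow> complex \<Rightarrow> complex" where
  "zero_quot f z = (if z = 0 then deriv f 0 else (f z - f 0) / z)"

lemma zero_quot_eq: "f z = f 0 + z * zero_quot f z"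
  by (simp add: zero_quot_def)

lemma holomorphic_zero_quot:
  assumes "f holomorphic_on ball 0 1"
  shows "zero_quot f holomorphic_on ball 0 1"
proof -
  have "(\<lambda>z. if z = 0 then deriv f 0 else (f z - f 0) / (z - 0)) holomorphic_on ball 0 1"
    by (rule pole_lemma_open[OF assms open_ball])
  then show ?thesis by (simp add: zero_quot_def[abs_def] cong: if_cong)
qed

lemma holomorphic_zero_quot_funpow:
  "f holomorphic_on ball 0 1 \<Longrightarrow> (zero_quot ^^ j) f holomorphic_on ball 0 1"
  by (induction j) (auto intro: holomorphic_zero_quot)

text \<open>For holomorphic \<open>f\<close> the numbers \<open>(zero_quot ^^ j) f 0\<close> are the
  Taylor coefficients. The identity itself is algebraic, so it holds at every
  \<open>z\<close>.\<close>

lemma zero_quot_expansion: "f z = (\<Sum>j<N. (zero_quot ^^ j) f 0 * z ^ j) + z ^ N * (zero_quot ^^ N) f z"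
proof (induction N)
  case (Suc N)
  have "(zero_quot ^^ N) f z = (zero_quot ^^ N) f 0 + z * (zero_quot ^^ Suc N) f z"
    using zero_quot_eq[of "(zero_quot ^^ N) f" z] by simp
  then show ?case by (subst Suc) (simp add: algebra_simps)
qed simp

lemma zero_quot_sum:
  assumes "finite I" "\<And>i. i \<in> I \<Longrightarrow> F i holomorphic_on ball 0 1"
  shows "zero_quot (\<lambda>z. \<Sum>i\<in>I. c i * F i z) = (\<lambda>z. \<Sum>i\<in>I. c i * zero_quot (F i) z)"
proof
  fix z
  have "((\<lambda>z. \<Sum>i\<in>I. c i * F i z) has_field_derivative (\<Sum>i\<in>I. c i * deriv (F i) 0)) (at 0)"
    using assms(2) by (auto intro!: DERIV_sum DERIV_cmult holomorphic_derivI[OF _ open_ball])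
  then have "deriv (\<lambda>z. \<Sum>i\<in>I. c i * F i z) 0 = (\<Sum>i\<in>I. c i * deriv (F i) 0)" by (rule DERIV_imp_deriv)
  then show "zero_quot (\<lambda>z. \<Sum>i\<in>I. c i * F i z) z = (\<Sum>i\<in>I. c i * zero_quot (F i) z)"
    by (simp add: zero_quot_def sum_divide_distrib right_diff_distrib diff_divide_distrib flip: sum_subtractf)
qed

lemma zero_quot_funpow_sum:
  assumes "finite I" "\<And>i. i \<in> I \<Longrightarrow> F i holomorphic_on ball 0 1"
  shows "(zero_quot ^^ j) (\<lambda>z. \<Sum>i\<in>I. c i * F i z) = (\<lambda>z. \<Sum>i\<in>I. c i * (zero_quot ^^ j) (F i) z)"
proof (induction j)
  case (Suc j)
  have "(zero_quot ^^ Suc j) (\<lambda>z. \<Sum>i\<in>I. c i * F i z) = zero_quot (\<lambda>z. \<Sum>i\<in>I. c i * (zero_quot ^^ j) (F i) z)"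
    by (simp add: Suc)
  also have "\<dots> = (\<lambda>z. \<Sum>i\<in>I. c i * (zero_quot ^^ Suc j) (F i) z)"
    by (subst zero_quot_sum[OF assms(1)]) (auto intro: holomorphic_zero_quot_funpow assms(2))
  finally show ?case .
qed simp

text \<open>Gaussian elimination. An unknown with nonzero coefficient in the last equation is
  eliminated together with that equation, and its value \<open>- s\<close> is recovered from the
  smaller system.\<close>

lemma homogeneous_system_nontrivial:
  fixes A :: "'i \<Rightarrow> nat \<Rightarrow> complex"
  assumes "finite I" "card I > N"
  shows "\<exists>c. (\<exists>i\<in>I. c i \<noteq> 0) \<and> (\<forall>j<N. (\<Sum>i\<in>I. c i * A i j) = 0)"
  using assms
proof (induction N arbitrary: I A)
  case 0
  then obtain i where "i \<in> I" by fastforce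
  then show ?case by (intro exI[of _ "\<lambda>_. 1"]) auto
next
  case (Suc N)
  show ?case
  proof (cases "\<forall>i\<in>I. A i N = 0")
    case True
    obtain c where c: "\<exists>i\<in>I. c i \<noteq> 0" "\<forall>j<N. (\<Sum>i\<in>I. c i * A i j) = 0"
      using Suc.IH[of I A] Suc.prems by auto
    then show ?thesis using True by (intro exI[of _ c]) (auto simp: less_Suc_eq)
  next
    case False
    then obtain i0 where i0: "i0 \<in> I" "A i0 N \<noteq> 0" by blast
    define I' where "I' = I - {i0}"
    define A' where "A' i j = A i j - A i N / A i0 N * A i0 j" for i j
    have fin: "finite I'" "card I' > N" using Suc.prems i0 by (auto simp: I'_def)
    obtain c where c: "\<exists>i\<in>I'. c i \<noteq> 0" "\<forall>j<N. (\<Sum>i\<in>I'. c i * A' i j) = 0"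
      using Suc.IH[OF fin, of A'] by blast
    define s where "s = (\<Sum>i\<in>I'. c i * A i N) / A i0 N"
    define d where "d i = (if i = i0 then - s else c i)" for i
    have dsum: "(\<Sum>i\<in>I. d i * A i j) = - s * A i0 j + (\<Sum>i\<in>I'. c i * A i j)" for j
    proof -
      have "(\<Sum>i\<in>I. d i * A i j) = d i0 * A i0 j + (\<Sum>i\<in>I'. d i * A i j)"
        unfolding I'_def using Suc.prems(1) i0(1) by (rule sum.remove)
      also have "(\<Sum>i\<in>I'. d i * A i j) = (\<Sum>i\<in>I'. c i * A i j)" by (intro sum.cong) (auto simp: d_def I'_def)
      finally show ?thesis by (simp add: d_def)
    qed
    have A'sum: "(\<Sum>i\<in>I'. c i * A' i j) = (\<Sum>i\<in>I'. c i * A i j) - s * A i0 j" for j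
      unfolding A'_def s_def by (simp add: right_diff_distrib sum_subtractf sum_divide_distrib sum_distrib_right mult.assoc)
    have "(\<Sum>i\<in>I. d i * A i j) = 0" if "j < Suc N" for j
    proof (cases "j = N")
      case True
      then show ?thesis unfolding dsum using i0(2) by (simp add: s_def)
    next
      case False
      then have "(\<Sum>i\<in>I'. c i * A' i j) = 0" using c(2) that by simp
      then show ?thesis unfolding dsum A'sum by (simp add: algebra_simps)
    qed
    moreover have "\<exists>i\<in>I. d i \<noteq> 0" using c(1) by (auto simp: d_def I'_def)
    ultimately show ?thesis by blast
  qed
qed

lemma complex_subspace_sum:
  assumes "complex_subspace M" "finite I" "\<And>i. i \<in> I \<Longrightarrow> F i \<in> M"
  shows "(\<lambda>z. \<Sum>i\<in>I. c i * F i z) \<in> M"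
  using assms(2,3)
proof (induction I rule: finite_induct)
  case empty
  then show ?case using assms(1) by (simp add: complex_subspace_def)
next
  case (insert x I)
  have add: "(\<lambda>z. f z + h z) \<in> M" if "f \<in> M" "h \<in> M" for f h
    using that assms(1) by (simp add: complex_subspace_def)
  have "(\<lambda>z. c x * F x z) \<in> M" "(\<lambda>z. \<Sum>i\<in>I. c i * F i z) \<in> M"
    using insert assms(1) by (auto simp: complex_subspace_def)
  then have "(\<lambda>z. c x * F x z + (\<Sum>i\<in>I. c i * F i z)) \<in> M"
    by (rule add)
  then show ?case using insert by simp
qed

text \<open>Vanishing of the first \<open>N\<close> Taylor coefficients is \<open>N\<close> linear
  conditions, so \<open>N + 1\<close> independent elements have a nonzero combination that satisfies
  them. The factor \<open>k\<close> normalises it.\<close>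

lemma high_order_element:
  assumes M: "M \<subseteq> hardy p" "complex_subspace M" "infinite_dimensional M" and p: "p > 0"
  obtains f h where "f \<in> M" "hpow p f = 1" "h holomorphic_on ball 0 1" "\<And>z. f z = z ^ N * h z"
proof -
  obtain F :: "nat \<Rightarrow> complex \<Rightarrow> complex" where F: "\<And>i. i < Suc N \<Longrightarrow> F i \<in> M"
    and ind: "\<And>c. (\<lambda>z. \<Sum>i<Suc N. c i * F i z) = (\<lambda>z. 0) \<Longrightarrow> \<forall>i<Suc N. c i = 0"
    using M(3) unfolding infinite_dimensional_def by metis
  obtain c where c: "\<exists>i<Suc N. c i \<noteq> 0" "\<And>j. j < N \<Longrightarrow> (\<Sum>i<Suc N. c i * (zero_quot ^^ j) (F i) 0) = 0"
    using homogeneous_system_nontrivial[of "{..<Suc N}" N "\<lambda>i j. (zero_quot ^^ j) (F i) 0"] by auto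
  define f where "f = (\<lambda>z. \<Sum>i<Suc N. c i * F i z)"
  have fM: "f \<in> M" unfolding f_def by (rule complex_subspace_sum[OF M(2)]) (use F in auto)
  have fH: "f \<in> hardy p" using fM M(1) by blast
  have hol: "F i holomorphic_on ball 0 1" if "i \<in> {..<Suc N}" for i using F[of i] M(1) that by (auto intro: hardyD(1))
  have z: "(zero_quot ^^ j) f 0 = 0" if "j < N" for j
  proof -
    have "(zero_quot ^^ j) f = (\<lambda>z. \<Sum>i<Suc N. c i * (zero_quot ^^ j) (F i) z)"
      unfolding f_def by (rule zero_quot_funpow_sum) (use hol in auto)
    then show ?thesis using c(2)[OF that] by simp
  qed
  have f: "f z = z ^ N * (zero_quot ^^ N) f z" for z
    using zero_quot_expansion[of f z N] z by simp
  have "f \<noteq> (\<lambda>z. 0)" using ind[of c] c(1) unfolding f_def by blast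
  then have h0: "hpow p f > 0" using hpow_eq_0[OF fH p] not_le by blast
  define k where "k = complex_of_real ((1 / hpow p f) powr (1/p))"
  have k: "norm k powr p = 1 / hpow p f" using h0 p by (simp add: k_def powr_powr)
  show ?thesis
  proof (rule that)
    show "(\<lambda>z. k * f z) \<in> M" using fM M(2) by (auto simp: complex_subspace_def)
    show "hpow p (\<lambda>z. k * f z) = 1" using hardy_scale(2)[OF fH p, of k] k h0 by simp
    show "(\<lambda>z. k * (zero_quot ^^ N) f z) holomorphic_on ball 0 1"
      by (intro holomorphic_intros holomorphic_zero_quot_funpow hardyD(1)[OF fH])
    show "k * f z = z ^ N * (k * (zero_quot ^^ N) f z)" for z by (subst f) simp
  qed
qed

subsection \<open>Almost disjoint sequences\<close>

text \<open>With \<open>Y\<close> the largest of the numbers 2^(n + 1) y n, each y n is at most Y /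
  2^(n + 1), so their sum is at most \<open>Y\<close>. The constants do not depend on
  \<open>N\<close>, and the growing weights are later outweighed by the choice of the
  errors.\<close>

lemma powr_sum_le_weighted:
  fixes y :: "nat \<Rightarrow> real"
  assumes y: "\<And>n. n < N \<Longrightarrow> 0 \<le> y n" and p: "p > 0"
  shows "(\<Sum>n<N. y n) powr p \<le> (\<Sum>n<N. 2 powr (real (n + 1) * p) * y n powr p)"
proof (cases "N = 0")
  case False
  define Y where "Y = Max ((\<lambda>n. 2 ^ (n + 1) * y n) ` {..<N})"
  have "Y \<in> (\<lambda>n. 2 ^ (n + 1) * y n) ` {..<N}" unfolding Y_def by (rule Max_in) (use False in auto)
  then obtain m where m: "m < N" "Y = 2 ^ (m + 1) * y m" by blast
  have le: "y n \<le> (1/2) ^ (n + 1) * Y" if "n < N" for n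
  proof -
    have "2 ^ (n + 1) * y n \<le> Y" unfolding Y_def using that by (intro Max_ge) auto
    then show ?thesis by (simp add: field_simps)
  qed
  have Y0: "Y \<ge> 0" using m y[of m] by simp
  have geo: "(\<Sum>n<k. (1/2::real) ^ (n + 1)) \<le> 1" for k
  proof -
    have "(\<Sum>n<k. (1/2::real) ^ (n + 1)) = 1 - (1/2) ^ k" by (induction k) (auto simp: field_simps)
    then show ?thesis by simp
  qed
  have "(\<Sum>n<N. y n) \<le> (\<Sum>n<N. (1/2) ^ (n + 1)) * Y"
    unfolding sum_distrib_right by (intro sum_mono le) auto
  also have "\<dots> \<le> 1 * Y" by (intro mult_right_mono geo Y0)
  finally have "(\<Sum>n<N. y n) powr p \<le> Y powr p" using y p by (intro powr_mono2 sum_nonneg) auto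
  also have "Y powr p = 2 powr (real (m + 1) * p) * y m powr p"
  proof -
    have "(2::real) ^ (m + 1) = 2 powr real (m + 1)" by (rule powr_realpow[symmetric]) simp
    then show ?thesis unfolding m(2) using y[OF m(1)] by (simp only: powr_mult powr_powr)
  qed
  also have "\<dots> \<le> (\<Sum>n<N. 2 powr (real (n + 1) * p) * y n powr p)"
    using m(1) by (intro member_le_sum) auto
  finally show ?thesis .
qed (use p in simp)

text \<open>If \<open>k\<close> is the last index with \<open>|x k| \<ge> \<delta> k\<close>, then the other terms are small: those after \<open>k\<close>
  are below their threshold, and those before \<open>k\<close> are weighted by \<open>\<psi> k \<ge> 1\<close>.\<close>
lemma almost_disjoint_pointwise:
  fixes x a :: "nat \<Rightarrow> complex" and \<delta> \<psi> :: "nat \<Rightarrow> real"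
  assumes p: "p > 0" and \<psi>: "\<And>n. n < N \<Longrightarrow> 0 \<le> \<psi> n" "\<And>n. n < N \<Longrightarrow> \<delta> n \<le> norm (x n) \<Longrightarrow> 1 \<le> \<psi> n"
    and d: "\<And>n. n < N \<Longrightarrow> d n = \<delta> n powr p + (\<Sum>m\<in>{n<..<N}. \<psi> m * norm (x n) powr p)"
    and D: "D = (\<Sum>n<N. norm (a n) powr p * (2 powr (real (n + 1) * p) * d n))"
  shows "norm (\<Sum>n<N. a n * x n) powr p \<le> 2 powr p * ((\<Sum>n<N. norm (a n) powr p * norm (x n) powr p) + D)"
    and "(\<Sum>n<N. norm (a n) powr p * norm (x n) powr p) \<le> 2 powr p * norm (\<Sum>n<N. a n * x n) powr p + (2 powr p + 1) * D"
proof -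
  define S where "S = {n. n < N \<and> \<delta> n \<le> norm (x n)}"
  \<comment> \<open>The value \<open>N\<close> means that no term reaches its threshold. Then there
    is no leading term, and \<open>b\<close> below is 0.\<close>
  define k where "k = (if S = {} then N else Max S)"
  have finS: "finite S" by (simp add: S_def)
  have dn: "norm (x n) powr p \<le> d n" if n: "n < N" "n \<noteq> k" for n
  proof (cases "n \<in> S")
    case True
    then have kS: "k \<in> S" "n \<le> k" using finS Max_in[OF finS] by (auto simp: k_def)
    then have nk: "n < k" "k < N" "1 \<le> \<psi> k" using n \<psi>(2) by (auto simp: S_def)
    have "1 * norm (x n) powr p \<le> \<psi> k * norm (x n) powr p" using nk by (intro mult_right_mono) auto
    also have "\<dots> \<le> (\<Sum>m\<in>{n<..<N}. \<psi> m * norm (x n) powr p)"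
      using nk \<psi>(1) by (intro member_le_sum[of k "{n<..<N}" "\<lambda>m. \<psi> m * norm (x n) powr p"]) auto
    finally show ?thesis unfolding d[OF n(1)] by (simp add: add_increasing)
  next
    case False
    then have "norm (x n) powr p \<le> \<delta> n powr p" using n p by (intro powr_mono2) (auto simp: S_def)
    also have "\<dots> \<le> d n" unfolding d[OF n(1)] using \<psi>(1) by (auto intro!: add_increasing2 sum_nonneg)
    finally show ?thesis .
  qed
  have d0: "d n \<ge> 0" if "n < N" for n
    unfolding d[OF that] using \<psi>(1) by (auto intro!: add_nonneg_nonneg sum_nonneg)
  have D0: "D \<ge> 0" unfolding D using d0 by (auto intro!: sum_nonneg)
  define y where "y n = (if n = k then 0 else norm (a n) * norm (x n))" for n
  define E where "E = (\<Sum>n<N. y n)"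
  define b where "b = (if k < N then a k * x k else 0)"
  have E0: "E \<ge> 0" unfolding E_def y_def by (auto intro!: sum_nonneg)
  have "E powr p \<le> (\<Sum>n<N. 2 powr (real (n + 1) * p) * y n powr p)"
    unfolding E_def by (rule powr_sum_le_weighted) (auto simp: y_def p)
  also have "\<dots> \<le> D" unfolding D
  proof (intro sum_mono)
    fix n assume "n \<in> {..<N}"
    then have n: "n < N" by simp
    have "y n powr p \<le> norm (a n) powr p * d n"
    proof (cases "n = k")
      case False
      then show ?thesis using dn[OF n False] by (auto simp: y_def powr_mult intro: mult_left_mono)
    qed (use d0[OF n] in \<open>simp add: y_def\<close>)
    then have "2 powr (real (n + 1) * p) * y n powr p \<le> 2 powr (real (n + 1) * p) * (norm (a n) powr p * d n)"
      by (intro mult_left_mono) auto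
    then show "2 powr (real (n + 1) * p) * y n powr p \<le> norm (a n) powr p * (2 powr (real (n + 1) * p) * d n)"
      by (simp add: mult_ac)
  qed
  finally have ED: "E powr p \<le> D" .
  have diff: "norm ((\<Sum>n<N. a n * x n) - b) \<le> E"
  proof -
    have "(\<Sum>n<N. a n * x n) - b = (\<Sum>n<N. if n = k then 0 else a n * x n)"
    proof (cases "k < N")
      case True
      have "(\<Sum>n<N. a n * x n) = a k * x k + (\<Sum>n\<in>{..<N} - {k}. a n * x n)" using True by (intro sum.remove) auto
      also have "(\<Sum>n\<in>{..<N} - {k}. a n * x n) = (\<Sum>n<N. if n = k then 0 else a n * x n)"
        by (intro sum.mono_neutral_cong_left) auto
      finally show ?thesis using True by (simp add: b_def)
    qed (auto simp: b_def intro!: sum.cong)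
    also have "norm \<dots> \<le> (\<Sum>n<N. norm (if n = k then 0 else a n * x n))" by (rule norm_sum)
    also have "\<dots> = E" unfolding E_def y_def by (intro sum.cong) (auto simp: norm_mult)
    finally show ?thesis .
  qed
  have bterm: "norm b powr p \<le> (\<Sum>n<N. norm (a n) powr p * norm (x n) powr p)"
  proof (cases "k < N")
    case True
    have "norm b powr p = norm (a k) powr p * norm (x k) powr p" using True by (simp add: b_def norm_mult powr_mult)
    also have "\<dots> \<le> (\<Sum>n<N. norm (a n) powr p * norm (x n) powr p)"
      using True by (intro member_le_sum[of k "{..<N}" "\<lambda>n. norm (a n) powr p * norm (x n) powr p"]) auto
    finally show ?thesis .
  qed (use p in \<open>auto simp: b_def intro!: sum_nonneg\<close>)
  \<comment> \<open>The sum and its leading term \<open>b\<close> differ by at most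
    \<open>E\<close>. Used in both directions, this gives the upper and the lower estimate.\<close>
  have tri: "norm u powr p \<le> 2 powr p * (norm v powr p + E powr p)" if "norm (u - v) \<le> E" for u v :: complex
  proof -
    have "norm u \<le> norm v + norm (u - v)" by (rule norm_triangle_sub)
    then have "norm u powr p \<le> (norm v + E) powr p" using that p by (intro powr_mono2) auto
    also have "\<dots> \<le> 2 powr p * (norm v powr p + E powr p)" using E0 p by (intro add_powr_le) auto
    finally show ?thesis .
  qed
  have "norm (\<Sum>n<N. a n * x n) powr p \<le> 2 powr p * (norm b powr p + E powr p)" by (rule tri[OF diff])
  also have "\<dots> \<le> 2 powr p * ((\<Sum>n<N. norm (a n) powr p * norm (x n) powr p) + D)"
    using bterm ED by (intro mult_left_mono add_mono) auto
  finally show "norm (\<Sum>n<N. a n * x n) powr p \<le> 2 powr p * ((\<Sum>n<N. norm (a n) powr p * norm (x n) powr p) + D)" .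
  have "norm b powr p \<le> 2 powr p * (norm (\<Sum>n<N. a n * x n) powr p + E powr p)"
    by (rule tri) (use diff in \<open>simp add: norm_minus_commute\<close>)
  also have "\<dots> \<le> 2 powr p * (norm (\<Sum>n<N. a n * x n) powr p + D)"
    using ED by (intro mult_left_mono add_mono) auto
  finally have b2: "norm b powr p \<le> 2 powr p * (norm (\<Sum>n<N. a n * x n) powr p + D)" .
  have "(\<Sum>n<N. norm (a n) powr p * norm (x n) powr p) \<le> norm b powr p + D"
  proof -
    have one: "1 \<le> (2::real) powr (real (n + 1) * p)" for n using p by (intro ge_one_powr_ge_zero) auto
    have t: "norm (a n) powr p * norm (x n) powr p \<le> norm (a n) powr p * (2 powr (real (n + 1) * p) * d n)" if "n < N" "n \<noteq> k" for n
    proof (rule mult_left_mono)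
      show "norm (x n) powr p \<le> 2 powr (real (n + 1) * p) * d n"
        using dn[OF that] mult_right_mono[OF one d0[OF that(1)], of n] by simp
    qed simp
    have "(\<Sum>n<N. norm (a n) powr p * norm (x n) powr p) \<le>
      (\<Sum>n<N. (if n = k then norm b powr p else 0) + norm (a n) powr p * (2 powr (real (n + 1) * p) * d n))"
    proof (intro sum_mono)
      fix n assume "n \<in> {..<N}"
      then have n: "n < N" by simp
      show "norm (a n) powr p * norm (x n) powr p \<le> (if n = k then norm b powr p else 0) + norm (a n) powr p * (2 powr (real (n + 1) * p) * d n)"
        using t[OF n] n d0[OF n] by (auto simp: b_def norm_mult powr_mult)
    qed
    also have "\<dots> \<le> norm b powr p + D" unfolding D sum.distrib by (auto simp: sum.delta)
    finally show ?thesis .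
  qed
  then show "(\<Sum>n<N. norm (a n) powr p * norm (x n) powr p) \<le> 2 powr p * norm (\<Sum>n<N. a n * x n) powr p + (2 powr p + 1) * D"
    using b2 by (simp add: algebra_simps)
qed

text \<open>The pointwise estimate is averaged over circles. \<gamma> is chosen so that (2^p + 1)
  \<gamma> = c0/4. Half of the error allowed at index \<open>n\<close> goes to the threshold
  \<delta> n, the other half to the later terms, whose geometric weights sum to at most 1. As the
  bounds hold on every circle, the supremum is taken only at the end.\<close>

lemma almost_disjoint_hpow:
  fixes X :: "nat \<Rightarrow> complex \<Rightarrow> complex" and \<delta> :: "nat \<Rightarrow> real" and \<psi> :: "nat \<Rightarrow> complex \<Rightarrow> real"
  assumes p: "p > 0" and X: "\<And>n. X n \<in> hardy p" and c0: "c0 > 0" "\<And>n. c0 \<le> hpow p (X n)" and K0: "\<And>n. hpow p (X n) \<le> K0"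
    and \<gamma>: "\<gamma> = c0 / (4 * (2 powr p + 1))" and \<delta>: "\<And>n. \<delta> n = (\<gamma> / (2 * 2 powr (real (n + 1) * p))) powr (1/p)"
    and \<psi>: "\<And>n z. 0 \<le> \<psi> n z" "\<And>n z. \<delta> n \<le> norm (X n z) \<Longrightarrow> 1 \<le> \<psi> n z" "\<And>n r. r < 1 \<Longrightarrow> continuous_on (sphere 0 r) (\<psi> n)"
    and small: "\<And>n m r. n < m \<Longrightarrow> 0 \<le> r \<Longrightarrow> r < 1 \<Longrightarrow>
      cmean (\<lambda>z. \<psi> m z * norm (X n z) powr p) r \<le> \<gamma> / (2 * 2 powr (real (n + 1) * p)) * (1/2) ^ m"
  shows "hpow p (\<lambda>z. \<Sum>n<N. a n * X n z) \<le> 2 powr p * (K0 + \<gamma>) * (\<Sum>n<N. norm (a n) powr p)"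
    and "c0 / 2 * (\<Sum>n<N. norm (a n) powr p) \<le> 2 powr p * hpow p (\<lambda>z. \<Sum>n<N. a n * X n z)"
proof -
  define F where "F = (\<lambda>z. \<Sum>n<N. a n * X n z)"
  define A where "A = (\<Sum>n<N. norm (a n) powr p)"
  have A0: "A \<ge> 0" by (simp add: A_def sum_nonneg)
  have FH: "F \<in> hardy p" unfolding F_def by (rule hardy_sum) (use X p in auto)
  have g0: "\<gamma> > 0" using c0 by (simp add: \<gamma> add_pos_pos)
  define d where "d = (\<lambda>n z. \<delta> n powr p + (\<Sum>m\<in>{n<..<N}. \<psi> m z * norm (X n z) powr p))"
  define D where "D = (\<lambda>z. \<Sum>n<N. norm (a n) powr p * (2 powr (real (n + 1) * p) * d n z))"
  define T where "T = (\<lambda>z. \<Sum>n<N. norm (a n) powr p * norm (X n z) powr p)"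
  have pw: "norm (F z) powr p \<le> 2 powr p * (T z + D z)" "T z \<le> 2 powr p * norm (F z) powr p + (2 powr p + 1) * D z" for z
    using almost_disjoint_pointwise[OF p, of N "\<lambda>n. \<psi> n z" \<delta> "\<lambda>n. X n z" "\<lambda>n. d n z" "D z" a] \<psi>(1,2)
    unfolding F_def T_def d_def D_def by auto
  have geo: "(\<Sum>m\<in>{n<..<N}. (1/2::real) ^ m) \<le> 1" for n
  proof -
    have "(\<Sum>m\<in>{n<..<N}. (1/2::real) ^ m) \<le> (\<Sum>m\<in>{0<..<N+1}. (1/2::real) ^ m)" by (intro sum_mono2) auto
    also have "{0<..<N+1} = Suc ` {..<N}" by (auto simp: image_iff elim: lessE) (metis Suc_less_SucD Suc_pred' lessThan_iff)
    also have "(\<Sum>m\<in>Suc ` {..<N}. (1/2::real) ^ m) = (\<Sum>m<N. (1/2) ^ Suc m)" by (subst sum.reindex) (auto simp: o_def)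
    also have "\<dots> = 1 - (1/2) ^ N" by (induction N) (auto simp: field_simps)
    also have "\<dots> \<le> 1" by (simp only: diff_le_eq le_add_same_cancel1) simp
    finally show ?thesis .
  qed
  have cX: "continuous_on (sphere 0 r) (\<lambda>z. norm (X n z) powr p)" if "r < 1" for r n
    by (rule continuous_on_norm_powr[OF continuous_on_sphere_hardy[OF X that] p])
  have cF: "continuous_on (sphere 0 r) (\<lambda>z. norm (F z) powr p)" if "r < 1" for r
    by (rule continuous_on_norm_powr[OF continuous_on_sphere_hardy[OF FH that] p])
  have cd: "continuous_on (sphere 0 r) (d n)" if "r < 1" for r n
    unfolding d_def by (intro continuous_on_add continuous_on_const continuous_on_sum continuous_on_mult \<psi>(3) cX that)
  have cD: "continuous_on (sphere 0 r) D" if "r < 1" for r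
    unfolding D_def by (intro continuous_on_const continuous_on_sum continuous_on_mult cd that)
  have cT: "continuous_on (sphere 0 r) T" if "r < 1" for r
    unfolding T_def by (intro continuous_on_const continuous_on_sum continuous_on_mult cX that)
  have md: "2 powr (real (n + 1) * p) * cmean (d n) r \<le> \<gamma>" if r: "0 \<le> r" "r < 1" for n r
  proof -
    define b where "b = \<gamma> / (2 * 2 powr (real (n + 1) * p))"
    have b0: "b > 0" using g0 by (simp add: b_def)
    have "cmean (d n) r = cmean (\<lambda>z. \<delta> n powr p) r + cmean (\<lambda>z. \<Sum>m\<in>{n<..<N}. \<psi> m z * norm (X n z) powr p) r"
      unfolding d_def by (intro cmean_add continuous_on_const continuous_on_sum continuous_on_mult \<psi>(3) cX r)
    also have "cmean (\<lambda>z. \<Sum>m\<in>{n<..<N}. \<psi> m z * norm (X n z) powr p) r = (\<Sum>m\<in>{n<..<N}. cmean (\<lambda>z. \<psi> m z * norm (X n z) powr p) r)"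
      by (intro cmean_sum continuous_on_mult \<psi>(3) cX r) auto
    also have "\<dots> \<le> (\<Sum>m\<in>{n<..<N}. b * (1/2) ^ m)" unfolding b_def by (intro sum_mono small r) auto
    also have "\<dots> \<le> b * 1" unfolding sum_distrib_left[symmetric] using b0 by (intro mult_left_mono geo) auto
    also have "cmean (\<lambda>z. \<delta> n powr p) r = b" using p b0 unfolding \<delta> b_def[symmetric] by (simp add: powr_powr)
    finally have "cmean (d n) r \<le> 2 * b" by simp
    then have "2 powr (real (n + 1) * p) * cmean (d n) r \<le> 2 powr (real (n + 1) * p) * (2 * b)" by (intro mult_left_mono) auto
    then show ?thesis by (simp add: b_def)
  qed
  have mD: "cmean D r \<le> \<gamma> * A" if r: "0 \<le> r" "r < 1" for r
  proof -
    have "cmean D r = (\<Sum>n<N. cmean (\<lambda>z. norm (a n) powr p * (2 powr (real (n + 1) * p) * d n z)) r)"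
      unfolding D_def by (intro cmean_sum continuous_on_const continuous_on_mult cd r) auto
    also have "\<dots> = (\<Sum>n<N. norm (a n) powr p * (2 powr (real (n + 1) * p) * cmean (d n) r))"
      by (simp only: cmean_cmult)
    also have "\<dots> \<le> (\<Sum>n<N. norm (a n) powr p * \<gamma>)" by (intro sum_mono mult_left_mono md r) auto
    finally show ?thesis by (simp add: A_def sum_distrib_left mult.commute)
  qed
  have mT: "cmean T r = (\<Sum>n<N. norm (a n) powr p * cmean (\<lambda>z. norm (X n z) powr p) r)" if r: "0 \<le> r" "r < 1" for r
  proof -
    have "cmean T r = (\<Sum>n<N. cmean (\<lambda>z. norm (a n) powr p * norm (X n z) powr p) r)"
      unfolding T_def by (intro cmean_sum continuous_on_const continuous_on_mult cX r) auto
    then show ?thesis by (simp only: cmean_cmult)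
  qed
  have "cmean (\<lambda>z. norm (F z) powr p) r \<le> 2 powr p * (K0 + \<gamma>) * A" if r: "0 \<le> r" "r < 1" for r
  proof -
    have "cmean (\<lambda>z. norm (F z) powr p) r \<le> cmean (\<lambda>z. 2 powr p * (T z + D z)) r"
      by (intro cmean_mono cF continuous_on_mult continuous_on_const continuous_on_add cT cD r pw)
    also have "\<dots> = 2 powr p * (cmean T r + cmean D r)"
      by (simp only: cmean_cmult cmean_add[OF cT[OF r(2)] cD[OF r(2)] r(1)])
    also have "\<dots> \<le> 2 powr p * (K0 * A + \<gamma> * A)"
    proof (intro mult_left_mono add_mono mD r)
      have "cmean T r \<le> (\<Sum>n<N. norm (a n) powr p * K0)"
        unfolding mT[OF r] by (intro sum_mono mult_left_mono order_trans[OF hardyD(4)[OF X r] K0]) auto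
      then show "cmean T r \<le> K0 * A" by (simp add: A_def sum_distrib_left mult.commute)
    qed auto
    finally show ?thesis by (simp add: algebra_simps)
  qed
  then have "hpow p F \<le> 2 powr p * (K0 + \<gamma>) * A" using hardyI(2)[OF hardyD(1)[OF FH] hardyD(2)[OF FH]] by blast
  then show "hpow p (\<lambda>z. \<Sum>n<N. a n * X n z) \<le> 2 powr p * (K0 + \<gamma>) * (\<Sum>n<N. norm (a n) powr p)"
    unfolding F_def A_def .
  \<comment> \<open>The norms are suprema that different terms may approach at different radii. For
    finitely many terms the largest of these radii serves all, by monotonicity. Of the 3/4 c0
    obtained there, c0/4 is lost to the error.\<close>
  have "\<exists>r. 0 \<le> r \<and> r < 1 \<and> 3/4 * c0 \<le> cmean (\<lambda>z. norm (X n z) powr p) r" for n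
  proof -
    have "3/4 * c0 < hpow p (X n)" using c0(1) c0(2)[of n] by simp
    then have "\<exists>x\<in>(cmean (\<lambda>z. norm (X n z) powr p)) ` {0..<1}. 3/4 * c0 < x"
      unfolding hpow_def by (intro less_cSupD hardyD(3)[OF X]) auto
    then show ?thesis by (auto intro: less_imp_le)
  qed
  then obtain \<rho> where \<rho>: "\<And>n. 0 \<le> \<rho> n" "\<And>n. \<rho> n < 1" "\<And>n. 3/4 * c0 \<le> cmean (\<lambda>z. norm (X n z) powr p) (\<rho> n)" by metis
  define r where "r = Max (insert 0 (\<rho> ` {..<N}))"
  have r: "0 \<le> r" "r < 1" and rn: "\<And>n. n < N \<Longrightarrow> \<rho> n \<le> r" using \<rho>(2) by (auto simp: r_def)
  have "3/4 * c0 * A \<le> cmean T r"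
  proof -
    have "3/4 * c0 * A = (\<Sum>n<N. norm (a n) powr p * (3/4 * c0))" by (simp add: A_def sum_distrib_left mult_ac)
    also have "\<dots> \<le> cmean T r" unfolding mT[OF r]
    proof (intro sum_mono mult_left_mono)
      fix n assume "n \<in> {..<N}"
      then show "3/4 * c0 \<le> cmean (\<lambda>z. norm (X n z) powr p) r"
        using cmean_norm_powr_mono[OF hardyD(1)[OF X] p \<rho>(1) rn r(2), of n n] \<rho>(3)[of n] by simp
    qed simp
    finally show ?thesis .
  qed
  also have "\<dots> \<le> cmean (\<lambda>z. 2 powr p * norm (F z) powr p + (2 powr p + 1) * D z) r"
    by (intro cmean_mono cF continuous_on_mult continuous_on_const continuous_on_add cT cD r pw)
  also have "\<dots> = 2 powr p * cmean (\<lambda>z. norm (F z) powr p) r + (2 powr p + 1) * cmean D r"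
  proof -
    have "cmean (\<lambda>z. 2 powr p * norm (F z) powr p + (2 powr p + 1) * D z) r =
       cmean (\<lambda>z. 2 powr p * norm (F z) powr p) r + cmean (\<lambda>z. (2 powr p + 1) * D z) r"
      by (intro cmean_add cF continuous_on_mult continuous_on_const cD r)
    then show ?thesis by (simp only: cmean_cmult)
  qed
  also have "\<dots> \<le> 2 powr p * hpow p F + (2 powr p + 1) * (\<gamma> * A)"
    by (intro add_mono mult_left_mono hardyD(4)[OF FH] mD r) auto
  also have "(2 powr p + 1) * (\<gamma> * A) = c0 / 4 * A"
  proof -
    have "(2 powr p + 1) \<noteq> (0::real)" using powr_gt_zero[of 2 p] by linarith
    then show ?thesis unfolding \<gamma> by (simp add: field_simps)
  qed
  finally show "c0 / 2 * (\<Sum>n<N. norm (a n) powr p) \<le> 2 powr p * hpow p (\<lambda>z. \<Sum>n<N. a n * X n z)"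
    unfolding F_def A_def by simp
qed

section \<open>Inductive selection of the sequence\<close>

lemma volterra_sum:
  fixes f :: "nat \<Rightarrow> complex \<Rightarrow> complex"
  assumes "\<And>n. n < N \<Longrightarrow> f n holomorphic_on ball 0 1" "g holomorphic_on ball 0 1"
  shows "volterra g (\<lambda>z. \<Sum>n<N. a n * f n z) = (\<lambda>z. \<Sum>n<N. a n * volterra g (f n) z)"
proof
  fix z
  show "volterra g (\<lambda>z. \<Sum>n<N. a n * f n z) z = (\<Sum>n<N. a n * volterra g (f n) z)"
  proof (cases "z \<in> ball 0 1")
    case True
    have sub: "(\<lambda>t::real. of_real t * z) ` {0..1} \<subseteq> ball 0 1"
    proof (intro image_subsetI)
      fix t :: real assume "t \<in> {0..1}"
      then have "t * norm z \<le> 1 * norm z" by (intro mult_right_mono) auto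
      then show "of_real t * z \<in> ball 0 1" using True \<open>t \<in> {0..1}\<close> by (simp add: norm_mult)
    qed
    have c: "continuous_on {0..1} (\<lambda>t::real. h (of_real t * z))" if "h holomorphic_on ball 0 1" for h
      by (rule continuous_on_compose2[OF holomorphic_on_imp_continuous_on[OF that] _ sub]) (intro continuous_intros)
    have cg: "continuous_on {0..1} (\<lambda>t::real. deriv g (of_real t * z))" by (intro c holomorphic_deriv assms(2) open_ball)
    have i: "(\<lambda>t::real. f n (of_real t * z) * deriv g (of_real t * z) * z) integrable_on {0..1}" if "n < N" for n
      by (intro integrable_continuous_real continuous_on_mult continuous_on_const cg c assms(1) that)
    have "integral {0..1} (\<lambda>t::real. (\<Sum>n<N. a n * f n (of_real t * z)) * deriv g (of_real t * z) * z) =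
       integral {0..1} (\<lambda>t::real. \<Sum>n<N. a n * (f n (of_real t * z) * deriv g (of_real t * z) * z))"
      by (simp only: sum_distrib_right mult.assoc)
    also have "\<dots> = (\<Sum>n<N. integral {0..1} (\<lambda>t::real. a n * (f n (of_real t * z) * deriv g (of_real t * z) * z)))"
      by (intro integral_sum finite_lessThan integrable_on_mult_right i) simp
    also have "\<dots> = (\<Sum>n<N. a n * integral {0..1} (\<lambda>t::real. f n (of_real t * z) * deriv g (of_real t * z) * z))"
      by (simp only: integral_mult_right)
    finally show ?thesis using True unfolding volterra_def by (simp only: if_True)
  qed (auto simp: volterra_def)
qed

text \<open>The weight is a continuous stand-in for the indicator of the set where the new image is
  at least \<delta>. By Chebyshev's inequality its mean is small on every circle once the image is
  small in H^q. Uniform integrability of the finitely many earlier functions then makes their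
  weighted means small.\<close>

lemma almost_disjoint_step:
  fixes Y :: "nat \<Rightarrow> complex \<Rightarrow> complex" and b :: "nat \<Rightarrow> real"
  assumes g: "g holomorphic_on ball 0 1" "bmoa_bound g B" and p: "p \<ge> 1" and q: "q = 2 * p / (p + 2)"
    and M: "M \<subseteq> hardy p" "complex_subspace M" "infinite_dimensional M"
    and Y: "\<And>k. k < n \<Longrightarrow> Y k \<in> hardy p" and b: "\<And>k. k < n \<Longrightarrow> b k > 0" and \<delta>: "\<delta> > 0"
  shows "\<exists>\<phi>. \<phi> \<in> M \<and> hpow p \<phi> = 1 \<and> (\<forall>k<n. \<forall>r. 0 \<le> r \<longrightarrow> r < 1 \<longrightarrow>
     cmean (\<lambda>z. min 1 ((norm (volterra g \<phi> z) / \<delta>) powr q) * norm (Y k z) powr p) r \<le> b k)"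
proof -
  have q0: "q > 0" using p by (simp add: q)
  have p0: "p > 0" using p by simp
  \<comment> \<open>The guard \<open>k < n\<close> makes the existence statement true for all
    \<open>k\<close>, as the choice of the constants requires.\<close>
  define Q where "Q k C \<longleftrightarrow> (k < n \<longrightarrow> C \<ge> 0 \<and> (\<forall>R \<psi>. 0 \<le> R \<longrightarrow> R < 1 \<longrightarrow> continuous_on (sphere 0 R) \<psi> \<longrightarrow>
     (\<forall>z. norm z = R \<longrightarrow> 0 \<le> \<psi> z \<and> \<psi> z \<le> 1) \<longrightarrow> cmean (\<lambda>z. \<psi> z * norm (Y k z) powr p) R \<le> C * cmean \<psi> R + b k / 2))"
    for k and C :: real
  have ex: "\<exists>C. Q k C" for k
  proof (cases "k < n")
    case True
    then have "b k / 2 > 0" using b by simp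
    note bk = this
    show ?thesis
    proof (rule hardy_uniformly_integrable[OF hardyD(1)[OF Y[OF True]] p0 hardyD(3)[OF Y[OF True]] bk])
      fix C :: real
      assume 1: "C \<ge> 0" and 2: "\<And>R \<psi>. 0 \<le> R \<Longrightarrow> R < 1 \<Longrightarrow> continuous_on (sphere 0 R) \<psi> \<Longrightarrow>
        (\<And>z. norm z = R \<Longrightarrow> 0 \<le> \<psi> z \<and> \<psi> z \<le> 1) \<Longrightarrow> cmean (\<lambda>z. \<psi> z * norm (Y k z) powr p) R \<le> C * cmean \<psi> R + b k / 2"
      show ?thesis unfolding Q_def by (intro exI[of _ C] impI conjI allI 1 2) auto
    qed
  qed (auto simp: Q_def)
  obtain C where C': "\<And>k. Q k (C k)" using choice[of Q] ex by blast
  have C: "C k \<ge> 0" if "k < n" for k using C'[of k] that unfolding Q_def by blast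
  have UI: "cmean (\<lambda>z. \<psi> z * norm (Y k z) powr p) R \<le> C k * cmean \<psi> R + b k / 2"
    if "k < n" "0 \<le> R" "R < 1" "continuous_on (sphere 0 R) \<psi>" "\<And>z. norm z = R \<Longrightarrow> 0 \<le> \<psi> z \<and> \<psi> z \<le> 1" for k R \<psi>
    using C'[of k] that unfolding Q_def by blast
  \<comment> \<open>One divisor that brings every C k below b k / 2. The 1 keeps it positive when n
    = 0. The choice of \<epsilon> below makes the mean of the weight at most 1 / s.\<close>
  define s where "s = 1 + (\<Sum>k<n. C k / (b k / 2))"
  have s0: "s > 0" unfolding s_def using C b by (intro add_pos_nonneg sum_nonneg divide_nonneg_pos) auto
  have Cs: "C k / s \<le> b k / 2" if "k < n" for k
  proof -
    have "C k / (b k / 2) \<le> (\<Sum>k<n. C k / (b k / 2))"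
      using that C b by (intro member_le_sum[of k "{..<n}" "\<lambda>k. C k / (b k / 2)"] divide_nonneg_pos) auto
    then have "C k / (b k / 2) \<le> s" by (simp add: s_def)
    then show ?thesis using s0 b[OF that] by (simp add: field_simps)
  qed
  define \<epsilon> where "\<epsilon> = \<delta> powr q / s"
  have e0: "\<epsilon> > 0" using \<delta> s0 by (simp add: \<epsilon>_def)
  obtain N where N: "\<And>f h r. f \<in> hardy p \<Longrightarrow> hpow p f \<le> 1 \<Longrightarrow> h holomorphic_on ball 0 1 \<Longrightarrow>
    (\<And>z. z \<in> ball 0 1 \<Longrightarrow> f z = z ^ N * h z) \<Longrightarrow> 0 \<le> r \<Longrightarrow> r < 1 \<Longrightarrow> cmean (\<lambda>z. norm (volterra g f z) powr q) r \<le> \<epsilon>"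
    using volterra_small_high_order[OF g p q e0] by metis
  obtain \<phi> h where \<phi>: "\<phi> \<in> M" "hpow p \<phi> = 1" "h holomorphic_on ball 0 1" "\<And>z. \<phi> z = z ^ N * h z"
    using high_order_element[OF M p0] by metis
  have \<phi>H: "\<phi> \<in> hardy p" using \<phi>(1) M(1) by blast
  have small: "cmean (\<lambda>z. norm (volterra g \<phi> z) powr q) r \<le> \<epsilon>" if "0 \<le> r" "r < 1" for r
    using N[OF \<phi>H _ \<phi>(3) \<phi>(4) that] \<phi>(2) by simp
  define \<psi> where "\<psi> = (\<lambda>z. min 1 ((norm (volterra g \<phi> z) / \<delta>) powr q))"
  have main: "cmean (\<lambda>z. \<psi> z * norm (Y k z) powr p) r \<le> b k" if k: "k < n" and r: "0 \<le> r" "r < 1" for k r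
  proof -
    have cV: "continuous_on (sphere 0 r) (volterra g \<phi>)"
      by (rule continuous_on_sphere_comp[OF volterra_primitive(1)[OF hardyD(1)[OF \<phi>H] g(1)] r(2)])
    have eq: "(norm w / \<delta>) powr q = inverse (\<delta> powr q) * norm w powr q" for w :: complex
    proof -
      have "(norm w / \<delta>) powr q = norm w powr q / \<delta> powr q" using \<delta> by (simp add: powr_divide)
      then show ?thesis by (simp add: divide_inverse mult.commute)
    qed
    have cW: "continuous_on (sphere 0 r) (\<lambda>z. inverse (\<delta> powr q) * norm (volterra g \<phi> z) powr q)"
      by (intro continuous_on_mult continuous_on_const continuous_on_norm_powr cV q0)
    have c\<psi>: "continuous_on (sphere 0 r) \<psi>" unfolding \<psi>_def eq
      by (intro continuous_on_min continuous_on_const cW)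
    have "cmean \<psi> r \<le> cmean (\<lambda>z. inverse (\<delta> powr q) * norm (volterra g \<phi> z) powr q) r"
      by (intro cmean_mono c\<psi> cW r) (simp add: \<psi>_def eq)
    also have "\<dots> \<le> inverse (\<delta> powr q) * \<epsilon>" unfolding cmean_cmult by (intro mult_left_mono small r) auto
    also have "\<dots> = 1 / s" using \<delta> by (simp add: \<epsilon>_def)
    finally have m: "cmean \<psi> r \<le> 1 / s" .
    have "cmean (\<lambda>z. \<psi> z * norm (Y k z) powr p) r \<le> C k * cmean \<psi> r + b k / 2"
      by (rule UI[OF k r c\<psi>]) (auto simp: \<psi>_def)
    also have "\<dots> \<le> C k * (1 / s) + b k / 2" by (intro add_right_mono mult_left_mono m C k)
    also have "\<dots> \<le> b k"
    proof -
      have "C k * (1 / s) = C k / s" by simp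
      then show ?thesis using Cs[OF k] by linarith
    qed
    finally show ?thesis .
  qed
  show ?thesis by (intro exI[of _ \<phi>] conjI \<phi>(1,2)) (use main in \<open>simp add: \<psi>_def\<close>)
qed

lemma lp_sequence_in_subspace:
  assumes g: "g holomorphic_on ball 0 1" "bmoa_bound g B" and p: "p \<ge> 1"
    and M: "M \<subseteq> hardy p" "complex_subspace M" "infinite_dimensional M"
    and c0: "c0 > 0" and low: "\<And>f. f \<in> M \<Longrightarrow> c0 * hpow p f \<le> hpow p (volterra g f)"
  obtains f :: "nat \<Rightarrow> complex \<Rightarrow> complex" and A C :: real where "\<And>n. f n \<in> M" "A > 0" "C > 0"
    "\<And>N a. A * (\<Sum>n<N. norm (a n) powr p) \<le> hpow p (\<lambda>z. \<Sum>n<N. a n * f n z)"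
    "\<And>N a. hpow p (\<lambda>z. \<Sum>n<N. a n * f n z) \<le> C * (\<Sum>n<N. norm (a n) powr p)"
proof -
  have p0: "p > 0" using p by simp
  define q where "q = 2 * p / (p + 2)"
  have q0: "q > 0" using p by (simp add: q_def)
  obtain K where K: "K > 0" "\<And>f. f \<in> hardy p \<Longrightarrow> volterra g f \<in> hardy p \<and> hpow p (volterra g f) \<le> K * hpow p f"
    using volterra_bounded[OF g p] by metis
  define \<gamma> where "\<gamma> = c0 / (4 * (2 powr p + 1))"
  define b where "b = (\<lambda>k. \<gamma> / (2 * 2 powr (real (k + 1) * p)))"
  define \<delta> where "\<delta> = (\<lambda>n. b n powr (1/p))"
  have g0: "\<gamma> > 0" using c0 by (simp add: \<gamma>_def add_pos_pos)
  have b0: "b k > 0" for k using g0 by (simp add: b_def)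
  have d0: "\<delta> n > 0" for n using b0[of n] by (simp add: \<delta>_def)
  \<comment> \<open>The condition on the element of index \<open>n\<close> refers only to earlier
    ones, as well-founded choice demands. The factor (1/2)^n makes the errors that all later
    elements cause at one index summable.\<close>
  define P where "P = (\<lambda>(f::nat \<Rightarrow> complex \<Rightarrow> complex) n \<phi>. \<phi> \<in> M \<and> hpow p \<phi> = 1 \<and> (\<forall>k<n. \<forall>r. 0 \<le> r \<longrightarrow> r < 1 \<longrightarrow>
     cmean (\<lambda>z. min 1 ((norm (volterra g \<phi> z) / \<delta> n) powr q) * norm (volterra g (f k) z) powr p) r \<le> b k * (1/2) ^ n))"
  have "\<exists>f. \<forall>n. P f n (f n)"
  proof (rule dependent_wellorder_choice)
    show "P f x r = P g x r" if "\<And>y. y < x \<Longrightarrow> f y = g y" for r f g x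
      using that unfolding P_def by auto
    fix n and f :: "nat \<Rightarrow> complex \<Rightarrow> complex"
    assume IH: "\<And>k. k < n \<Longrightarrow> P f k (f k)"
    have Y: "volterra g (f k) \<in> hardy p" if "k < n" for k
      using IH[OF that] K(2) M(1) unfolding P_def by blast
    have b': "b k * (1/2) ^ n > 0" for k using b0 by simp
    show "\<exists>\<phi>. P f n \<phi>" unfolding P_def
      by (rule almost_disjoint_step[OF g p q_def M, where Y="\<lambda>k. volterra g (f k)" and b="\<lambda>k. b k * (1/2) ^ n"])
        (use Y b' d0 in auto)
  qed
  then obtain f where f: "\<And>n. P f n (f n)" by blast
  define X where "X = (\<lambda>n. volterra g (f n))"
  have fM: "f n \<in> M" "hpow p (f n) = 1" for n using f[of n] by (auto simp: P_def)
  have fH: "f n \<in> hardy p" for n using fM M(1) by blast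
  have X: "X n \<in> hardy p" "hpow p (X n) \<le> K" "c0 \<le> hpow p (X n)" for n
    using K(2)[OF fH[of n]] low[OF fM(1)[of n]] by (auto simp: X_def fM(2))
  define \<psi> where "\<psi> = (\<lambda>n z. min 1 ((norm (X n z) / \<delta> n) powr q))"
  have \<psi>: "0 \<le> \<psi> n z" "\<delta> n \<le> norm (X n z) \<Longrightarrow> 1 \<le> \<psi> n z" "r < 1 \<Longrightarrow> continuous_on (sphere 0 r) (\<psi> n)" for n z r
  proof -
    show "0 \<le> \<psi> n z" by (simp add: \<psi>_def)
    show "1 \<le> \<psi> n z" if "\<delta> n \<le> norm (X n z)"
      using that d0[of n] q0 by (auto simp: \<psi>_def intro!: ge_one_powr_ge_zero)
    show "continuous_on (sphere 0 r) (\<psi> n)" if "r < 1"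
      unfolding \<psi>_def using d0[of n] q0
      by (intro continuous_on_min continuous_on_const continuous_on_powr' continuous_on_divide continuous_on_norm
          continuous_on_sphere_hardy[OF X(1) that]) auto
  qed
  have small: "cmean (\<lambda>z. \<psi> m z * norm (X n z) powr p) r \<le> \<gamma> / (2 * 2 powr (real (n + 1) * p)) * (1/2) ^ m"
    if "n < m" "0 \<le> r" "r < 1" for n m r
    using f[of m] that unfolding P_def \<psi>_def X_def b_def by blast
  have Xsum: "volterra g (\<lambda>z. \<Sum>n<N. a n * f n z) = (\<lambda>z. \<Sum>n<N. a n * X n z)" for N :: nat and a
    unfolding X_def by (rule volterra_sum[OF hardyD(1)[OF fH] g(1)])
  have sumM: "(\<lambda>z. \<Sum>n<N. a n * f n z) \<in> M" for N :: nat and a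
    by (rule complex_subspace_sum[OF M(2)]) (use fM in auto)
  have dd: "\<delta> n = (\<gamma> / (2 * 2 powr (real (n + 1) * p))) powr (1/p)" for n by (simp add: \<delta>_def b_def)
  note AD = almost_disjoint_hpow[where \<delta>=\<delta> and \<psi>=\<psi>, OF p0 X(1) c0 X(3) X(2) \<gamma>_def dd]
  have AD1: "hpow p (\<lambda>z. \<Sum>n<N. a n * X n z) \<le> 2 powr p * (K + \<gamma>) * (\<Sum>n<N. norm (a n) powr p)" for N a
    by (rule AD(1), rule \<psi>(1), erule \<psi>(2), erule \<psi>(3), erule (2) small)
  have AD2: "c0 / 2 * (\<Sum>n<N. norm (a n) powr p) \<le> 2 powr p * hpow p (\<lambda>z. \<Sum>n<N. a n * X n z)" for N a
    by (rule AD(2), rule \<psi>(1), erule \<psi>(2), erule \<psi>(3), erule (2) small)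
  \<comment> \<open>Boundedness of the operator carries the lower estimate from the images back to
    \<open>f\<close>; the lower bound on \<open>M\<close> carries the upper one.\<close>
  show ?thesis
  proof (rule that[of f "c0 / (2 * 2 powr p * K)" "2 powr p * (K + \<gamma>) / c0"])
    show "f n \<in> M" for n by (rule fM)
    show "c0 / (2 * 2 powr p * K) > 0" "2 powr p * (K + \<gamma>) / c0 > 0" using c0 K g0 by auto
    fix N :: nat and a :: "nat \<Rightarrow> complex"
    let ?F = "\<lambda>z. \<Sum>n<N. a n * f n z" and ?A = "\<Sum>n<N. norm (a n) powr p"
    have FH: "?F \<in> hardy p" using sumM M(1) by blast
    have "hpow p (\<lambda>z. \<Sum>n<N. a n * X n z) \<le> K * hpow p ?F" using K(2)[OF FH] unfolding Xsum by blast
    then have "2 powr p * hpow p (\<lambda>z. \<Sum>n<N. a n * X n z) \<le> 2 powr p * (K * hpow p ?F)" by (intro mult_left_mono) auto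
    with AD2[of a N] have "c0 / 2 * ?A \<le> 2 powr p * (K * hpow p ?F)" by (rule order_trans)
    then show "c0 / (2 * 2 powr p * K) * ?A \<le> hpow p ?F" using K(1) by (simp add: field_simps)
    have "c0 * hpow p ?F \<le> 2 powr p * (K + \<gamma>) * ?A"
      using low[OF sumM] AD1[of a N] unfolding Xsum by (rule order_trans)
    then show "hpow p ?F \<le> 2 powr p * (K + \<gamma>) / c0 * ?A" using c0 by (simp add: field_simps)
  qed
qed

subsection \<open>Copies of the sequence space\<close>

lemma le_powr_inverse:
  assumes "x powr p \<le> b" "0 \<le> (x::real)" "p > 0"
  shows "x \<le> b powr (1/p)"
proof -
  have "x = (x powr p) powr (1/p)" using assms by (simp add: powr_powr)
  also have "\<dots> \<le> b powr (1/p)" using assms by (intro powr_mono2) auto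
  finally show ?thesis .
qed

lemma hpow_tendsto_0_iff:
  assumes "\<And>n. F n \<in> hardy p" "p > 0"
  shows "(\<lambda>n. hardy_norm p (F n)) \<longlonglongrightarrow> 0 \<longleftrightarrow> (\<lambda>n. hpow p (F n)) \<longlonglongrightarrow> 0"
proof
  assume "(\<lambda>n. hardy_norm p (F n)) \<longlonglongrightarrow> 0"
  then have "(\<lambda>n. hardy_norm p (F n) powr p) \<longlonglongrightarrow> 0"
    by (rule tendsto_zero_powrI[OF _ tendsto_const]) (use assms in \<open>auto simp: hardy_norm_eq\<close>)
  then show "(\<lambda>n. hpow p (F n)) \<longlonglongrightarrow> 0" using hardy_norm_powr[OF assms] by simp
next
  assume "(\<lambda>n. hpow p (F n)) \<longlonglongrightarrow> 0"
  then show "(\<lambda>n. hardy_norm p (F n)) \<longlonglongrightarrow> 0" unfolding hardy_norm_eq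
    by (rule tendsto_zero_powrI[OF _ tendsto_const]) (use assms hpow_nonneg[OF assms(1)] in auto)
qed

lemma hpow_diff_commute: "hpow p (\<lambda>z. f z - h z) = hpow p (\<lambda>z. h z - f z)"
  by (simp add: hpow_def norm_minus_commute)

lemma hardy_diff:
  assumes f: "f \<in> hardy p" and h: "h \<in> hardy p" and p: "p > 0"
  shows "(\<lambda>z. f z - h z) \<in> hardy p" and "hpow p (\<lambda>z. f z - h z) \<le> 2 powr p * (hpow p f + hpow p h)"
proof -
  have m: "(\<lambda>z. -1 * h z) \<in> hardy p" "hpow p (\<lambda>z. -1 * h z) = hpow p h"
    using hardy_scale[OF h p, of "-1"] by auto
  show "(\<lambda>z. f z - h z) \<in> hardy p" using hardy_add(1)[OF f m(1) p] by simp
  show "hpow p (\<lambda>z. f z - h z) \<le> 2 powr p * (hpow p f + hpow p h)" using hardy_add(2)[OF f m(1) p] m(2) by simp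
qed

lemma hpow_triangle:
  assumes f: "f \<in> hardy p" and h: "h \<in> hardy p" and k: "k \<in> hardy p" and p: "p > 0"
  shows "hpow p (\<lambda>z. f z - k z) \<le> 2 powr p * (hpow p (\<lambda>z. f z - h z) + hpow p (\<lambda>z. h z - k z))"
  using hardy_add(2)[OF hardy_diff(1)[OF f h p] hardy_diff(1)[OF h k p] p] by simp

lemma lp_space_lincomb:
  assumes x: "x \<in> lp_space p" and y: "y \<in> lp_space p" and p: "p > 0"
  shows "(\<lambda>n. a * x n + b * y n) \<in> lp_space p"
proof -
  have "summable (\<lambda>n. 2 powr p * (norm a powr p * norm (x n) powr p + norm b powr p * norm (y n) powr p))"
    using x y unfolding lp_space_def by (intro summable_mult summable_add) auto
  then have "summable (\<lambda>n. norm (a * x n + b * y n) powr p)"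
  proof (rule summable_comparison_test'[where N=0])
    fix n
    have "norm (a * x n + b * y n) powr p \<le> (norm (a * x n) + norm (b * y n)) powr p"
      using p by (intro powr_mono2 norm_triangle_ineq) auto
    also have "\<dots> \<le> 2 powr p * (norm (a * x n) powr p + norm (b * y n) powr p)" using p by (intro add_powr_le) auto
    finally show "norm (norm (a * x n + b * y n) powr p) \<le> 2 powr p * (norm a powr p * norm (x n) powr p + norm b powr p * norm (y n) powr p)"
      by (simp add: norm_mult powr_mult)
  qed
  then show ?thesis by (simp add: lp_space_def)
qed

text \<open>The hypotheses concern finite sums. They are extended to a map from all of l^p, bounded
  above and below, with closed range.\<close>

locale lp_basic_sequence =
  fixes p A B :: real and f :: "nat \<Rightarrow> complex \<Rightarrow> complex"
  assumes p: "p \<ge> 1" and fH: "\<And>n. f n \<in> hardy p" and AB: "A > 0" "B > 0"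
    and low: "\<And>N a. A * (\<Sum>n<N. norm (a n) powr p) \<le> hpow p (\<lambda>z. \<Sum>n<N. a n * f n z)"
    and upp: "\<And>N a. hpow p (\<lambda>z. \<Sum>n<N. a n * f n z) \<le> B * (\<Sum>n<N. norm (a n) powr p)"
begin

lemma p0: "p > 0" using p by simp

definition psum :: "(nat \<Rightarrow> complex) \<Rightarrow> nat \<Rightarrow> complex \<Rightarrow> complex" where
  "psum x k z = (\<Sum>n<k. x n * f n z)"

text \<open>The series is summed pointwise. Outside the disc all terms are 0, as representatives of
  H^p require.\<close>

definition synth :: "(nat \<Rightarrow> complex) \<Rightarrow> complex \<Rightarrow> complex" where
  "synth x z = (\<Sum>n. x n * f n z)"

definition tail :: "(nat \<Rightarrow> complex) \<Rightarrow> nat \<Rightarrow> real" where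
  "tail x k = (\<Sum>n. norm (x n) powr p) - (\<Sum>n<k. norm (x n) powr p)"

lemma psum_hardy: "psum x k \<in> hardy p"
  unfolding psum_def[abs_def] by (rule hardy_sum) (use fH p0 in auto)

context
  fixes x assumes x: "x \<in> lp_space p"
begin

lemma summable_x: "summable (\<lambda>n. norm (x n) powr p)" using x by (simp add: lp_space_def)

lemma tail_tendsto: "tail x \<longlonglongrightarrow> 0"
  using tendsto_diff[OF tendsto_const summable_LIMSEQ[OF summable_x], of "\<Sum>n. norm (x n) powr p"]
  by (simp add: tail_def[abs_def])

lemma block_le_tail:
  assumes "j \<le> k"
  shows "(\<Sum>n\<in>{j..<k}. norm (x n) powr p) \<le> tail x j"
proof -
  have "(\<Sum>n<k. norm (x n) powr p) = (\<Sum>n<j. norm (x n) powr p) + (\<Sum>n\<in>{j..<k}. norm (x n) powr p)"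
    using sum.atLeastLessThan_concat[of 0 j k "\<lambda>n. norm (x n) powr p"] assms by (simp add: lessThan_atLeast0)
  moreover have "(\<Sum>n<k. norm (x n) powr p) \<le> (\<Sum>n. norm (x n) powr p)"
    by (rule sum_le_suminf[OF summable_x]) auto
  ultimately show ?thesis by (simp add: tail_def)
qed

lemma tail_nonneg: "0 \<le> tail x j" using block_le_tail[of j j] by simp

lemma psum_diff:
  assumes "j \<le> k"
  shows "psum x k z - psum x j z = (\<Sum>n\<in>{j..<k}. x n * f n z)"
  using sum.atLeastLessThan_concat[of 0 j k "\<lambda>n. x n * f n z"] assms
  unfolding psum_def lessThan_atLeast0 by (simp add: eq_diff_eq diff_eq_eq add.commute)

lemma hpow_psum_diff:
  assumes "j \<le> k"
  shows "hpow p (\<lambda>z. psum x k z - psum x j z) \<le> B * tail x j"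
proof -
  define a where "a n = (if n < j then 0 else x n)" for n
  have "psum x k z - psum x j z = (\<Sum>n<k. a n * f n z)" for z
    unfolding psum_diff[OF assms] by (intro sum.mono_neutral_cong_left) (auto simp: a_def)
  then have "hpow p (\<lambda>z. psum x k z - psum x j z) \<le> B * (\<Sum>n<k. norm (a n) powr p)" using upp[where a=a and N=k] by simp
  also have "(\<Sum>n<k. norm (a n) powr p) = (\<Sum>n\<in>{j..<k}. norm (x n) powr p)"
    by (intro sum.mono_neutral_cong_right) (auto simp: a_def)
  also have "B * \<dots> \<le> B * tail x j" using AB block_le_tail[OF assms] by (intro mult_left_mono) auto
  finally show ?thesis .
qed

text \<open>Point evaluation turns the H^p bound on blocks starting at \<open>j\<close> into this
  bound, uniform on the closed disc of radius \<rho>.\<close>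

definition "pbound \<rho> j = (4 / (1 - \<rho>)\<^sup>2 * (B * tail x j)) powr (1/p)"

lemma pbound_tendsto: "pbound \<rho> \<longlonglongrightarrow> 0"
proof -
  have "(\<lambda>j. 4 / (1 - \<rho>)\<^sup>2 * (B * tail x j)) \<longlonglongrightarrow> 0" using tail_tendsto by (intro tendsto_mult_right_zero)
  then show ?thesis unfolding pbound_def[abs_def]
    by (rule tendsto_zero_powrI[OF _ tendsto_const]) (use AB tail_nonneg p0 in auto)
qed

lemma psum_diff_pointwise:
  assumes "j \<le> k" "norm z \<le> \<rho>" "\<rho> < 1"
  shows "norm (psum x k z - psum x j z) \<le> pbound \<rho> j"
  unfolding pbound_def
proof (rule le_powr_inverse)
  have z1: "norm z < 1" using assms by simp
  have "norm (psum x k z - psum x j z) powr p \<le> 4 / (1 - norm z)\<^sup>2 * hpow p (\<lambda>z. psum x k z - psum x j z)"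
    by (rule hardy_point_bound[OF hardy_diff(1)[OF psum_hardy psum_hardy p0] p0 z1])
  also have "\<dots> \<le> 4 / (1 - norm z)\<^sup>2 * (B * tail x j)" by (intro mult_left_mono hpow_psum_diff assms) auto
  also have "\<dots> \<le> 4 / (1 - \<rho>)\<^sup>2 * (B * tail x j)"
    using AB tail_nonneg assms by (intro mult_right_mono divide_left_mono power_mono mult_pos_pos zero_less_power) auto
  finally show "norm (psum x k z - psum x j z) powr p \<le> 4 / (1 - \<rho>)\<^sup>2 * (B * tail x j)" .
qed (use p0 in auto)

lemma summable_synth: "summable (\<lambda>n. x n * f n z)"
proof (cases "norm z < 1")
  case True
  show ?thesis unfolding summable_Cauchy
  proof (intro allI impI)
    fix e :: real assume e: "e > 0"
    then have "\<forall>\<^sub>F j in sequentially. pbound (norm z) j < e" using order_tendstoD(2)[OF pbound_tendsto] by blast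
    then obtain J where J: "\<And>j. j \<ge> J \<Longrightarrow> pbound (norm z) j < e" unfolding eventually_sequentially by blast
    have "norm (sum (\<lambda>n. x n * f n z) {m..<n}) < e" if "m \<ge> J" for m n
    proof (cases "m \<le> n")
      case mn: True
      show ?thesis using psum_diff_pointwise[OF mn order_refl True] J[OF that] psum_diff[OF mn, of z] by simp
    qed (use e in simp)
    then show "\<exists>N. \<forall>m\<ge>N. \<forall>n. norm (sum (\<lambda>n. x n * f n z) {m..<n}) < e" by blast
  qed
qed (use hardyD(2)[OF fH] in simp)

lemma psum_LIMSEQ: "(\<lambda>k. psum x k z) \<longlonglongrightarrow> synth x z"
  unfolding psum_def synth_def by (rule summable_LIMSEQ[OF summable_synth])

lemma synth_diff_pointwise:
  assumes "norm z \<le> \<rho>" "\<rho> < 1"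
  shows "norm (synth x z - psum x j z) \<le> pbound \<rho> j"
proof (rule LIMSEQ_le_const2)
  show "(\<lambda>k. norm (psum x k z - psum x j z)) \<longlonglongrightarrow> norm (synth x z - psum x j z)"
    by (intro tendsto_intros psum_LIMSEQ)
  show "\<exists>N. \<forall>n\<ge>N. norm (psum x n z - psum x j z) \<le> pbound \<rho> j" using psum_diff_pointwise assms by blast
qed

lemma synth_holomorphic: "synth x holomorphic_on ball 0 1"
proof (rule holomorphic_uniform_sequence[where f="psum x", OF open_ball])
  show "psum x n holomorphic_on ball 0 1" for n by (rule hardyD(1)[OF psum_hardy])
  fix z :: complex assume z: "z \<in> ball 0 1"
  define \<rho> where "\<rho> = (1 + norm z) / 2"
  have r: "norm z < \<rho>" "\<rho> < 1" using z by (auto simp: \<rho>_def)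
  have sub: "norm w \<le> \<rho>" if "w \<in> cball z (\<rho> - norm z)" for w
    using that norm_triangle_ineq2[of w z] by (auto simp: dist_norm norm_minus_commute)
  have "uniform_limit (cball z (\<rho> - norm z)) (psum x) (synth x) sequentially"
    unfolding uniform_limit_iff
  proof (intro allI impI)
    fix e :: real assume "e > 0"
    then have "\<forall>\<^sub>F j in sequentially. pbound \<rho> j < e" using order_tendstoD(2)[OF pbound_tendsto] by blast
    then show "\<forall>\<^sub>F j in sequentially. \<forall>w\<in>cball z (\<rho> - norm z). dist (psum x j w) (synth x w) < e"
    proof eventually_elim
      case (elim j)
      show ?case
      proof
        fix w assume "w \<in> cball z (\<rho> - norm z)"
        from synth_diff_pointwise[OF sub[OF this] r(2), of j] elim
        show "dist (psum x j w) (synth x w) < e" by (simp add: dist_norm norm_minus_commute)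
      qed
    qed
  qed
  moreover have "cball z (\<rho> - norm z) \<subseteq> ball 0 1" using sub r by force
  ultimately show "\<exists>d>0. cball z d \<subseteq> ball 0 1 \<and> uniform_limit (cball z d) (psum x) (synth x) sequentially"
    using r by (intro exI[of _ "\<rho> - norm z"]) auto
qed

text \<open>The limit is taken on each circle separately, where the partial sums converge uniformly.
  This plays the part of Fatou's lemma.\<close>

lemma synth_psum_hardy: "(\<lambda>z. synth x z - psum x j z) \<in> hardy p"
  and hpow_synth_psum: "hpow p (\<lambda>z. synth x z - psum x j z) \<le> 2 powr p * (B * tail x j)"
proof -
  have hol: "(\<lambda>z. synth x z - psum x j z) holomorphic_on ball 0 1"
    by (intro holomorphic_intros synth_holomorphic hardyD(1)[OF psum_hardy])
  have z: "synth x z - psum x j z = 0" if "z \<notin> ball 0 1" for z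
    using hardyD(2)[OF fH that] by (simp add: synth_def psum_def)
  have le: "cmean (\<lambda>z. norm (synth x z - psum x j z) powr p) r \<le> 2 powr p * (B * tail x j)" if r: "0 \<le> r" "r < 1" for r
  proof (rule LIMSEQ_le_const)
    have "(\<lambda>k. 2 powr p * (pbound r k powr p + B * tail x j)) \<longlonglongrightarrow> 2 powr p * (0 + B * tail x j)"
      by (intro tendsto_intros tendsto_zero_powrI[OF pbound_tendsto tendsto_const]) (use p0 in \<open>auto simp: pbound_def\<close>)
    then show "(\<lambda>k. 2 powr p * (pbound r k powr p + B * tail x j)) \<longlonglongrightarrow> 2 powr p * (B * tail x j)" by simp
    have "cmean (\<lambda>z. norm (synth x z - psum x j z) powr p) r \<le> 2 powr p * (pbound r k powr p + B * tail x j)" if k: "j \<le> k" for k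
    proof -
      have H: "(\<lambda>z. psum x k z - psum x j z) \<in> hardy p" by (rule hardy_diff(1)[OF psum_hardy psum_hardy p0])
      have c1: "continuous_on (sphere 0 r) (\<lambda>z. norm (psum x k z - psum x j z) powr p)"
        by (intro continuous_on_norm_powr continuous_on_sphere_hardy[OF H r(2)] p0)
      have "cmean (\<lambda>z. norm (synth x z - psum x j z) powr p) r \<le>
         cmean (\<lambda>z. 2 powr p * (pbound r k powr p + norm (psum x k z - psum x j z) powr p)) r"
      proof (intro cmean_mono r)
        show "continuous_on (sphere 0 r) (\<lambda>z. norm (synth x z - psum x j z) powr p)"
          by (intro continuous_on_norm_powr continuous_on_sphere_comp[OF hol r(2)] p0)
        show "continuous_on (sphere 0 r) (\<lambda>z. 2 powr p * (pbound r k powr p + norm (psum x k z - psum x j z) powr p))"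
          by (intro continuous_on_mult continuous_on_add continuous_on_const c1)
        fix z :: complex assume zr: "norm z = r"
        have "norm (synth x z - psum x j z) \<le> norm (synth x z - psum x k z) + norm (psum x k z - psum x j z)"
          by (rule norm_diff_triangle_le[OF order_refl order_refl])
        also have "norm (synth x z - psum x k z) \<le> pbound r k" using zr r by (intro synth_diff_pointwise) auto
        finally have "norm (synth x z - psum x j z) powr p \<le> (pbound r k + norm (psum x k z - psum x j z)) powr p"
          using p0 by (intro powr_mono2) auto
        also have "\<dots> \<le> 2 powr p * (pbound r k powr p + norm (psum x k z - psum x j z) powr p)"
          using p0 by (intro add_powr_le) (auto simp: pbound_def)
        finally show "norm (synth x z - psum x j z) powr p \<le> 2 powr p * (pbound r k powr p + norm (psum x k z - psum x j z) powr p)" .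
      qed
      also have "\<dots> = 2 powr p * (pbound r k powr p + cmean (\<lambda>z. norm (psum x k z - psum x j z) powr p) r)"
        by (simp only: cmean_cmult cmean_add[OF continuous_on_const c1 r(1)] cmean_const)
      also have "\<dots> \<le> 2 powr p * (pbound r k powr p + B * tail x j)"
        by (intro mult_left_mono add_left_mono order_trans[OF hardyD(4)[OF H r] hpow_psum_diff[OF k]]) auto
      finally show ?thesis .
    qed
    then show "\<exists>N. \<forall>n\<ge>N. cmean (\<lambda>z. norm (synth x z - psum x j z) powr p) r \<le> 2 powr p * (pbound r n powr p + B * tail x j)" by blast
  qed
  show "(\<lambda>z. synth x z - psum x j z) \<in> hardy p" by (rule hardyI(1)[OF hol z le])
  show "hpow p (\<lambda>z. synth x z - psum x j z) \<le> 2 powr p * (B * tail x j)" by (rule hardyI(2)[OF hol z le])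
qed

lemma synth_hardy: "synth x \<in> hardy p"
  and hpow_synth_le: "hpow p (synth x) \<le> 2 powr p * B * (\<Sum>n. norm (x n) powr p)"
proof -
  have e: "(\<lambda>z. synth x z - psum x 0 z) = synth x" unfolding psum_def lessThan_0 sum.empty diff_zero ..
  show "synth x \<in> hardy p" using synth_psum_hardy[of 0] unfolding e .
  have "tail x 0 = (\<Sum>n. norm (x n) powr p)" by (simp add: tail_def)
  then show "hpow p (synth x) \<le> 2 powr p * B * (\<Sum>n. norm (x n) powr p)"
    using hpow_synth_psum[of 0] unfolding e by (simp only: mult.assoc)
qed

text \<open>A partial sum is \<open>synth x\<close> minus an error that tends to 0, and the crude
  triangle inequality costs the factor 2^p.\<close>

lemma hpow_synth_ge: "A / 2 powr p * (\<Sum>n. norm (x n) powr p) \<le> hpow p (synth x)"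
proof -
  have "A * (\<Sum>n. norm (x n) powr p) \<le> 2 powr p * (0 + hpow p (synth x))"
  proof (rule LIMSEQ_le)
    show "(\<lambda>k. A * (\<Sum>n<k. norm (x n) powr p)) \<longlonglongrightarrow> A * (\<Sum>n. norm (x n) powr p)"
      by (intro tendsto_intros summable_LIMSEQ summable_x)
    have "(\<lambda>k. 2 powr p * (2 powr p * (B * tail x k) + hpow p (synth x))) \<longlonglongrightarrow> 2 powr p * (2 powr p * (B * 0) + hpow p (synth x))"
      by (intro tendsto_intros tail_tendsto)
    then show "(\<lambda>k. 2 powr p * (2 powr p * (B * tail x k) + hpow p (synth x))) \<longlonglongrightarrow> 2 powr p * (0 + hpow p (synth x))" by simp
    have "A * (\<Sum>n<k. norm (x n) powr p) \<le> 2 powr p * (2 powr p * (B * tail x k) + hpow p (synth x))" for k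
    proof -
      have "A * (\<Sum>n<k. norm (x n) powr p) \<le> hpow p (psum x k)" using low[where a=x and N=k] by (simp add: psum_def[abs_def])
      also have "\<dots> = hpow p (\<lambda>z. synth x z - (synth x z - psum x k z))" by simp
      also have "\<dots> \<le> 2 powr p * (hpow p (synth x) + hpow p (\<lambda>z. synth x z - psum x k z))"
        by (rule hardy_diff(2)[OF synth_hardy synth_psum_hardy p0])
      also have "\<dots> \<le> 2 powr p * (hpow p (synth x) + 2 powr p * (B * tail x k))"
        by (intro mult_left_mono add_left_mono hpow_synth_psum) auto
      finally show ?thesis by (simp add: add.commute)
    qed
    then show "\<exists>N. \<forall>n\<ge>N. A * (\<Sum>k<n. norm (x k) powr p) \<le> 2 powr p * (2 powr p * (B * tail x n) + hpow p (synth x))" by blast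
  qed
  then show ?thesis by (simp add: field_simps)
qed

lemma synth_in_closed_subspace:
  assumes "complex_subspace M" "hardy_closed p M" "\<And>n. f n \<in> M"
  shows "synth x \<in> M"
proof -
  have "psum x k \<in> M" for k
    unfolding psum_def[abs_def] by (rule complex_subspace_sum[OF assms(1)]) (use assms(3) in auto)
  moreover have "(\<lambda>k. hardy_norm p (\<lambda>z. psum x k z - synth x z)) \<longlonglongrightarrow> 0"
  proof (subst hpow_tendsto_0_iff)
    show H: "(\<lambda>z. psum x k z - synth x z) \<in> hardy p" for k by (rule hardy_diff(1)[OF psum_hardy synth_hardy p0])
    have "(\<lambda>k. 2 powr p * (B * tail x k)) \<longlonglongrightarrow> 2 powr p * (B * 0)" by (intro tendsto_intros tail_tendsto)
    then have lim: "(\<lambda>k. 2 powr p * (B * tail x k)) \<longlonglongrightarrow> 0" by simp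
    show "(\<lambda>k. hpow p (\<lambda>z. psum x k z - synth x z)) \<longlonglongrightarrow> 0"
    proof (rule real_tendsto_sandwich[OF _ _ tendsto_const lim])
      show "\<forall>\<^sub>F k in sequentially. 0 \<le> hpow p (\<lambda>z. psum x k z - synth x z)" using hpow_nonneg[OF H] by simp
      show "\<forall>\<^sub>F k in sequentially. hpow p (\<lambda>z. psum x k z - synth x z) \<le> 2 powr p * (B * tail x k)"
        unfolding hpow_diff_commute[of p "psum x _"] using hpow_synth_psum by simp
    qed
  qed (rule p0)
  ultimately show ?thesis using assms(2) synth_hardy unfolding hardy_closed_def by blast
qed

end

lemma synth_lincomb:
  assumes "x \<in> lp_space p" "y \<in> lp_space p"
  shows "synth (\<lambda>n. a * x n + b * y n) = (\<lambda>z. a * synth x z + b * synth y z)"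
proof
  fix z
  have "(\<lambda>n. a * (x n * f n z) + b * (y n * f n z)) sums (a * synth x z + b * synth y z)"
    unfolding synth_def using summable_sums[OF summable_synth[OF assms(1)]] summable_sums[OF summable_synth[OF assms(2)]]
    by (intro sums_add sums_mult)
  then show "synth (\<lambda>n. a * x n + b * y n) z = a * synth x z + b * synth y z"
    unfolding synth_def by (simp add: sums_iff algebra_simps)
qed

lemma synth_diff:
  assumes "x \<in> lp_space p" "y \<in> lp_space p"
  shows "(\<lambda>n. x n - y n) \<in> lp_space p" "synth (\<lambda>n. x n - y n) = (\<lambda>z. synth x z - synth y z)"
  using lp_space_lincomb[OF assms p0, of 1 "-1"] synth_lincomb[OF assms, of 1 "-1"] by simp_all

lemma hpow_synth_ge_partial:
  assumes "x \<in> lp_space p"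
  shows "(\<Sum>n<k. norm (x n) powr p) \<le> 2 powr p / A * hpow p (synth x)"
proof -
  have "(\<Sum>n<k. norm (x n) powr p) \<le> (\<Sum>n. norm (x n) powr p)"
    by (rule sum_le_suminf[OF summable_x[OF assms]]) auto
  also have "\<dots> \<le> 2 powr p / A * hpow p (synth x)" using hpow_synth_ge[OF assms] AB by (simp add: field_simps)
  finally show ?thesis .
qed

lemma inj_synth: "inj_on synth (lp_space p)"
proof
  fix x y assume xy: "x \<in> lp_space p" "y \<in> lp_space p" "synth x = synth y"
  note d = synth_diff[OF xy(1,2)]
  have "synth (\<lambda>n. x n - y n) = (\<lambda>z. 0)" using d(2) xy(3) by simp
  then have "(\<Sum>n<k. norm (x n - y n) powr p) \<le> 0" for k using hpow_synth_ge_partial[OF d(1), of k] hardy_zero by simp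
  note le = this
  show "x = y"
  proof
    fix n
    have "norm (x n - y n) powr p \<le> (\<Sum>i<Suc n. norm (x i - y i) powr p)" by (simp add: sum_nonneg)
    then have "norm (x n - y n) powr p \<le> 0" using le[of "Suc n"] by linarith
    then show "x n = y n" by simp
  qed
qed

text \<open>The lower estimate makes the coefficient sequences Cauchy in l^p. The limit is taken
  coordinatewise, and estimates on finitely many coordinates carry over to it. It lies in l^p as a
  difference of two members.\<close>

lemma closed_range: "hardy_closed p (synth ` lp_space p)"
  unfolding hardy_closed_def
proof (intro allI impI, elim conjE)
  fix F h
  assume F: "\<forall>n. F n \<in> synth ` lp_space p" and h: "h \<in> hardy p"
    and lim: "(\<lambda>n. hardy_norm p (\<lambda>z. F n z - h z)) \<longlonglongrightarrow> 0"
  from F obtain X where X: "\<And>n. X n \<in> lp_space p" "\<And>n. F n = synth (X n)" unfolding image_iff by metis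
  have FH: "F n \<in> hardy p" for n unfolding X(2) by (rule synth_hardy[OF X(1)])
  define e where "e n = hpow p (\<lambda>z. F n z - h z)" for n
  have e0: "e n \<ge> 0" for n unfolding e_def by (rule hpow_nonneg[OF hardy_diff(1)[OF FH h p0]])
  have elim: "e \<longlonglongrightarrow> 0"
    using lim hpow_tendsto_0_iff[of "\<lambda>n z. F n z - h z" p] hardy_diff(1)[OF FH h p0] p0 unfolding e_def by blast
  \<comment> \<open>The first factor comes from the lower estimate, the second 2^p from the triangle
    inequality through \<open>h\<close>.\<close>
  define c where "c = 2 powr p / A * 2 powr p"
  have c: "c > 0" using AB by (simp add: c_def)
  have part: "(\<Sum>i<k. norm (X n i - X m i) powr p) \<le> c * (e n + e m)" for k n m
  proof -
    have "(\<Sum>i<k. norm (X n i - X m i) powr p) \<le> 2 powr p / A * hpow p (\<lambda>z. F n z - F m z)"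
      using hpow_synth_ge_partial[OF synth_diff(1)[OF X(1) X(1)], of n m k] synth_diff(2)[OF X(1) X(1), of n m] by (simp add: X(2))
    also have "hpow p (\<lambda>z. F n z - F m z) \<le> 2 powr p * (e n + e m)"
      using hpow_triangle[OF FH[of n] h FH[of m] p0] unfolding e_def hpow_diff_commute[of p h] .
    finally show ?thesis using AB by (simp add: c_def mult_left_mono field_simps)
  qed
  have "Cauchy (\<lambda>n. X n i)" for i
  proof (rule metric_CauchyI)
    fix \<epsilon> :: real assume ep: "\<epsilon> > 0"
    have "(\<lambda>n. c * e n) \<longlonglongrightarrow> c * 0" by (intro tendsto_intros elim)
    then have "\<forall>\<^sub>F n in sequentially. c * e n < \<epsilon> powr p / 2" using ep by (intro order_tendstoD(2)) auto
    then obtain J where J: "\<And>n. n \<ge> J \<Longrightarrow> c * e n < \<epsilon> powr p / 2" unfolding eventually_sequentially by blast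
    have "dist (X m i) (X n i) < \<epsilon>" if "m \<ge> J" "n \<ge> J" for m n
    proof (rule ccontr)
      assume "\<not> ?thesis"
      then have "\<epsilon> powr p \<le> norm (X m i - X n i) powr p" using ep p0 by (intro powr_mono2) (auto simp: dist_norm)
      also have "\<dots> \<le> (\<Sum>i<Suc i. norm (X m i - X n i) powr p)" by (simp add: sum_nonneg)
      also have "\<dots> \<le> c * (e m + e n)" by (rule part)
      also have "\<dots> < \<epsilon> powr p" using J[OF that(1)] J[OF that(2)] by (simp add: distrib_left)
      finally show False by simp
    qed
    then show "\<exists>M. \<forall>m\<ge>M. \<forall>n\<ge>M. dist (X m i) (X n i) < \<epsilon>" by blast
  qed
  note Cau = this
  define y where "y = (\<lambda>i. lim (\<lambda>n. X n i))"
  have y: "(\<lambda>n. X n i) \<longlonglongrightarrow> y i" for i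
    unfolding y_def using Cauchy_convergent[OF Cau] by (simp only: convergent_LIMSEQ_iff)
  have part': "(\<Sum>i<k. norm (X n i - y i) powr p) \<le> c * e n" for k n
  proof (rule LIMSEQ_le)
    show "(\<lambda>m. \<Sum>i<k. norm (X n i - X m i) powr p) \<longlonglongrightarrow> (\<Sum>i<k. norm (X n i - y i) powr p)"
      using p0 by (intro tendsto_sum tendsto_powr' tendsto_intros y) auto
    have "(\<lambda>m. c * (e n + e m)) \<longlonglongrightarrow> c * (e n + 0)" by (intro tendsto_intros elim)
    then show "(\<lambda>m. c * (e n + e m)) \<longlonglongrightarrow> c * e n" by simp
  qed (use part in blast)
  have D: "(\<lambda>i. X n i - y i) \<in> lp_space p" for n
    unfolding lp_space_def mem_Collect_eq by (rule summableI_nonneg_bounded[OF _ part']) auto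
  have yl: "y \<in> lp_space p" using synth_diff(1)[OF X(1)[of 0] D[of 0]] by simp
  have "hpow p (\<lambda>z. F n z - synth y z) \<le> 2 powr p * B * (c * e n)" for n
  proof -
    have "hpow p (\<lambda>z. F n z - synth y z) = hpow p (synth (\<lambda>i. X n i - y i))"
      using synth_diff(2)[OF X(1) yl, of n] by (simp add: X(2))
    also have "\<dots> \<le> 2 powr p * B * (\<Sum>i. norm (X n i - y i) powr p)" by (rule hpow_synth_le[OF D])
    also have "(\<Sum>i. norm (X n i - y i) powr p) \<le> c * e n"
      by (rule suminf_le_const[OF summable_x[OF D] part'])
    finally show ?thesis using AB by (simp add: mult_left_mono)
  qed
  note Fy = this
  \<comment> \<open>\<open>h\<close> and \<open>synth y\<close> are limits of the same sequence. A
    vanishing norm identifies them at every point, also outside the disc, where elements of H^p are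
    0.\<close>
  have "hpow p (\<lambda>z. h z - synth y z) \<le> 2 powr p * (0 + 2 powr p * B * (c * 0))"
  proof (rule LIMSEQ_le_const)
    show "(\<lambda>n. 2 powr p * (e n + 2 powr p * B * (c * e n))) \<longlonglongrightarrow> 2 powr p * (0 + 2 powr p * B * (c * 0))"
      by (intro tendsto_intros elim)
    have "hpow p (\<lambda>z. h z - synth y z) \<le> 2 powr p * (e n + 2 powr p * B * (c * e n))" for n
    proof -
      have "hpow p (\<lambda>z. h z - synth y z) \<le> 2 powr p * (hpow p (\<lambda>z. h z - F n z) + hpow p (\<lambda>z. F n z - synth y z))"
        by (rule hpow_triangle[OF h FH synth_hardy[OF yl] p0])
      also have "\<dots> \<le> 2 powr p * (e n + 2 powr p * B * (c * e n))"
        unfolding e_def[symmetric] hpow_diff_commute[of p h] by (intro mult_left_mono add_left_mono Fy) auto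
      finally show ?thesis .
    qed
    then show "\<exists>N. \<forall>n\<ge>N. hpow p (\<lambda>z. h z - synth y z) \<le> 2 powr p * (e n + 2 powr p * B * (c * e n))" by blast
  qed
  then have "(\<lambda>z. h z - synth y z) = (\<lambda>z. 0)"
    by (intro hpow_eq_0[OF hardy_diff(1)[OF h synth_hardy[OF yl] p0] p0]) simp
  then have "h = synth y" by (auto simp: fun_eq_iff)
  then show "h \<in> synth ` lp_space p" using yl by blast
qed

lemma lp_norm_bounds:
  assumes x: "x \<in> lp_space p"
  shows "(A / 2 powr p) powr (1/p) * lp_norm p x \<le> hardy_norm p (synth x)"
    and "hardy_norm p (synth x) \<le> (2 powr p * B) powr (1/p) * lp_norm p x"
proof -
  have s0: "0 \<le> (\<Sum>n. norm (x n) powr p)" by (rule suminf_nonneg[OF summable_x[OF x]]) auto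
  have "(A / 2 powr p) powr (1/p) * lp_norm p x = (A / 2 powr p * (\<Sum>n. norm (x n) powr p)) powr (1/p)"
    unfolding lp_norm_def using AB s0 by (intro powr_mult[symmetric])
  also have "\<dots> \<le> hardy_norm p (synth x)" unfolding hardy_norm_eq
    using AB s0 p0 by (intro powr_mono2 hpow_synth_ge[OF x]) auto
  finally show "(A / 2 powr p) powr (1/p) * lp_norm p x \<le> hardy_norm p (synth x)" .
  have "hardy_norm p (synth x) \<le> (2 powr p * B * (\<Sum>n. norm (x n) powr p)) powr (1/p)" unfolding hardy_norm_eq
    using p0 by (intro powr_mono2 hpow_synth_le[OF x] hpow_nonneg[OF synth_hardy[OF x]]) auto
  also have "\<dots> = (2 powr p * B) powr (1/p) * lp_norm p x"
    unfolding lp_norm_def using AB s0 by (intro powr_mult)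
  finally show "hardy_norm p (synth x) \<le> (2 powr p * B) powr (1/p) * lp_norm p x" .
qed

lemma iso_to_lp_range: "iso_to_lp p (synth ` lp_space p)"
  unfolding iso_to_lp_def
proof (intro exI conjI ballI allI)
  show "0 < (A / 2 powr p) powr (1/p)" "0 < (2 powr p * B) powr (1/p)" using AB by auto
  show "bij_betw synth (lp_space p) (synth ` lp_space p)" using inj_synth by (rule inj_on_imp_bij_betw)
qed (use lp_norm_bounds synth_lincomb in auto)

lemma subspace_range: "complex_subspace (synth ` lp_space p)"
  unfolding complex_subspace_def
proof (intro conjI ballI allI)
  have 0: "(\<lambda>n. 0) \<in> lp_space p" using p0 by (simp add: lp_space_def)
  moreover have "synth (\<lambda>n. 0) = (\<lambda>z. 0)" by (simp add: synth_def[abs_def])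
  ultimately show "(\<lambda>z. 0) \<in> synth ` lp_space p" by (metis image_eqI)
  show "(\<lambda>z. u z + v z) \<in> synth ` lp_space p" if uv: "u \<in> synth ` lp_space p" "v \<in> synth ` lp_space p" for u v
  proof -
    obtain x y where xy: "x \<in> lp_space p" "y \<in> lp_space p" "u = synth x" "v = synth y" using uv by blast
    show ?thesis using lp_space_lincomb[OF xy(1,2) p0, of 1 1] synth_lincomb[OF xy(1,2), of 1 1] xy(3,4) by (auto intro!: image_eqI)
  qed
  show "(\<lambda>z. c * u z) \<in> synth ` lp_space p" if uc: "u \<in> synth ` lp_space p" for u c
  proof -
    obtain x where x: "x \<in> lp_space p" "u = synth x" using uc by blast
    show ?thesis using lp_space_lincomb[OF x(1) x(1) p0, of c 0] synth_lincomb[OF x(1) x(1), of c 0] x(2) by (auto intro!: image_eqI)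
  qed
qed

end

theorem theorem1p1:
  fixes g :: "complex \<Rightarrow> complex" and p :: real and M :: "(complex \<Rightarrow> complex) set"
  assumes "g \<in> BMOA" and "1 \<le> p" and "p \<noteq> 2"
    and "M \<subseteq> hardy p" and "complex_subspace M" and "hardy_closed p M"
    and "infinite_dimensional M"
    and "\<exists>c>0. \<forall>f\<in>M. hardy_norm p (volterra g f) \<ge> c * hardy_norm p f"
  shows "\<exists>N. N \<subseteq> M \<and> complex_subspace N \<and> hardy_closed p N \<and> iso_to_lp p N"
proof -
  have p0: "p > 0" using assms(2) by simp
  obtain B where g: "g holomorphic_on ball 0 1" "bmoa_bound g B" using BMOA_imp_bmoa_bound[OF assms(1)] by blast
  obtain K where K: "K > 0" "\<And>f. f \<in> hardy p \<Longrightarrow> volterra g f \<in> hardy p \<and> hpow p (volterra g f) \<le> K * hpow p f"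
    using volterra_bounded[OF g assms(2)] by blast
  obtain c where c: "c > 0" "\<And>f. f \<in> M \<Longrightarrow> c * hardy_norm p f \<le> hardy_norm p (volterra g f)" using assms(8) by blast
  \<comment> \<open>The hypothesis concerns norms; for p-th powers its constant becomes c^p.\<close>
  have low: "c powr p * hpow p f \<le> hpow p (volterra g f)" if f: "f \<in> M" for f
  proof -
    have fH: "f \<in> hardy p" and vH: "volterra g f \<in> hardy p" using f assms(4) K(2) by auto
    have n0: "0 \<le> hardy_norm p f" by (simp add: hardy_norm_eq)
    have "(c * hardy_norm p f) powr p \<le> hardy_norm p (volterra g f) powr p"
      using c(1) c(2)[OF f] n0 p0 by (intro powr_mono2) auto
    then show ?thesis using c(1) n0 hardy_norm_powr[OF fH p0] hardy_norm_powr[OF vH p0] by (simp add: powr_mult)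
  qed
  obtain f :: "nat \<Rightarrow> complex \<Rightarrow> complex" and A C :: real where f: "\<And>n. f n \<in> M" "A > 0" "C > 0"
    "\<And>N a. A * (\<Sum>n<N. norm (a n) powr p) \<le> hpow p (\<lambda>z. \<Sum>n<N. a n * f n z)"
    "\<And>N a. hpow p (\<lambda>z. \<Sum>n<N. a n * f n z) \<le> C * (\<Sum>n<N. norm (a n) powr p)"
    by (rule lp_sequence_in_subspace[OF g assms(2,4,5,7) _ low]) (use c(1) in auto)
  interpret lp_basic_sequence p A C f
    using assms(2,4) f by unfold_locales auto
  show ?thesis
  proof (intro exI conjI)
    show "synth ` lp_space p \<subseteq> M" using synth_in_closed_subspace[OF _ assms(5,6) f(1)] by blast
    show "complex_subspace (synth ` lp_space p)" by (rule subspace_range)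
    show "hardy_closed p (synth ` lp_space p)" by (rule closed_range)
    show "iso_to_lp p (synth ` lp_space p)" by (rule iso_to_lp_range)
  qed
qed

end
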